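(* Let $(C,0)\subset(\mathbb{C}^n,0)$ be a reduced curve singularity with irreducible components $C_1,\dots,C_r$. Then $X_C(\underline{t})=P_C(\underline{t})$, where $X_C$ and $P_C$ are as defined in the context.
   Context: Let $\varphi_i:(\mathbb{C},0)\to(\mathbb{C}^n,0)$, $i=1,\dots,r$, be parameterizations (uniformizations) of the branches $C_i$ (analytic germs with image $C_i$, isomorphisms onto $C_i$ outside the origin), with coordinate $\tau_i$ on the source. For a germ $g\in\mathcal{O}_{\mathbb{C}^n,0}$ write $g\circ\varphi_i(\tau_i)=a_i\tau_i^{v_i}+(\text{higher order terms})$ with $a_i\neq 0$; set $v_i(g)=v_i\in\mathbb{Z}_{\ge0}$, $a_i(g)=a_i$ (if $g\circ\varphi_i\equiv0$, $v_i(g)=+\infty$ and $a_i(g)$ is undefined), $\underline{v}(g)=(v_1(g),\dots,v_r(g))$. For $\underline{v}\in\mathbb{Z}^r$ let $J(\underline{v})=\{g\in\mathcal{O}_{\mathbb{C}^n,0}: v_i(g)\ge v_i \text{ for all } i\}$, and let $j_{\underline{v}}:J(\underline{v})\to\mathbb{C}^r$ send $g$ to $(a_1,\dots,a_r)$, where $a_i$ is the coefficient of $\tau_i^{v_i}$ in $g\circ\varphi_i(\tau_i)$ (possibly $0$). Put $\underline{1}=(1,\dots,1)$ and $c(\underline{v})=\dim J(\underline{v})/J(\underline{v}+\underline{1})$. Extended semigroup and $X_C$: for $\underline{v}\in\mathbb{Z}_{\ge0}^r$ let $F_{\underline{v}}=\operatorname{Im} j_{\underline{v}}\cap(\mathbb{C}^*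 )^r$ (the set of $\underline{a}(g)$ over all $g$ with $\underline{v}(g)=\underline{v}$), and $\mathbb{P}F_{\underline{v}}$ its quotient by the diagonal action of $\mathbb{C}^*$ (a complement of a hyperplane arrangement in a projective space, possibly empty). Define $X_C(\underline{t})=\sum_{\underline{v}\in\mathbb{Z}^r_{\ge0}}\chi(\mathbb{P}F_{\underline{v}})\,\underline{t}^{\underline{v}}$, where $\underline{t}^{\underline{v}}=t_1^{v_1}\cdots t_r^{v_r}$ and $\chi$ is the Euler characteristic defined by $\chi(X)=\sum_q(-1)^q\dim H_q(X^*,*;\mathbb{R})$, $X^*$ the one-point compactification of $X$ with added point $*$ (this is additive on semialgebraic sets; $\chi(\emptyset)=0$). Poincaré series $P_C$: let $\mathcal{L}(\underline{t})=\sum_{\underline{v}\in\mathbb{Z}^r}c(\underline{v})\underline{t}^{\underline{v}}$ (a Laurent series possibly infinite in all directions) and $P'_C(\underline{t})=\mathcal{L}(\underline{t})\cdot\prod_{i=1}^r(t_i-1)$, which is a polynomial (for $r=1$, a power series); for $r>1$, $P'_C$ is divisible by $t_1\cdots t_r-1$. Define $P_C(\underline{t})=P'_C(\underline{t})/(t_1\cdots t_r-1)$ (a polynomial for $r>1$, a power series for $r=1$). *)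

theory Defs
  imports "HOL-Analysis.Analysis" "HOL-Homology.Homology"
begin

definition holo_germ :: "(complex^'n \<Rightarrow> complex) \<Rightarrow> bool" where
  "holo_germ g \<longleftrightarrow> (\<exists>e>0. \<forall>z\<in>ball 0 e. \<exists>L. (g has_derivative L) (at z) \<and>
       (\<forall>v. L (\<i> *s v) = \<i> * L v))"

definition tcoeff :: "(complex \<Rightarrow> complex) \<Rightarrow> int \<Rightarrow> complex" where
  "tcoeff f m = (if m < 0 then 0 else (deriv ^^ nat m) f 0 / of_nat (fact (nat m)))"

definition tord :: "(complex \<Rightarrow> complex) \<Rightarrow> enat" where
  "tord f = (if \<forall>k::nat. tcoeff f (int k) = 0 then \<infinity>
             else enat (LEAST k::nat. tcoeff f (int k) \<noteq> 0))"

text \<open>phi i : parametrization of branch i.\<close>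
definition Jset :: "('r \<Rightarrow> complex \<Rightarrow> complex^'n) \<Rightarrow> ('r \<Rightarrow> int) \<Rightarrow> (complex^'n \<Rightarrow> complex) set" where
  "Jset \<phi> v = {g. holo_germ g \<and> (\<forall>i. v i \<le> 0 \<or> enat (nat (v i)) \<le> tord (g \<circ> \<phi> i))}"

definition quot_dim :: "('a \<Rightarrow> complex) set \<Rightarrow> ('a \<Rightarrow> complex) set \<Rightarrow> nat" where
  "quot_dim A B = Sup {k. \<exists>g::nat \<Rightarrow> 'a \<Rightarrow> complex. (\<forall>j<k. g j \<in> A) \<and>
      (\<forall>a::nat \<Rightarrow> complex. (\<lambda>z. \<Sum>j<k. a j * g j z) \<in> B \<longrightarrow> (\<forall>j<k. a j = 0))}"

definition cdim :: "('r \<Rightarrow> complex \<Rightarrow> complex^'n) \<Rightarrow> ('r \<Rightarrow> int) \<Rightarrow> nat" where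
  "cdim \<phi> v = quot_dim (Jset \<phi> v) (Jset \<phi> (\<lambda>i. v i + 1))"

text \<open>Coefficients of P'_C = L(t) * prod_i (t_i - 1).\<close>
definition Pprime_coeff :: "('r::finite \<Rightarrow> complex \<Rightarrow> complex^'n) \<Rightarrow> ('r \<Rightarrow> int) \<Rightarrow> int" where
  "Pprime_coeff \<phi> v = (\<Sum>S\<in>Pow (UNIV::'r set).
      (-1) ^ card (UNIV - S) * int (cdim \<phi> (\<lambda>i. v i - (if i \<in> S then 1 else 0))))"

text \<open>P_C = P'_C / (t_1...t_r - 1): the unique power series Q (coefficients supported on
  Z_{>=0}^r) with Q * (t_1 ... t_r - 1) = P'_C.\<close>
definition Poincare_coeff :: "('r::finite \<Rightarrow> complex \<Rightarrow> complex^'n) \<Rightarrow> ('r \<Rightarrow> int) \<Rightarrow> int" where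
  "Poincare_coeff \<phi> = (THE Q. (\<forall>v. (\<exists>i. v i < 0) \<longrightarrow> Q v = 0) \<and>
       (\<forall>v. Q (\<lambda>i. v i - 1) - Q v = Pprime_coeff \<phi> v))"

definition quotient_topology :: "'a topology \<Rightarrow> ('a \<Rightarrow> 'b) \<Rightarrow> 'b topology" where
  "quotient_topology X f = topology (\<lambda>U. U \<subseteq> f ` topspace X \<and> openin X {x \<in> topspace X. f x \<in> U})"

text \<open>Free rank of an abelian group (= dim of G \<otimes> R).\<close>
definition free_rank :: "('a, 'b) monoid_scheme \<Rightarrow> nat" where
  "free_rank G = Sup {card S | S. finite S \<and> S \<subseteq> carrier G \<and>
      (\<forall>n::'a \<Rightarrow> int. finprod G (\<lambda>x. x [^]\<^bsub>G\<^esub> n x) S = \<one>\<^bsub>G\<^esub> \<longrightarrow> (\<forall>x\<in>S. n x = 0))}"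

text \<open>chi(X) = sum_q (-1)^q dim H_q(X^*, *; R), X^* the one-point compactification.\<close>
definition euler_char :: "'a topology \<Rightarrow> int" where
  "euler_char X = (\<Sum>q\<in>{q::nat. free_rank (relative_homology_group (int q)
        (Alexandroff_compactification X) {None}) \<noteq> 0}.
      (-1) ^ q * int (free_rank (relative_homology_group (int q)
        (Alexandroff_compactification X) {None})))"

definition Fset :: "('r \<Rightarrow> complex \<Rightarrow> complex^'n) \<Rightarrow> ('r \<Rightarrow> nat) \<Rightarrow> ('r \<Rightarrow> complex) set" where
  "Fset \<phi> v = {(\<lambda>i. tcoeff (g \<circ> \<phi> i) (int (v i))) | g.
                 holo_germ g \<and> (\<forall>i. tord (g \<circ> \<phi> i) = enat (v i))}"

definition Cstar_orbit :: "('r \<Rightarrow> complex) \<Rightarrow> ('r \<Rightarrow> complex) set" where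
  "Cstar_orbit a = {(\<lambda>i. c * a i) | c. c \<noteq> 0}"

definition PF_top :: "('r \<Rightarrow> complex \<Rightarrow> complex^'n) \<Rightarrow> ('r \<Rightarrow> nat) \<Rightarrow> ('r \<Rightarrow> complex) set topology" where
  "PF_top \<phi> v = quotient_topology (subtopology euclidean (Fset \<phi> v)) Cstar_orbit"

definition X_coeff :: "('r \<Rightarrow> complex \<Rightarrow> complex^'n) \<Rightarrow> ('r \<Rightarrow> int) \<Rightarrow> int" where
  "X_coeff \<phi> v = (if \<forall>i. 0 \<le> v i then euler_char (PF_top \<phi> (\<lambda>i. nat (v i))) else 0)"

definition curve_parametrization :: "('r \<Rightarrow> complex \<Rightarrow> complex^'n) \<Rightarrow> bool" where
  "curve_parametrization \<phi> \<longleftrightarrow> (\<exists>e0>0.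
     (\<forall>i. (\<forall>k. (\<lambda>t. \<phi> i t $ k) holomorphic_on ball 0 e0) \<and> \<phi> i 0 = 0 \<and>
          inj_on (\<phi> i) (ball 0 e0)) \<and>
     (\<forall>i j. i \<noteq> j \<longrightarrow> (\<forall>e. 0 < e \<and> e \<le> e0 \<longrightarrow> (\<forall>U. open U \<and> 0 \<in> U \<longrightarrow>
          \<phi> i ` ball 0 e \<inter> U \<noteq> \<phi> j ` ball 0 e \<inter> U))))"

end

theory Submission
  imports Defs "HOL-Complex_Analysis.Cauchy_Integral_Formula"
begin

text \<open>
  Ranks are additive in exact sequences, so the Euler characteristic of the statement changes by \<open>(-1) ^ dim c\<close>
  when an open cell \<open>c\<close> is attached to a closed set; this only needs the homology of a punctured Euclidean space and
  a radial deformation towards the boundary of the cell. Normalising the coordinate \<open>i0\<close> identifies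
  \<open>\<P>F_v\<close> with the complement of coordinate hyperplanes in a complex affine space, which the orthants of
  \<open>\<complex>\<^sup>r\<close> cut into cells. The Euler characteristic of a flat, computed once by orthants and once as a single
  cell of even dimension, is \<open>1\<close>, so inclusion-exclusion expresses that of \<open>\<P>F_v\<close> as the sum over all
  \<open>I\<close> not containing \<open>i0\<close> of \<open>(-1) ^ card I * dim (J(v + 1_I) / J(v + 1_I + e_i0))\<close>.
  The difference of these sums at \<open>v - 1\<close> and at \<open>v\<close> is the coefficient of \<open>P'_C\<close> at \<open>v\<close>, and this
  recursion together with the vanishing for negative \<open>v\<close> characterises \<open>P_C\<close>.
\<close>

section \<open>Ranks of abelian groups\<close>

text \<open>Two features of the definitions shape the argument. The Euler characteristic is read off
  from free ranks of integral relative homology, so additivity has to come from long exact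
  sequences, and finiteness of all the ranks involved has to be carried along with it. The cells are
  in general unbounded, and part of their frontier may lie outside the space under consideration.
  All these missing points are collapsed to the added point \<open>None\<close>; this is why a cell
  can be parametrised by a whole closed ball even if its closure in the space is not compact. The
  signs of individual cells are never computed, only their sums over flats are. On the algebraic
  side every dimension is reached in steps of 0 or 1, because raising one exponent imposes a single
  linear condition.\<close>

definition zcomb :: "('a, 'b) monoid_scheme \<Rightarrow> 'i set \<Rightarrow> ('i \<Rightarrow> 'a) \<Rightarrow> ('i \<Rightarrow> int) \<Rightarrow> 'a" where
  "zcomb G I f n = finprod G (\<lambda>i. f i [^]\<^bsub>G\<^esub> n i) I"

text \<open>Stated for families, since homomorphisms and gluing produce families rather than
  subsets; independent families are injective, which leads back to sets.\<close>

definition zindep :: "('a, 'b) monoid_scheme \<Rightarrow> 'i set \<Rightarrow> ('i \<Rightarrow> 'a) \<Rightarrow> bool" where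
  "zindep G I f \<longleftrightarrow> finite I \<and> f \<in> I \<rightarrow> carrier G \<and>
     (\<forall>n. zcomb G I f n = \<one>\<^bsub>G\<^esub> \<longrightarrow> (\<forall>i\<in>I. n i = 0))"

text \<open>A relation rather than a \<open>Sup\<close>: it asserts that the maximum is attained,
  whereas \<open>Sup\<close> of an unbounded set of naturals carries no information. Taking a subset
  \<open>H\<close> of the carrier lets kernels and images be measured in the ambient group.\<close>

definition srank :: "('a, 'b) monoid_scheme \<Rightarrow> 'a set \<Rightarrow> nat \<Rightarrow> bool" where
  "srank G H r \<longleftrightarrow> (\<exists>S\<subseteq>H. zindep G S (\<lambda>x. x) \<and> card S = r) \<and>
     (\<forall>S\<subseteq>H. zindep G S (\<lambda>x. x) \<longrightarrow> card S \<le> r)"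

lemma srank_unique: "srank G H r \<Longrightarrow> srank G H r' \<Longrightarrow> r = r'"
  unfolding srank_def by (meson le_antisym)

lemma free_rank_eq:
  assumes "srank G (carrier G) r"
  shows "free_rank G = r"
proof -
  have "{card S | S. finite S \<and> S \<subseteq> carrier G \<and>
      (\<forall>n::'a \<Rightarrow> int. finprod G (\<lambda>x. x [^]\<^bsub>G\<^esub> n x) S = \<one>\<^bsub>G\<^esub> \<longrightarrow> (\<forall>x\<in>S. n x = 0))}
    = {card S | S. S \<subseteq> carrier G \<and> zindep G S (\<lambda>x. x)}" (is "?A = ?B")
    by (auto simp: zindep_def zcomb_def)
  moreover have "Sup ?B = r"
    by (rule cSup_eq_maximum) (use assms in \<open>auto simp: srank_def\<close>)
  ultimately show ?thesis
    by (simp add: free_rank_def)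
qed

context comm_group
begin

lemma zcomb_closed [simp]: "f \<in> I \<rightarrow> carrier G \<Longrightarrow> zcomb G I f n \<in> carrier G"
  unfolding zcomb_def by (rule finprod_closed) auto

lemma zcomb_add:
  assumes "f \<in> I \<rightarrow> carrier G"
  shows "zcomb G I f (\<lambda>i. m i + n i) = zcomb G I f m \<otimes> zcomb G I f n"
proof -
  have "zcomb G I f (\<lambda>i. m i + n i) = finprod G (\<lambda>i. f i [^] m i \<otimes> f i [^] n i) I"
    unfolding zcomb_def by (rule finprod_cong') (use assms in \<open>auto simp: int_pow_mult Pi_iff\<close>)
  also have "\<dots> = zcomb G I f m \<otimes> zcomb G I f n"
    unfolding zcomb_def by (rule finprod_multf) (use assms in auto)
  finally show ?thesis .
qed

lemma zcomb_scale:
  assumes "f \<in> I \<rightarrow> carrier G" "finite I"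
  shows "zcomb G I f (\<lambda>i. m i * c) = zcomb G I f m [^] (c::int)"
  using assms(2,1)
proof (induction I)
  case empty
  then show ?case by (simp add: zcomb_def)
next
  case (insert x F)
  then have f: "f \<in> F \<rightarrow> carrier G" "f x \<in> carrier G" by auto
  then have *: "(\<lambda>i. f i [^] (m i * c)) \<in> F \<rightarrow> carrier G" "(\<lambda>i. f i [^] (m i)) \<in> F \<rightarrow> carrier G"
    by auto
  have "zcomb G (insert x F) f (\<lambda>i. m i * c) = f x [^] (m x * c) \<otimes> zcomb G F f (\<lambda>i. m i * c)"
    unfolding zcomb_def by (subst finprod_insert) (use insert f * in auto)
  also have "\<dots> = (f x [^] m x \<otimes> zcomb G F f m) [^] c"
    using insert f by (simp add: int_pow_distrib int_pow_pow)
  also have "f x [^] m x \<otimes> zcomb G F f m = zcomb G (insert x F) f m"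
    unfolding zcomb_def by (subst finprod_insert) (use insert f * in auto)
  finally show ?case .
qed

lemma zcomb_zero: "(\<And>i. i \<in> I \<Longrightarrow> n i = 0) \<Longrightarrow> zcomb G I f n = \<one>"
  unfolding zcomb_def by (rule finprod_one_eqI) simp

lemma zcomb_zcomb:
  assumes "f \<in> I \<rightarrow> carrier G" "finite I" "finite F"
  shows "zcomb G F (\<lambda>s. zcomb G I f (m s)) c = zcomb G I f (\<lambda>i. \<Sum>s\<in>F. m s i * c s)"
  using assms(3)
proof (induction F)
  case empty
  then show ?case using zcomb_zero[of I "\<lambda>_. 0" f] by (simp add: zcomb_def)
next
  case (insert x F)
  have "zcomb G (insert x F) (\<lambda>s. zcomb G I f (m s)) c
     = zcomb G I f (m x) [^] c x \<otimes> zcomb G F (\<lambda>s. zcomb G I f (m s)) c"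
    unfolding zcomb_def[of G "insert x F"] zcomb_def[of G F]
    by (subst finprod_insert) (use insert assms(1) in auto)
  also have "\<dots> = zcomb G I f (\<lambda>i. m x i * c x) \<otimes> zcomb G I f (\<lambda>i. \<Sum>s\<in>F. m s i * c s)"
    using insert assms by (simp add: zcomb_scale)
  also have "\<dots> = zcomb G I f (\<lambda>i. m x i * c x + (\<Sum>s\<in>F. m s i * c s))"
    using assms by (simp add: zcomb_add)
  finally show ?case using insert by simp
qed

lemma zcomb_mono_neutral:
  assumes "f \<in> I \<rightarrow> carrier G" "finite I" "J \<subseteq> I" "\<And>i. i \<in> I - J \<Longrightarrow> n i = 0"
  shows "zcomb G I f n = zcomb G J f n"
  unfolding zcomb_def
  by (rule finprod_mono_neutral_cong_right) (use assms in auto)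

lemma zindep_imp_inj_on:
  assumes "zindep G I f"
  shows "inj_on f I"
proof (rule inj_onI, rule ccontr)
  fix i j assume ij: "i \<in> I" "j \<in> I" "f i = f j" "i \<noteq> j"
  define n where "n = (\<lambda>k. if k = i then (1::int) else if k = j then -1 else 0)"
  have f: "f \<in> I \<rightarrow> carrier G" "finite I" using assms by (auto simp: zindep_def)
  have "zcomb G I f n = zcomb G {i,j} f n"
    by (rule zcomb_mono_neutral) (use ij f in \<open>auto simp: n_def\<close>)
  also have "\<dots> = f i [^] (1::int) \<otimes> f j [^] (-1::int)"
    unfolding zcomb_def using ij f by (simp add: Pi_iff n_def)
  also have "\<dots> = \<one>"
    using ij f by (auto simp: Pi_iff int_pow_neg)
  finally have "n i = 0"
    using assms ij unfolding zindep_def by blast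
  then show False by (simp add: n_def)
qed

lemma zindep_image:
  assumes "zindep G I f"
  shows "zindep G (f ` I) (\<lambda>x. x)"
proof -
  have inj: "inj_on f I" using assms by (rule zindep_imp_inj_on)
  have f: "f \<in> I \<rightarrow> carrier G" "finite I" using assms by (auto simp: zindep_def)
  have "zcomb G (f ` I) (\<lambda>x. x) n = zcomb G I f (n \<circ> f)" for n
    unfolding zcomb_def by (subst finprod_reindex) (use inj f in \<open>auto simp: o_def\<close>)
  then show ?thesis
    using assms by (auto simp: zindep_def)
qed

lemma srank_card_le:
  assumes "srank G H r" "zindep G I f" "f ` I \<subseteq> H"
  shows "card I \<le> r"
  using assms zindep_image[OF assms(2)] zindep_imp_inj_on[OF assms(2)]
  by (metis card_image srank_def)

lemma srank_eqI:
  assumes "zindep G I f" "f ` I \<subseteq> H" "card I = r"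
    "\<And>S. S \<subseteq> H \<Longrightarrow> zindep G S (\<lambda>x. x) \<Longrightarrow> card S \<le> r"
  shows "srank G H r"
  unfolding srank_def
  using assms zindep_image[OF assms(1)] zindep_imp_inj_on[OF assms(1)]
  by (metis card_image)

lemma zindep_empty: "zindep G {} f"
  by (auto simp: zindep_def)

lemma srank_exists:
  assumes "\<And>S. S \<subseteq> H \<Longrightarrow> zindep G S (\<lambda>x. x) \<Longrightarrow> card S \<le> r"
  obtains s where "srank G H s"
proof -
  let ?P = "\<lambda>k. \<exists>S\<subseteq>H. zindep G S (\<lambda>x. x) \<and> card S = k"
  have "?P 0" using zindep_empty[of "\<lambda>x. x"] by (intro exI[of _ "{}"]) auto
  moreover have b: "k \<le> r" if "?P k" for k using that assms by auto
  ultimately have "?P (Greatest ?P)" by (rule GreatestI_nat[where P="?P"])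
  moreover have "k \<le> Greatest ?P" if "?P k" for k
    using that b by (rule Greatest_le_nat[where P="?P"])
  ultimately show ?thesis
    by (intro that[of "Greatest ?P"]) (auto simp: srank_def)
qed

lemma srank_one: "srank G {\<one>} 0"
proof (rule srank_eqI[OF zindep_empty])
  fix S assume S: "S \<subseteq> {\<one>}" "zindep G S (\<lambda>x. x)"
  have "S = {}"
  proof (rule ccontr)
    assume "S \<noteq> {}"
    then have "S = {\<one>}" using S by auto
    then have "zcomb G S (\<lambda>x. x) (\<lambda>_. 1) = \<one>" by (simp add: zcomb_def)
    then show False using S \<open>S = {\<one>}\<close> unfolding zindep_def
      by (metis insertI1 zero_neq_one)
  qed
  then show "card S \<le> 0" by simp
qed auto

end

section \<open>Rank-nullity for homomorphisms of abelian groups\<close>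

lemma hom_zcomb:
  assumes "comm_group A" "comm_group B" "h \<in> hom A B" "f \<in> I \<rightarrow> carrier A" "finite I"
  shows "h (zcomb A I f n) = zcomb B I (\<lambda>i. h (f i)) n"
proof -
  interpret A: comm_group A by fact
  interpret B: comm_group B by fact
  interpret h: group_hom A B h by unfold_locales fact
  show ?thesis using assms(5,4)
  proof (induction I)
    case empty
    then show ?case by (simp add: zcomb_def)
  next
    case (insert x F)
    have "h (zcomb A (insert x F) f n) = h (f x [^]\<^bsub>A\<^esub> n x \<otimes>\<^bsub>A\<^esub> zcomb A F f n)"
      unfolding zcomb_def by (subst A.finprod_insert) (use insert in auto)
    also have "\<dots> = h (f x) [^]\<^bsub>B\<^esub> n x \<otimes>\<^bsub>B\<^esub> zcomb B F (\<lambda>i. h (f i)) n"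
      using insert by (subst h.hom_mult) (auto simp: h.hom_int_pow Pi_iff A.zcomb_closed)
    also have "\<dots> = zcomb B (insert x F) (\<lambda>i. h (f i)) n"
      unfolding zcomb_def by (subst B.finprod_insert) (use insert in \<open>auto intro!: B.int_pow_closed simp: Pi_iff\<close>)
    finally show ?case .
  qed
qed

text \<open>Elimination without division: \<open>T\<close> is a subset of \<open>S\<close> of
  largest size with independent images. Each further \<open>s\<close> takes part in a relation
  \<open>m s\<close> between images, and the same combination formed in \<open>A\<close> lies in the
  kernel. On \<open>S - T\<close> these combinations are a diagonal system.\<close>

lemma zindep_kernel_image_split:
  assumes A: "comm_group A" and B: "comm_group B" and h: "h \<in> hom A B" and S: "zindep A S (\<lambda>x. x)"
  obtains T k where "T \<subseteq> S" "zindep B T h" "zindep A (S - T) k" "k ` (S - T) \<subseteq> kernel A B h"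
proof -
  interpret A: comm_group A by fact
  interpret B: comm_group B by fact
  interpret h: group_hom A B h by unfold_locales fact
  have fin: "finite S" and SA: "S \<subseteq> carrier A" using S by (auto simp: zindep_def)
  let ?P = "\<lambda>T. T \<subseteq> S \<and> zindep B T h"
  have ex: "\<exists>T. ?P T" using B.zindep_empty[of h] by blast
  obtain T where T: "T \<subseteq> S" "zindep B T h" and Tmax: "\<And>T'. T' \<subseteq> S \<Longrightarrow> zindep B T' h \<Longrightarrow> card T' \<le> card T"
    using ex_has_greatest_nat[of ?P _ card "Suc (card S)"] ex
    by (metis (no_types, lifting) card_mono fin less_Suc_eq_le)
  have finT: "finite T" using T fin finite_subset by auto
  have "\<exists>m::'a \<Rightarrow> int. m s \<noteq> 0 \<and> (\<forall>x\<in>S - insert s T. m x = 0) \<and> zcomb B S h m = \<one>\<^bsub>B\<^esub>" if s: "s \<in> S - T" for s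
  proof -
    have "\<not> zindep B (insert s T) h"
      using Tmax[of "insert s T"] s T(1) finT by auto
    moreover have "h \<in> insert s T \<rightarrow> carrier B" using s T SA by auto
    ultimately obtain n i where n: "zcomb B (insert s T) h n = \<one>\<^bsub>B\<^esub>" "i \<in> insert s T" "n i \<noteq> 0"
      using finT unfolding zindep_def by auto
    \<comment> \<open>Otherwise the relation would involve only the independent images of
      \<open>T\<close> and be trivial.\<close>
    have ns: "n s \<noteq> 0"
    proof
      assume "n s = 0"
      then have "zcomb B (insert s T) h n = zcomb B T h n"
        using s T SA finT by (intro B.zcomb_mono_neutral) auto
      then have "\<forall>i\<in>T. n i = 0" using n T(2) by (auto simp: zindep_def)
      then show False using n \<open>n s = 0\<close> by auto
    qed
    define m where "m = (\<lambda>x. if x \<in> insert s T then n x else 0)"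
    have "zcomb B S h m = zcomb B (insert s T) h m"
      by (rule B.zcomb_mono_neutral) (use s T SA fin in \<open>auto simp: m_def\<close>)
    also have "\<dots> = zcomb B (insert s T) h n"
      unfolding zcomb_def by (rule B.finprod_cong') (use s T SA in \<open>auto simp: m_def\<close>)
    finally show ?thesis using ns n by (intro exI[of _ m]) (auto simp: m_def)
  qed
  then obtain m :: "'a \<Rightarrow> 'a \<Rightarrow> int" where m: "\<And>s. s \<in> S - T \<Longrightarrow> m s s \<noteq> 0"
      "\<And>s x. s \<in> S - T \<Longrightarrow> x \<in> S - insert s T \<Longrightarrow> m s x = 0"
      "\<And>s. s \<in> S - T \<Longrightarrow> zcomb B S h (m s) = \<one>\<^bsub>B\<^esub>"
    by metis
  define k where "k = (\<lambda>s. zcomb A S (\<lambda>x. x) (m s))"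
  have kc: "k s \<in> carrier A" for s unfolding k_def by (rule A.zcomb_closed) (use SA in auto)
  have "zindep A (S - T) k"
    unfolding zindep_def
  proof (intro conjI allI impI ballI)
    show "finite (S - T)" using fin by auto
    show "k \<in> S - T \<rightarrow> carrier A" using kc by auto
    fix c s assume c: "zcomb A (S - T) k c = \<one>\<^bsub>A\<^esub>" and s: "s \<in> S - T"
    have "zcomb A (S - T) k c = zcomb A S (\<lambda>x. x) (\<lambda>i. \<Sum>s\<in>S - T. m s i * c s)"
      unfolding k_def by (rule A.zcomb_zcomb) (use SA fin in auto)
    then have "(\<Sum>t\<in>S - T. m t s * c t) = 0"
      using c S s unfolding zindep_def by fastforce
    \<comment> \<open>\<open>m t\<close> vanishes on \<open>S - T\<close> away from
      \<open>t\<close>, so only the diagonal entry at \<open>s\<close> remains.\<close>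
    moreover have "(\<Sum>t\<in>S - T. m t s * c t) = (\<Sum>t\<in>{s}. m t s * c t)"
      by (rule sum.mono_neutral_right) (use s fin m(2) in auto)
    ultimately show "c s = 0" using m(1)[OF s] by simp
  qed
  moreover have "k ` (S - T) \<subseteq> kernel A B h"
  proof -
    have "h (k s) = zcomb B S h (m s)" for s
      unfolding k_def by (rule hom_zcomb[OF A B h]) (use SA fin in auto)
    then show ?thesis using kc m(3) by (auto simp: kernel_def)
  qed
  ultimately show ?thesis using that T by blast
qed

text \<open>Applying \<open>h\<close> to a relation kills the part on \<open>S\<close>, so the
  coefficients on \<open>T\<close> vanish first and those on \<open>S\<close> next. Indexing by a
  disjoint sum avoids asking whether the two families overlap.\<close>

lemma zindep_Plus:
  assumes A: "comm_group A" and B: "comm_group B" and h: "h \<in> hom A B"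
    and S: "zindep A S f" "f ` S \<subseteq> kernel A B h" and T: "zindep B T (h \<circ> g)" "g ` T \<subseteq> carrier A"
  shows "zindep A (Sum_Type.Plus S T) (case_sum f g)"
proof -
  interpret A: comm_group A by fact
  interpret B: comm_group B by fact
  interpret h: group_hom A B h by unfold_locales fact
  have fin: "finite S" "finite T" and f: "f \<in> S \<rightarrow> carrier A" and g: "g \<in> T \<rightarrow> carrier A"
    using S T by (auto simp: zindep_def)
  have *: "zcomb A (Sum_Type.Plus S T) (case_sum f g) n = zcomb A S f (n \<circ> Inl) \<otimes>\<^bsub>A\<^esub> zcomb A T g (n \<circ> Inr)" for n
  proof -
    have "zcomb A (Sum_Type.Plus S T) (case_sum f g) n =
        zcomb A (Inl ` S) (case_sum f g) n \<otimes>\<^bsub>A\<^esub> zcomb A (Inr ` T) (case_sum f g) n"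
      unfolding zcomb_def Plus_def
      by (rule A.finprod_Un_disjoint) (use fin f g in \<open>auto intro!: A.int_pow_closed\<close>)
    moreover have "zcomb A (Inl ` S) (case_sum f g) n = zcomb A S f (n \<circ> Inl)"
      unfolding zcomb_def by (subst A.finprod_reindex) (use f in \<open>auto intro!: A.int_pow_closed\<close>)
    moreover have "zcomb A (Inr ` T) (case_sum f g) n = zcomb A T g (n \<circ> Inr)"
      unfolding zcomb_def by (subst A.finprod_reindex) (use g in \<open>auto intro!: A.int_pow_closed\<close>)
    ultimately show ?thesis by simp
  qed
  show ?thesis
    unfolding zindep_def
  proof (intro conjI allI impI)
    show "finite (Sum_Type.Plus S T)" using fin by auto
    show "case_sum f g \<in> Sum_Type.Plus S T \<rightarrow> carrier A" using f g by auto
    fix n assume n: "zcomb A (Sum_Type.Plus S T) (case_sum f g) n = \<one>\<^bsub>A\<^esub>"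
    have "h (zcomb A S f (n \<circ> Inl)) = zcomb B S (\<lambda>i. h (f i)) (n \<circ> Inl)"
      by (rule hom_zcomb[OF A B h f fin(1)])
    also have "\<dots> = \<one>\<^bsub>B\<^esub>"
      unfolding zcomb_def by (rule B.finprod_one_eqI) (use S(2) in \<open>auto simp: kernel_def\<close>)
    finally have hS: "h (zcomb A S f (n \<circ> Inl)) = \<one>\<^bsub>B\<^esub>" .
    have "h (zcomb A (Sum_Type.Plus S T) (case_sum f g) n) = h (zcomb A T g (n \<circ> Inr))"
      using hS f g unfolding * by (subst h.hom_mult) auto
    then have "zcomb B T (h \<circ> g) (n \<circ> Inr) = \<one>\<^bsub>B\<^esub>"
      using n hom_zcomb[OF A B h g fin(2)] by (simp add: o_def)
    then have T0: "\<forall>i\<in>T. n (Inr i) = 0" using T(1) unfolding zindep_def by fastforce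
    then have "zcomb A T g (n \<circ> Inr) = \<one>\<^bsub>A\<^esub>" by (intro A.zcomb_zero) auto
    then have "zcomb A S f (n \<circ> Inl) = \<one>\<^bsub>A\<^esub>" using n f unfolding * by simp
    then show "\<forall>i\<in>Sum_Type.Plus S T. n i = 0" using T0 S(1) unfolding zindep_def by fastforce
  qed
qed

lemma (in comm_group) zindep_lift:
  assumes "zindep G T (\<lambda>x. x)" "T \<subseteq> h ` C"
  obtains g where "zindep G T (h \<circ> g)" "g ` T \<subseteq> C"
proof -
  define g where "g = inv_into C h"
  have g: "g t \<in> C \<and> h (g t) = t" if "t \<in> T" for t
    using that assms(2) unfolding g_def by (auto intro!: inv_into_into f_inv_into_f)
  have "zcomb G T (h \<circ> g) n = zcomb G T (\<lambda>x. x) n" for n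
    unfolding zcomb_def
    by (rule finprod_cong') (use g assms in \<open>auto simp: zindep_def\<close>)
  then show ?thesis
    by (intro that[of g]) (use g assms in \<open>auto simp: zindep_def\<close>)
qed

lemma srank_kernel_image:
  assumes A: "comm_group A" and B: "comm_group B" and h: "h \<in> hom A B"
    and a: "srank A (kernel A B h) a" and b: "srank B (h ` carrier A) b"
  shows "srank A (carrier A) (a + b)"
proof -
  obtain S T where S: "S \<subseteq> kernel A B h" "zindep A S (\<lambda>x. x)" "card S = a"
    and T: "T \<subseteq> h ` carrier A" "zindep B T (\<lambda>x. x)" "card T = b"
    using a b unfolding srank_def by metis
  obtain g where g: "zindep B T (h \<circ> g)" "g ` T \<subseteq> carrier A"
    using comm_group.zindep_lift[OF B T(2,1)] by blast
  have "zindep A (Sum_Type.Plus S T) (case_sum (\<lambda>x. x) g)"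
    by (rule zindep_Plus[OF A B h]) (use S g in auto)
  moreover have "card (Sum_Type.Plus S T) = a + b"
    using S T by (simp add: card_Plus zindep_def)
  moreover have "case_sum (\<lambda>x. x) g ` (Sum_Type.Plus S T) \<subseteq> carrier A"
    using S g by (auto simp: kernel_def)
  moreover have "card U \<le> a + b" if U: "zindep A U (\<lambda>x. x)" for U
  proof -
    obtain T k where T: "T \<subseteq> U" "zindep B T h" "zindep A (U - T) k" "k ` (U - T) \<subseteq> kernel A B h"
      using zindep_kernel_image_split[OF A B h U] by blast
    have "U \<subseteq> carrier A" "finite U" using U by (auto simp: zindep_def)
    then have "card T \<le> b"
      by (intro comm_group.srank_card_le[OF B b T(2)]) (use T(1) in auto)
    moreover have "card (U - T) \<le> a"
      by (rule comm_group.srank_card_le[OF A a T(3,4)])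
    moreover have "card U = card T + card (U - T)"
      using T(1) \<open>finite U\<close> by (metis card_Diff_subset card_mono finite_subset le_add_diff_inverse)
    ultimately show ?thesis by simp
  qed
  ultimately show ?thesis by (intro comm_group.srank_eqI[OF A]) auto
qed

text \<open>Finiteness of the rank passes to the kernel, which is a subset, and to the image,
  because independent elements lift. This allows both ranks to be named when an exact sequence is
  cut into pieces.\<close>

lemma srank_kernel_image_exists:
  assumes A: "comm_group A" and B: "comm_group B" and h: "h \<in> hom A B"
    and n: "srank A (carrier A) n"
  obtains a b where "srank A (kernel A B h) a" "srank B (h ` carrier A) b" "n = a + b"
proof -
  have "\<exists>a. srank A (kernel A B h) a"
  proof (rule comm_group.srank_exists[OF A, of "kernel A B h" n])
    fix S assume "S \<subseteq> kernel A B h" "zindep A S (\<lambda>x. x)"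
    then show "card S \<le> n" using n unfolding srank_def kernel_def by blast
  qed auto
  moreover have "\<exists>b. srank B (h ` carrier A) b"
  proof (rule comm_group.srank_exists[OF B, of "h ` carrier A" n])
    fix T assume T: "T \<subseteq> h ` carrier A" "zindep B T (\<lambda>x. x)"
    obtain g where g: "zindep B T (h \<circ> g)" "g ` T \<subseteq> carrier A"
      using comm_group.zindep_lift[OF B T(2,1)] by blast
    \<comment> \<open>Gluing with an empty kernel part: a lift of an independent family is
      independent.\<close>
    have "zindep A (Sum_Type.Plus {} T) (case_sum (\<lambda>x. x) g)"
      by (rule zindep_Plus[OF A B h]) (use g comm_group.zindep_empty[OF A] in auto)
    then have "card (Sum_Type.Plus {} T :: ('a + 'c) set) \<le> n"
      by (rule comm_group.srank_card_le[OF A n]) (use g in auto)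
    then show "card T \<le> n" using T by (simp add: card_Plus zindep_def)
  qed auto
  ultimately obtain a b where "srank A (kernel A B h) a" "srank B (h ` carrier A) b" by blast
  moreover from this have "n = a + b"
    using srank_kernel_image[OF A B h] srank_unique n by blast
  ultimately show ?thesis using that by blast
qed

lemma srank_iso:
  assumes A: "comm_group A" and B: "comm_group B" and iso: "A \<cong> B" and n: "srank A (carrier A) n"
  shows "srank B (carrier B) n"
proof -
  obtain h where h: "h \<in> hom A B" "bij_betw h (carrier A) (carrier B)"
    using iso by (auto simp: is_iso_def iso_def)
  interpret h: group_hom A B h
    using A B h by (auto simp: group_hom_def group_hom_axioms_def comm_group_def)
  obtain a b where ab: "srank A (kernel A B h) a" "srank B (h ` carrier A) b" "n = a + b"
    using srank_kernel_image_exists[OF A B h(1) n] .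
  have "kernel A B h = {\<one>\<^bsub>A\<^esub>}"
    using h(2) h.inj_iff_trivial_ker by (simp add: bij_betw_def)
  then have "a = 0" using ab(1) comm_group.srank_one[OF A] srank_unique by auto
  then show ?thesis using ab h by (simp add: bij_betw_def)
qed

lemma srank_trivial_group:
  assumes "comm_group A" "trivial_group A"
  shows "srank A (carrier A) 0"
  using assms comm_group.srank_one[of A] by (simp add: trivial_group_def)

lemma srank_integer_group: "srank integer_group (carrier integer_group) 1"
proof -
  interpret comm_group integer_group by (rule abelian_integer_group)
  have fp: "finprod integer_group f S = sum f S" if "finite S" for f :: "'i \<Rightarrow> int" and S
    using that by (induction S) (auto simp: Pi_iff)
  have pw: "x [^]\<^bsub>integer_group\<^esub> n = n * x" for x n :: int
    by simp
  have zc: "zcomb integer_group S f n = (\<Sum>i\<in>S. n i * f i)" if "finite S" for f :: "'i \<Rightarrow> int" and S n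
    using that by (simp add: zcomb_def fp pw)
  show ?thesis
  proof (rule srank_eqI)
    show "zindep integer_group {()} (\<lambda>_. 1::int)"
      by (auto simp: zindep_def zc)
    fix S :: "int set" assume S: "zindep integer_group S (\<lambda>x. x)"
    then have fin: "finite S" by (auto simp: zindep_def)
    have "x = y" if "x \<in> S" "y \<in> S" for x y
    proof (rule ccontr)
      assume "x \<noteq> y"
      \<comment> \<open>The relation \<open>y * x + (- x) * y = 0\<close>; its coefficients are not
        both zero, since \<open>x\<close> and \<open>y\<close> differ.\<close>
      define n where "n = (\<lambda>k. if k = x then y else if k = y then - x else 0)"
      have "zcomb integer_group S (\<lambda>x. x) n = (\<Sum>i\<in>{x,y}. n i * i)"
        unfolding zc[OF fin]
        by (rule sum.mono_neutral_right) (use that fin in \<open>auto simp: n_def\<close>)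
      also have "\<dots> = 0" using \<open>x \<noteq> y\<close> by (simp add: n_def)
      finally have "n x = 0" "n y = 0" using S that by (auto simp: zindep_def)
      then show False using \<open>x \<noteq> y\<close> by (auto simp: n_def)
    qed
    then show "card S \<le> 1" using fin by (simp add: card_le_Suc0_iff_eq)
  qed auto
qed

section \<open>Euler characteristics of pairs\<close>

text \<open>Finite ranks and vanishing above some \<open>N\<close> belong to the relation, so that
  alternating sums can be rearranged as finite sums.\<close>

definition euler_pair :: "'a topology \<Rightarrow> 'a set \<Rightarrow> int \<Rightarrow> bool" where
  "euler_pair X S e \<longleftrightarrow> (\<exists>h N.
     (\<forall>q. srank (relative_homology_group (int q) X S) (carrier (relative_homology_group (int q) X S)) (h q)) \<and>
     (\<forall>q>N. h q = 0) \<and> e = (\<Sum>q\<le>N. (-1) ^ q * int (h q)))"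

lemma alternating_sum_truncate:
  fixes h :: "nat \<Rightarrow> nat"
  assumes "\<forall>q>N. h q = 0" "N \<le> M"
  shows "(\<Sum>q\<le>M. (-1) ^ q * int (h q)) = (\<Sum>q\<le>N. (-1) ^ q * int (h q))"
  by (rule sum.mono_neutral_right) (use assms in auto)

lemma euler_char_eqI:
  assumes "euler_pair (Alexandroff_compactification X) {None} e"
  shows "euler_char X = e"
proof -
  obtain h N where h: "\<And>q. srank (relative_homology_group (int q) (Alexandroff_compactification X) {None})
        (carrier (relative_homology_group (int q) (Alexandroff_compactification X) {None})) (h q)"
    and N: "\<forall>q>N. h q = 0" and e: "e = (\<Sum>q\<le>N. (-1) ^ q * int (h q))"
    using assms unfolding euler_pair_def by blast
  have "free_rank (relative_homology_group (int q) (Alexandroff_compactification X) {None}) = h q" for q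
    by (rule free_rank_eq[OF h])
  then have "euler_char X = (\<Sum>q\<in>{q. h q \<noteq> 0}. (-1) ^ q * int (h q))"
    unfolding euler_char_def by simp
  also have "\<dots> = e"
    unfolding e by (rule sum.mono_neutral_left) (use N in \<open>auto simp: not_less[symmetric]\<close>)
  finally show ?thesis .
qed

lemma euler_pair_unique:
  assumes "euler_pair X S e" "euler_pair X S e'"
  shows "e = e'"
proof -
  obtain h N where h: "\<And>q. srank (relative_homology_group (int q) X S) (carrier (relative_homology_group (int q) X S)) (h q)"
    and N: "\<forall>q>N. h q = 0" and e: "e = (\<Sum>q\<le>N. (-1) ^ q * int (h q))"
    using assms(1) unfolding euler_pair_def by blast
  obtain h' N' where h': "\<And>q. srank (relative_homology_group (int q) X S) (carrier (relative_homology_group (int q) X S)) (h' q)"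
    and N': "\<forall>q>N'. h' q = 0" and e': "e' = (\<Sum>q\<le>N'. (-1) ^ q * int (h' q))"
    using assms(2) unfolding euler_pair_def by blast
  have "h' = h" using srank_unique[OF h h'] by auto
  then show ?thesis
    using alternating_sum_truncate[OF N, of "max N N'"] alternating_sum_truncate[OF N', of "max N N'"] e e' by simp
qed

lemma euler_pair_iso:
  assumes "euler_pair X S e"
    and "\<And>q::nat. relative_homology_group (int q) X S \<cong> relative_homology_group (int q) Y T"
  shows "euler_pair Y T e"
proof -
  have *: "srank (relative_homology_group (int q) X S) (carrier (relative_homology_group (int q) X S)) r
      \<Longrightarrow> srank (relative_homology_group (int q) Y T) (carrier (relative_homology_group (int q) Y T)) r" for q r
    by (rule srank_iso[OF abelian_relative_homology_group abelian_relative_homology_group assms(2)])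
  obtain h N where h: "\<And>q. srank (relative_homology_group (int q) X S) (carrier (relative_homology_group (int q) X S)) (h q)"
    and "\<forall>q>N. h q = 0" "e = (\<Sum>q\<le>N. (-1) ^ q * int (h q))"
    using assms(1) unfolding euler_pair_def by blast
  then show ?thesis
    unfolding euler_pair_def using *[OF h] by (intro exI[of _ h] exI[of _ N]) auto
qed

lemma euler_pair_homeomorphic_map:
  assumes "euler_pair X S e" "homeomorphic_map X Y f" "S \<subseteq> topspace X" "f ` S = T"
  shows "euler_pair Y T e"
  using euler_pair_iso[OF assms(1)] homeomorphic_map_relative_homology_iso[OF assms(2-4)] is_isoI by blast

lemma euler_pair_trivial:
  assumes "\<And>q::nat. trivial_group (relative_homology_group (int q) X S)"
  shows "euler_pair X S 0"
  unfolding euler_pair_def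
  by (rule exI[of _ "\<lambda>_. 0"], rule exI[of _ 0])
     (auto intro: srank_trivial_group[OF abelian_relative_homology_group assms])

lemma euler_pair_single:
  assumes "relative_homology_group (int k) X S \<cong> integer_group"
    and "\<And>q::nat. q \<noteq> k \<Longrightarrow> trivial_group (relative_homology_group (int q) X S)"
  shows "euler_pair X S ((-1) ^ k)"
  unfolding euler_pair_def
proof (rule exI[of _ "\<lambda>q. if q = k then 1 else 0"], rule exI[of _ k], intro conjI allI impI)
  fix q
  have "integer_group \<cong> relative_homology_group (int k) X S"
    using assms(1) group.iso_sym group_relative_homology_group by blast
  then have "srank (relative_homology_group (int k) X S) (carrier (relative_homology_group (int k) X S)) 1"
    by (rule srank_iso[OF abelian_integer_group abelian_relative_homology_group _ srank_integer_group])
  then show "srank (relative_homology_group (int q) X S) (carrier (relative_homology_group (int q) X S)) (if q = k then 1 else 0)"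
    using srank_trivial_group[OF abelian_relative_homology_group assms(2)] by auto
  have "(\<Sum>q\<le>k. (-1) ^ q * int (if q = k then 1 else 0)) = (\<Sum>q\<in>{k}. (-1) ^ q * int (if q = k then 1 else 0))"
    by (rule sum.mono_neutral_right) auto
  then show "(-1) ^ k = (\<Sum>q\<le>k. (-1) ^ q * int (if q = k then 1 else 0))" by simp
qed auto

lemma euler_pair_excision:
  assumes "euler_pair (subtopology X (S - U)) (T - U) e" "X closure_of U \<subseteq> X interior_of T" "T \<subseteq> S"
  shows "euler_pair (subtopology X S) T e"
  using euler_pair_iso[OF assms(1)] homology_excision_axiom[OF assms(2,3)] is_isoI by blast

lemma alternating_sum_shift:
  fixes \<alpha> :: "int \<Rightarrow> nat"
  assumes "\<alpha> (-1) = 0"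
  shows "(\<Sum>q\<le>n. (-1) ^ q * (int (\<alpha> (int q)) + int (\<alpha> (int q - 1)))) = (-1) ^ n * int (\<alpha> (int n))"
  by (induction n) (auto simp: assms algebra_simps)

text \<open>The long exact sequence of the triple, with each rank split into kernel and image:
  degree \<open>q\<close> contributes \<open>\<alpha> q + \<beta> q\<close> for (S,T),
  \<open>\<beta> q + \<gamma> q\<close> for (X,T), and \<open>\<gamma> q + \<alpha> (q - 1)\<close>
  for (X,S). The terms in \<alpha> telescope away.\<close>

lemma euler_pair_triple:
  assumes "T \<subseteq> S" and a: "euler_pair (subtopology X S) T a" and c: "euler_pair X S c"
  shows "euler_pair X T (a + c)"
proof -
  let ?A = "\<lambda>q::int. relative_homology_group q (subtopology X S) T"
  let ?B = "\<lambda>q::int. relative_homology_group q X T"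
  let ?C = "\<lambda>q::int. relative_homology_group q X S"
  let ?i = "\<lambda>q::int. hom_induced q (subtopology X S) T X T id"
  let ?j = "\<lambda>q::int. hom_induced q X T X S id"
  let ?d = "\<lambda>q::int. hom_relboundary q X S T"
  note ab = abelian_relative_homology_group
  have ker_d: "kernel (?C q) (?A (q - 1)) (?d q) = ?j q ` carrier (?B q)" for q
    using homology_exactness_triple_1[OF assms(1), of q X] by simp
  have ker_i: "kernel (?A q) (?B q) (?i q) = ?d (q + 1) ` carrier (?C (q + 1))" for q
    using homology_exactness_triple_2[OF assms(1), of "q + 1" X] by simp
  have ker_j: "kernel (?B q) (?C q) (?j q) = ?i q ` carrier (?A q)" for q
    using homology_exactness_triple_3[OF assms(1), of q X] by simp
  obtain ha NA where ha: "\<And>q::nat. srank (?A (int q)) (carrier (?A (int q))) (ha q)"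
    and NA: "\<forall>q>NA. ha q = 0" and ea: "a = (\<Sum>q\<le>NA. (-1) ^ q * int (ha q))"
    using a unfolding euler_pair_def by blast
  obtain hc NC where hc: "\<And>q::nat. srank (?C (int q)) (carrier (?C (int q))) (hc q)"
    and NC: "\<forall>q>NC. hc q = 0" and ec: "c = (\<Sum>q\<le>NC. (-1) ^ q * int (hc q))"
    using c unfolding euler_pair_def by blast
  \<comment> \<open>Extended by 0 to negative degrees, because the connecting map from degree 0
    lands in degree -1.\<close>
  define ra where "ra = (\<lambda>q::int. if q < 0 then 0 else ha (nat q))"
  define rc where "rc = (\<lambda>q::int. if q < 0 then 0 else hc (nat q))"
  have ra: "srank (?A q) (carrier (?A q)) (ra q)" for q
    using ha[of "nat q"] srank_trivial_group[OF ab trivial_relative_homology_group] by (auto simp: ra_def)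
  have rc: "srank (?C q) (carrier (?C q)) (rc q)" for q
    using hc[of "nat q"] srank_trivial_group[OF ab trivial_relative_homology_group] by (auto simp: rc_def)
  have "\<exists>x y. srank (?A q) (kernel (?A q) (?B q) (?i q)) x \<and> srank (?B q) (?i q ` carrier (?A q)) y \<and> ra q = x + y" for q
    using srank_kernel_image_exists[OF ab ab hom_induced_hom ra[of q]] by metis
  then obtain \<alpha> \<beta> where \<alpha>: "\<And>q. srank (?A q) (kernel (?A q) (?B q) (?i q)) (\<alpha> q)"
    and \<beta>: "\<And>q. srank (?B q) (?i q ` carrier (?A q)) (\<beta> q)" and ra_eq: "\<And>q. ra q = \<alpha> q + \<beta> q"
    by metis
  have "\<exists>x y. srank (?C q) (kernel (?C q) (?A (q - 1)) (?d q)) x \<and> srank (?A (q - 1)) (?d q ` carrier (?C q)) y \<and> rc q = x + y" for q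
    using srank_kernel_image_exists[OF ab ab group_homomorphism_hom_relboundary rc[of q]] by metis
  then obtain \<gamma> \<delta> where \<gamma>: "\<And>q. srank (?C q) (kernel (?C q) (?A (q - 1)) (?d q)) (\<gamma> q)"
    and \<delta>: "\<And>q. srank (?A (q - 1)) (?d q ` carrier (?C q)) (\<delta> q)" and rc_eq: "\<And>q. rc q = \<gamma> q + \<delta> q"
    by metis
  have \<delta>\<alpha>: "\<delta> q = \<alpha> (q - 1)" for q
    using srank_unique[OF \<delta>[of q]] \<alpha>[of "q - 1"] ker_i[of "q - 1"] by simp
  have rb: "srank (?B q) (carrier (?B q)) (\<beta> q + \<gamma> q)" for q
    by (rule srank_kernel_image[OF ab ab hom_induced_hom[of q X T X S id]])
       (use \<beta>[of q] \<gamma>[of q] ker_j[of q] ker_d[of q] in simp_all)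
  \<comment> \<open>The successor makes \<alpha> vanish at \<open>N\<close> itself, which removes
    the last term of the telescoping sum.\<close>
  define N where "N = Suc (max NA NC)"
  have z: "\<alpha> (int q) = 0 \<and> \<beta> (int q) = 0 \<and> \<gamma> (int q) = 0" if "q \<ge> N" for q
    using ra_eq[of "int q"] rc_eq[of "int q"] NA NC that by (auto simp: ra_def rc_def N_def)
  have "\<alpha> (-1) = 0" using ra_eq[of "-1"] by (simp add: ra_def)
  then have "(\<Sum>q\<le>N. (-1) ^ q * (int (\<alpha> (int q)) + int (\<alpha> (int q - 1)))) = 0"
    using z[of N] by (simp add: alternating_sum_shift)
  moreover have "a = (\<Sum>q\<le>N. (-1) ^ q * (int (\<alpha> (int q)) + int (\<beta> (int q))))"
  proof -
    have "a = (\<Sum>q\<le>N. (-1) ^ q * int (ha q))"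
      unfolding ea by (rule alternating_sum_truncate[OF NA, symmetric]) (simp add: N_def)
    moreover have "ha q = \<alpha> (int q) + \<beta> (int q)" for q using ra_eq[of "int q"] by (simp add: ra_def)
    ultimately show ?thesis by simp
  qed
  moreover have "c = (\<Sum>q\<le>N. (-1) ^ q * (int (\<gamma> (int q)) + int (\<alpha> (int q - 1))))"
  proof -
    have "c = (\<Sum>q\<le>N. (-1) ^ q * int (hc q))"
      unfolding ec by (rule alternating_sum_truncate[OF NC, symmetric]) (simp add: N_def)
    moreover have "hc q = \<gamma> (int q) + \<alpha> (int q - 1)" for q using rc_eq[of "int q"] \<delta>\<alpha> by (simp add: rc_def)
    ultimately show ?thesis by simp
  qed
  ultimately have "a + c = (\<Sum>q\<le>N. (-1) ^ q * int (\<beta> (int q) + \<gamma> (int q)))"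
    by (simp add: algebra_simps sum.distrib)
  then show ?thesis
    unfolding euler_pair_def
    using rb z by (intro exI[of _ "\<lambda>q. \<beta> (int q) + \<gamma> (int q)"] exI[of _ N]) auto
qed

section \<open>Homology of a punctured real vector space\<close>

lemma sphere_homotopy_eqv_punctured_subspace:
  fixes W :: "'a::euclidean_space set"
  assumes "subspace W"
  shows "(sphere 0 1 \<inter> W) homotopy_eqv (W - {0})"
proof -
  have W: "convex W" "affine W" "0 \<in> W"
    using assms by (auto simp: subspace_imp_convex subspace_imp_affine subspace_0)
  have "0 \<in> interior (cball 0 1) \<inter> W" using W by simp
  then have ne: "interior (cball 0 1) \<inter> W \<noteq> {}" by blast
  have "rel_frontier (cball 0 1 \<inter> W) = sphere 0 1 \<inter> W"
    using convex_affine_rel_frontier_Int[OF convex_cball W(2) ne] by simp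
  moreover have "rel_frontier (cball 0 1 \<inter> W) homotopy_eqv (W - {0})"
  proof (rule homotopy_eqv_rel_frontier_punctured_convex)
    show "0 \<in> rel_interior (cball 0 1 \<inter> W)"
      using rel_interior_convex_Int_affine[OF convex_cball W(2) ne] W by auto
    have "affine hull (W \<inter> cball 0 1) = affine hull W"
      by (rule affine_hull_convex_Int_nonempty_interior) (use W ne in auto)
    then show "W \<subseteq> affine hull (cball 0 1 \<inter> W)"
      by (metis hull_subset inf_commute)
    show "rel_frontier (cball 0 1 \<inter> W) \<subseteq> W" using calculation by auto
  qed (use W in \<open>auto intro: convex_Int\<close>)
  ultimately show ?thesis by simp
qed

lemma euler_pair_punctured_subspace:
  fixes W :: "'a::euclidean_space set"
  assumes "subspace W"
  shows "euler_pair (top_of_set W) (W - {0}) ((-1) ^ dim W)"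
proof (cases "dim W = 0")
  case True
  then have W: "W = {0}" using assms subspace_0 by (auto simp: dim_eq_0)
  \<comment> \<open>In dimension 0 there is no sphere to compare with: the punctured space is empty
    and the pair is a single point.\<close>
  have "euler_pair (top_of_set W) {} ((-1) ^ 0)"
    using W by (intro euler_pair_single) (auto intro: homology_coefficients homology_dimension_axiom)
  then show ?thesis using W True by simp
next
  case False
  obtain B where B: "0 \<notin> B" "B \<subseteq> W" "pairwise orthogonal B" "\<And>x. x \<in> B \<Longrightarrow> norm x = 1"
      "independent B" "card B = dim W" "span B = W"
    using orthonormal_basis_subspace[OF assms]
    by (metis norm_zero zero_neq_one)
  obtain f :: "(nat \<Rightarrow> real) \<Rightarrow> 'a" and g where fg: "homeomorphic_maps (nsphere (dim W - 1)) (top_of_set (sphere 0 1 \<inter> W)) f g"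
    using homeomorphic_maps_nsphere_euclidean_sphere[OF B(5,3,6) False B(4)] B(7) by metis
  then have h1: "top_of_set (sphere 0 1 \<inter> W) homotopy_equivalent_space nsphere (dim W - 1)"
    using homeomorphic_imp_homotopy_equivalent_space homeomorphic_space_sym unfolding homeomorphic_space_def by metis
  have h2: "top_of_set (W - {0}) homotopy_equivalent_space top_of_set (sphere 0 1 \<inter> W)"
    using sphere_homotopy_eqv_punctured_subspace[OF assms] homotopy_equivalent_space_sym by blast
  have h: "top_of_set (W - {0}) homotopy_equivalent_space nsphere (dim W - 1)"
    using homotopy_eqv_trans[OF h2 h1] .
  have ne: "W - {0} \<noteq> {}" using False by (metis Diff_eq_empty_iff dim_eq_0)
  have con: "contractible_space (top_of_set W)"
    using assms by (simp add: convex_imp_contractible subspace_imp_convex)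
  \<comment> \<open>\<open>W\<close> is contractible, so relative homology is the reduced homology
    of the punctured space one degree lower.\<close>
  have iso: "relative_homology_group q (top_of_set W) (W - {0}) \<cong> reduced_homology_group (q - 1) (nsphere (dim W - 1))" for q
  proof -
    have "relative_homology_group q (top_of_set W) (W - {0}) \<cong> reduced_homology_group (q - 1) (subtopology (top_of_set W) (W - {0}))"
      by (rule isomorphic_group_relative_homology_of_contractible[OF con]) (use ne in auto)
    also have "subtopology (top_of_set W) (W - {0}) = top_of_set (W - {0})"
      by (simp add: subtopology_subtopology Int_absorb1 inf_commute)
    also have "reduced_homology_group (q - 1) \<dots> \<cong> reduced_homology_group (q - 1) (nsphere (dim W - 1))"
      by (rule homotopy_equivalent_space_imp_isomorphic_reduced_homology_groups[OF h])
    finally show ?thesis .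
  qed
  obtain k where k: "dim W = Suc k" using False not0_implies_Suc by blast
  show ?thesis
  proof (rule euler_pair_single)
    have "int (dim W) - 1 = int (dim W - 1)" by (simp add: k)
    then show "relative_homology_group (int (dim W)) (top_of_set W) (W - {0}) \<cong> integer_group"
      using iso[of "int (dim W)"] reduced_homology_group_nsphere(1) iso_trans by metis
    fix q :: nat assume "q \<noteq> dim W"
    then have "int q - 1 \<noteq> int (dim W - 1)" by (simp add: k)
    then have "trivial_group (reduced_homology_group (int q - 1) (nsphere (dim W - 1)))"
      by (rule reduced_homology_group_nsphere(2))
    then show "trivial_group (relative_homology_group (int q) (top_of_set W) (W - {0}))"
      using isomorphic_group_triviality[OF iso[of "int q"]] by simp
  qed
qed

section \<open>Attaching a cell\<close>

text \<open>The characteristic map may collapse the sphere into \<open>A\<close> in any way.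
  Compactness of the ball and the Hausdorff property force the topology of \<open>K\<close> near the
  cell to be the expected one. Using a subspace \<open>W\<close> instead of a whole type provides
  cells of every dimension.\<close>

locale attached_cell =
  fixes K :: "'b topology" and A :: "'b set" and W :: "'a::euclidean_space set" and \<Phi> :: "'a \<Rightarrow> 'b"
  assumes Hausdorff: "Hausdorff_space K"
    and closedA: "closedin K A"
    and W: "subspace W"
    and cont: "continuous_map (top_of_set (cball 0 1 \<inter> W)) K \<Phi>"
    and sphere_A: "\<And>z. z \<in> sphere 0 1 \<inter> W \<Longrightarrow> \<Phi> z \<in> A"
    and ball_A: "\<And>z. z \<in> ball 0 1 \<inter> W \<Longrightarrow> \<Phi> z \<notin> A"
    and inj: "inj_on \<Phi> (ball 0 1 \<inter> W)"
    and covers: "topspace K = A \<union> \<Phi> ` (ball 0 1 \<inter> W)"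
begin

abbreviation "D \<equiv> cball 0 1 \<inter> W"
abbreviation "B \<equiv> ball 0 1 \<inter> W"

lemma Phi_topspace: "z \<in> D \<Longrightarrow> \<Phi> z \<in> topspace K"
  using cont by (auto simp: continuous_map_def)

lemma Phi_in_A_iff: "z \<in> D \<Longrightarrow> \<Phi> z \<in> A \<longleftrightarrow> norm z = 1"
  using sphere_A[of z] ball_A[of z] by (auto simp: less_eq_real_def)

lemma zero_in_B: "0 \<in> B"
  using W subspace_0 by auto

lemma Phi_eq_center: "z \<in> D \<Longrightarrow> \<Phi> z = \<Phi> 0 \<longleftrightarrow> z = 0"
proof
  assume z: "z \<in> D" "\<Phi> z = \<Phi> 0"
  then have "z \<in> B" using Phi_in_A_iff[of z] ball_A[OF zero_in_B] by (auto simp: less_eq_real_def)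
  then show "z = 0" using inj z zero_in_B by (meson inj_onD)
qed auto

text \<open>Compact source and Hausdorff target. Properness is the convenient notion because it
  survives restriction to full preimages and products with the unit interval, and still yields
  closed maps.\<close>

lemma proper_Phi: "proper_map (top_of_set D) K \<Phi>"
proof (rule continuous_imp_proper_map[OF _ _ cont])
  have "compact D" using W by (simp add: closed_subspace compact_Int_closed)
  then show "compact_space (top_of_set D)" by (simp add: compact_space_subtopology)
  show "kc_space K" using Hausdorff by (rule Hausdorff_imp_kc_space)
qed

text \<open>The open ball is the full preimage of the complement of \<open>A\<close>, so the
  restriction stays proper and hence closed.\<close>

lemma homeomorphic_open_cell:
  "homeomorphic_map (top_of_set B) (subtopology K (topspace K - A)) \<Phi>"
proof (rule bijective_closed_imp_homeomorphic_map)
  have eq: "{x \<in> topspace (top_of_set D). \<Phi> x \<in> topspace K - A} = B"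
    using Phi_topspace Phi_in_A_iff by (auto simp: less_eq_real_def)
  have top: "subtopology (top_of_set D) B = top_of_set B"
    by (simp add: subtopology_subtopology) (rule arg_cong[where f = top_of_set], auto)
  have "proper_map (top_of_set B) (subtopology K (topspace K - A)) \<Phi>"
    using proper_map_restriction[OF proper_Phi eq] top by simp
  then show "closed_map (top_of_set B) (subtopology K (topspace K - A)) \<Phi>"
    by (simp add: proper_map_def)
  have "continuous_map (subtopology (top_of_set D) B) K \<Phi>"
    by (rule continuous_map_from_subtopology[OF cont])
  then show "continuous_map (top_of_set B) (subtopology K (topspace K - A)) \<Phi>"
    unfolding top by (rule continuous_map_into_subtopology) (use eq in auto)
  show "\<Phi> ` topspace (top_of_set B) = topspace (subtopology K (topspace K - A))"
    using covers ball_A by auto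
  show "inj_on \<Phi> (topspace (top_of_set B))" using inj by simp
qed

text \<open>Pushing radially away from the centre of the cell deforms the complement of the centre into \<open>A\<close>.
  Continuity is checked after composing with the proper, hence quotient, map \<open>\<Phi>\<close>.\<close>

definition push :: "real \<Rightarrow> 'a \<Rightarrow> 'a" where
  "push t z = ((1 - t) + t / norm z) *\<^sub>R z"

definition flow :: "real \<times> 'b \<Rightarrow> 'b" where
  "flow = (\<lambda>(t, x). if x \<in> \<Phi> ` (B - {0}) then \<Phi> (push t (inv_into B \<Phi> x)) else x)"

lemma norm_push: "0 \<le> t \<Longrightarrow> t \<le> 1 \<Longrightarrow> z \<noteq> 0 \<Longrightarrow> norm (push t z) = (1 - t) * norm z + t"
proof -
  assume *: "0 \<le> t" "t \<le> 1" "z \<noteq> 0"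
  then have "norm (push t z) = ((1 - t) + t / norm z) * norm z"
    by (simp add: push_def add_nonneg_nonneg)
  then show ?thesis using * by (simp add: distrib_right)
qed

lemma push_mem:
  assumes "0 \<le> t" "t \<le> 1" "z \<in> D - {0}"
  shows "push t z \<in> D - {0}"
proof -
  have n: "0 < norm z" "norm z \<le> 1" using assms by auto
  have "(1 - t) * norm z \<le> (1 - t) * 1" using assms n by (intro mult_left_mono) auto
  then have "norm (push t z) \<le> 1" using norm_push assms by simp
  moreover have "norm (push t z) > 0"
  proof (cases "t = 0")
    case False
    then show ?thesis using norm_push[of t z] assms by (simp add: add_nonneg_pos)
  qed (use n in \<open>simp add: push_def\<close>)
  moreover have "push t z \<in> W" using assms W by (simp add: push_def subspace_scale)
  ultimately show ?thesis by auto
qed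

lemma flow_Phi:
  assumes "z \<in> D - {0}"
  shows "flow (t, \<Phi> z) = \<Phi> (push t z)"
proof (cases "norm z = 1")
  case True
  then have "\<Phi> z \<in> A" using Phi_in_A_iff assms by auto
  then have "\<Phi> z \<notin> \<Phi> ` (B - {0})" using ball_A by auto
  moreover have "push t z = z" using True by (simp add: push_def)
  ultimately show ?thesis by (simp add: flow_def)
next
  case False
  then have z: "z \<in> B - {0}" using assms by auto
  then have "inv_into B \<Phi> (\<Phi> z) = z" using inj by (intro inv_into_f_f) auto
  then show ?thesis using z by (auto simp: flow_def)
qed

lemma flow_A: "x \<in> A \<Longrightarrow> flow (t, x) = x"
  using ball_A by (auto simp: flow_def)

lemma flow_0: "flow (0, x) = x"
proof (cases "x \<in> \<Phi> ` (B - {0})")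
  case True
  then obtain z where "z \<in> B - {0}" "x = \<Phi> z" by blast
  then show ?thesis using flow_Phi[of z 0] by (simp add: push_def)
qed (simp add: flow_def)

lemma punctured_eq: "topspace K - {\<Phi> 0} = A \<union> \<Phi> ` (D - {0})"
proof
  show "topspace K - {\<Phi> 0} \<subseteq> A \<union> \<Phi> ` (D - {0})"
    using covers by auto
  show "A \<union> \<Phi> ` (D - {0}) \<subseteq> topspace K - {\<Phi> 0}"
  proof
    fix x assume "x \<in> A \<union> \<Phi> ` (D - {0})"
    then consider "x \<in> A" | z where "z \<in> D" "z \<noteq> 0" "x = \<Phi> z" by blast
    then show "x \<in> topspace K - {\<Phi> 0}"
      by cases (use covers ball_A[OF zero_in_B] Phi_topspace Phi_eq_center in auto)
  qed
qed

lemma continuous_flow: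
  "continuous_map (prod_topology (top_of_set {0..1}) (subtopology K (topspace K - {\<Phi> 0})))
     (subtopology K (topspace K - {\<Phi> 0})) flow"
proof -
  let ?Y = "subtopology K (topspace K - {\<Phi> 0})"
  let ?P = "prod_topology (top_of_set {0..1::real}) ?Y"
  \<comment> \<open>Two closed pieces: on \<open>A\<close> the flow is the projection to the second
    factor, on the image of the punctured closed ball it is induced by \<open>push\<close>.\<close>
  define T where "T = (\<lambda>b. if b then {0..1::real} \<times> A else {0..1} \<times> \<Phi> ` (D - {0}))"
  have topY: "topspace ?Y = A \<union> \<Phi> ` (D - {0})" using punctured_eq by auto
  have topP: "topspace ?P = {0..1} \<times> (A \<union> \<Phi> ` (D - {0}))" using topY by auto
  have eqD: "{x \<in> topspace (top_of_set D). \<Phi> x \<in> topspace K - {\<Phi> 0}} = D - {0}"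
    using Phi_topspace Phi_eq_center by auto
  have topD: "subtopology (top_of_set D) (D - {0}) = top_of_set (D - {0})"
    by (simp add: subtopology_subtopology) (rule arg_cong[where f = top_of_set], auto)
  have propD: "proper_map (top_of_set (D - {0})) ?Y \<Phi>"
    using proper_map_restriction[OF proper_Phi eqD] unfolding topD .
  have contD: "continuous_map (top_of_set (D - {0})) K \<Phi>"
    using continuous_map_from_subtopology[OF cont, of "D - {0}"] unfolding topD .
  have contY: "continuous_map (top_of_set (D - {0})) ?Y \<Phi>"
    by (rule continuous_map_into_subtopology[OF contD]) (use eqD in auto)
  have closedPhi: "closedin ?Y (\<Phi> ` (D - {0}))"
    using propD unfolding proper_map_def closed_map_def
    by (metis closedin_topspace topspace_euclidean_subtopology)
  have closedA': "closedin ?Y A"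
    using closedA by (rule closedin_subset_topspace) (use punctured_eq in auto)
  show ?thesis
  proof (rule pasting_lemma_closed[of "{True, False}" ?P T ?Y "\<lambda>_. flow"])
    show "closedin ?P (T b)" for b
      using closedPhi closedA' by (auto simp: T_def closedin_prod_Times_iff)
    show "continuous_map (subtopology ?P (T b)) ?Y flow" for b
    proof (cases b)
      case True
      have "continuous_map (subtopology ?P (T b)) ?Y snd"
        by (rule continuous_map_from_subtopology) (rule continuous_map_snd)
      then show ?thesis
        by (rule continuous_map_eq) (auto simp: T_def True flow_A)
    next
      case False
      let ?Q = "prod_topology (top_of_set {0..1::real}) (top_of_set (D - {0}))"
      let ?q = "\<lambda>(t, z). (id t, \<Phi> z)"
      let ?Y' = "subtopology ?Y (\<Phi> ` (D - {0}))"
      have "proper_map (top_of_set (D - {0})) ?Y' \<Phi>"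
        by (rule proper_map_into_subtopology[OF propD]) auto
      then have "proper_map ?Q (prod_topology (top_of_set {0..1}) ?Y') ?q"
        unfolding proper_map_prod using proper_map_id by blast
      then have "closed_map ?Q (prod_topology (top_of_set {0..1}) ?Y') ?q"
        by (simp add: proper_map_def)
      moreover have "continuous_map (top_of_set (D - {0})) ?Y' \<Phi>"
        by (rule continuous_map_into_subtopology[OF contY]) auto
      then have "continuous_map ?Q (prod_topology (top_of_set {0..1}) ?Y') ?q"
        by (subst continuous_map_prod_top) auto
      moreover have "?q ` topspace ?Q = topspace (prod_topology (top_of_set {0..1}) ?Y')"
        using topY by (auto simp: image_iff)
      ultimately have quo: "quotient_map ?Q (prod_topology (top_of_set {0..1}) ?Y') ?q"
        by (intro continuous_closed_imp_quotient_map)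
      have T: "subtopology ?P (T b) = prod_topology (top_of_set {0..1}) ?Y'"
        by (simp add: T_def False subtopology_Times subtopology_subtopology)
      have "continuous_on ({0..1} \<times> (D - {0})) (\<lambda>p. push (fst p) (snd p))"
        unfolding push_def by (intro continuous_intros) auto
      then have "continuous_map (top_of_set ({0..1} \<times> (D - {0}))) (top_of_set (D - {0})) (\<lambda>p. push (fst p) (snd p))"
        using push_mem by auto
      then have "continuous_map ?Q (top_of_set (D - {0})) (\<lambda>p. push (fst p) (snd p))"
        by simp
      then have "continuous_map ?Q ?Y (\<Phi> \<circ> (\<lambda>p. push (fst p) (snd p)))"
        using contY by (rule continuous_map_compose)
      then have "continuous_map ?Q ?Y (flow \<circ> ?q)"
      proof (rule continuous_map_eq)
        fix p assume "p \<in> topspace ?Q"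
        then have "snd p \<in> D - {0}" by auto
        then show "(\<Phi> \<circ> (\<lambda>p. push (fst p) (snd p))) p = (flow \<circ> ?q) p"
          using flow_Phi[of "snd p" "fst p"] by (cases p) (simp only: o_apply prod.case fst_conv snd_conv id_apply)
      qed
      then show ?thesis
        unfolding T by (rule continuous_compose_quotient_map[OF quo])
    qed
    show "\<exists>j. j \<in> {True, False} \<and> x \<in> T j \<and> flow x = flow x" if "x \<in> topspace ?P" for x
      using that unfolding topP by (cases x) (auto simp: T_def split: if_splits)
  qed auto
qed

lemma euler_pair_punctured: "euler_pair (subtopology K (topspace K - {\<Phi> 0})) A 0"
proof (rule euler_pair_trivial)
  fix q :: nat
  let ?Y = "subtopology K (topspace K - {\<Phi> 0})"
  have AY: "A \<subseteq> topspace ?Y" using punctured_eq by auto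
  have c1: "continuous_map ?Y ?Y (\<lambda>x. flow (1, x))"
    using continuous_map_compose[OF _ continuous_flow, of ?Y "\<lambda>x. (1, x)"]
    by (simp add: o_def continuous_map_pairwise)
  have img: "flow (1, x) \<in> A" if x: "x \<in> topspace ?Y" for x
  proof (cases "x \<in> A")
    case False
    then obtain z where z: "z \<in> D - {0}" "x = \<Phi> z"
      using x punctured_eq topspace_subtopology_subset[of "topspace K - {\<Phi> 0}" K] by blast
    then have "flow (1, x) = \<Phi> (push 1 z)" using flow_Phi by simp
    moreover have "push 1 z \<in> D" "norm (push 1 z) = 1" using push_mem[of 1 z] norm_push[of 1 z] z by auto
    ultimately show ?thesis using Phi_in_A_iff by simp
  qed (simp add: flow_A)
  have retr: "continuous_map ?Y (subtopology ?Y A) (\<lambda>x. flow (1, x))"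
    by (rule continuous_map_into_subtopology[OF c1]) (use img in auto)
  have hom: "homotopic_with (\<lambda>k. True) ?Y ?Y id (\<lambda>x. flow (1, x))"
    unfolding homotopic_with_def
    by (rule exI[of _ flow]) (use continuous_flow flow_0 in auto)
  show "trivial_group (relative_homology_group (int q) ?Y A)"
  proof (rule trivial_relative_homology_group_gen[OF retr])
    show "homotopic_with (\<lambda>k. True) ?Y ?Y (\<lambda>x. flow (1, x)) id"
      using hom by (rule homotopic_with_symD)
    show "homotopic_with (\<lambda>h. True) (subtopology ?Y A) (subtopology ?Y A) (\<lambda>x. flow (1, x)) id"
      by (rule homotopic_with_equal)
         (auto simp: flow_A intro: continuous_map_into_subtopology continuous_map_from_subtopology[OF retr])
  qed
qed

lemma homeomorphic_subspace_ball:
  "homeomorphic_map (top_of_set W) (top_of_set B) (\<lambda>y. y /\<^sub>R (1 + norm y))"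
proof -
  have pos: "1 + norm y \<noteq> 0" "0 < 1 + norm y" if "y \<in> W" for y
    using norm_ge_zero[of y] by linarith+
  have "homeomorphic_maps (top_of_set W) (top_of_set B) (\<lambda>y. y /\<^sub>R (1 + norm y)) (\<lambda>z. z /\<^sub>R (1 - norm z))"
    unfolding homeomorphic_maps_def
  proof (intro conjI ballI)
    have "continuous_on W (\<lambda>y. y /\<^sub>R (1 + norm y))"
      by (intro continuous_intros) (use pos in auto)
    then show "continuous_map (top_of_set W) (top_of_set B) (\<lambda>y. y /\<^sub>R (1 + norm y))"
      using W pos by (auto simp: subspace_scale field_simps)
    have "continuous_on B (\<lambda>z. z /\<^sub>R (1 - norm z))"
      by (intro continuous_intros) auto
    then show "continuous_map (top_of_set B) (top_of_set W) (\<lambda>z. z /\<^sub>R (1 - norm z))"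
      using W by (auto simp: subspace_scale)
    fix y assume y: "y \<in> topspace (top_of_set W)"
    have "1 - norm (y /\<^sub>R (1 + norm y)) = inverse (1 + norm y)"
      using pos[of y] y by (simp add: field_simps)
    then show "y /\<^sub>R (1 + norm y) /\<^sub>R (1 - norm (y /\<^sub>R (1 + norm y))) = y"
      using pos[of y] y by simp
  next
    fix z assume "z \<in> topspace (top_of_set B)"
    then have z: "norm z < 1" by auto
    then have "1 + norm (z /\<^sub>R (1 - norm z)) = inverse (1 - norm z)"
      by (simp add: field_simps)
    then show "z /\<^sub>R (1 - norm z) /\<^sub>R (1 + norm (z /\<^sub>R (1 - norm z))) = z"
      using z by simp
  qed
  then show ?thesis using homeomorphic_map_maps by blast
qed

text \<open>Excising \<open>A\<close> from the pair of \<open>K\<close> and the complement of the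
  centre leaves a punctured copy of \<open>W\<close>. In the triple of \<open>A\<close>, the
  complement of the centre, and \<open>K\<close>, the first pair contributes 0 by the radial
  deformation.\<close>

lemma euler_pair_cell: "euler_pair K A ((-1) ^ dim W)"
proof -
  let ?U = "topspace K - {\<Phi> 0}"
  have h: "homeomorphic_map (top_of_set W) (subtopology K (topspace K - A)) (\<Phi> \<circ> (\<lambda>y. y /\<^sub>R (1 + norm y)))"
    using homeomorphic_map_compose[OF homeomorphic_subspace_ball homeomorphic_open_cell] .
  have "euler_pair (subtopology K (topspace K - A)) (?U - A) ((-1) ^ dim W)"
  proof (rule euler_pair_homeomorphic_map[OF euler_pair_punctured_subspace[OF W] h])
    let ?f = "\<Phi> \<circ> (\<lambda>y. y /\<^sub>R (1 + norm y))"
    have im: "?f ` W = topspace K - A"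
      using homeomorphic_imp_surjective_map[OF h] by auto
    have "inj_on ?f W" using homeomorphic_imp_injective_map[OF h] by simp
    moreover have "0 \<in> W" "?f 0 = \<Phi> 0" using W subspace_0 by auto
    ultimately have "?f ` (W - {0}) = ?f ` W - {\<Phi> 0}"
      by (subst inj_on_image_set_diff[of _ W]) auto
    then show "?f ` (W - {0}) = ?U - A" using im by auto
  qed auto
  moreover have "K closure_of A \<subseteq> K interior_of ?U"
  proof -
    have "t1_space K" using Hausdorff by (rule Hausdorff_imp_t1_space)
    moreover have "\<Phi> 0 \<in> topspace K" using Phi_topspace zero_in_B by auto
    ultimately have "closedin K {\<Phi> 0}" by (simp add: closedin_t1_singleton)
    then have "openin K ?U" by (simp add: openin_diff)
    then have "K interior_of ?U = ?U" by (simp add: interior_of_openin)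
    moreover have "K closure_of A = A" using closedA by (simp add: closure_of_closedin)
    ultimately show ?thesis using punctured_eq by auto
  qed
  ultimately have "euler_pair (subtopology K (topspace K)) ?U ((-1) ^ dim W)"
    by (rule euler_pair_excision) auto
  then have "euler_pair K ?U ((-1) ^ dim W)" by simp
  then have "euler_pair K A (0 + (-1) ^ dim W)"
    by (intro euler_pair_triple[OF _ euler_pair_punctured]) (use punctured_eq in auto)
  then show ?thesis by simp
qed

end

section \<open>Convex cells in a one-point compactification\<close>

text \<open>The cell \<open>{p + y | y \<in> W, g y < 1}\<close> is given by a gauge \<open>g\<close> that may vanish on nonzero vectors
  (unbounded directions). The map \<open>z \<mapsto> p + z / (1 - |z| + g z)\<close> sends the open unit ball of \<open>W\<close> onto the cell, and
  extends continuously to the closed ball with values in the one-point compactification.\<close>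

locale gauge_cell =
  fixes X S :: "'a::euclidean_space set" and W :: "'a set" and g :: "'a \<Rightarrow> real" and p :: 'a
  assumes loc_compact: "locally_compact_space (top_of_set X)"
    and W: "subspace W"
    and cont_g: "continuous_on UNIV g"
    and g_nonneg: "\<And>y. 0 \<le> g y"
    and g_scale: "\<And>c y. 0 \<le> c \<Longrightarrow> g (c *\<^sub>R y) = c * g y"
    and closed_S: "closedin (top_of_set X) S"
    and cell_X: "\<And>y. y \<in> W \<Longrightarrow> g y < 1 \<Longrightarrow> p + y \<in> X - S"
    and frontier_S: "\<And>y. y \<in> W \<Longrightarrow> g y = 1 \<Longrightarrow> p + y \<in> X \<Longrightarrow> p + y \<in> S"
    and open_X: "\<exists>U. open U \<and> (\<forall>y\<in>W. g y \<le> 1 \<longrightarrow> (p + y \<in> X \<longleftrightarrow> p + y \<in> U))"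
begin

abbreviation "DW \<equiv> cball 0 1 \<inter> W"
abbreviation "d z \<equiv> 1 - norm z + g z"
abbreviation "m z \<equiv> p + z /\<^sub>R d z"

text \<open>In the closed ball \<open>d z = 0\<close> holds exactly at unit vectors of gauge 0, that
  is, in unbounded directions of the cell. These go to infinity, as do the sphere points whose image
  falls outside \<open>X\<close>.\<close>

definition cmap :: "'a \<Rightarrow> 'a option" where
  "cmap z = (if d z \<noteq> 0 \<and> m z \<in> X then Some (m z) else None)"

definition cell :: "'a set" where
  "cell = (\<lambda>y. p + y) ` {y \<in> W. g y < 1}"

lemma d_nonneg: "z \<in> DW \<Longrightarrow> 0 \<le> d z"
  using g_nonneg[of z] by auto

lemma g_0: "g 0 = 0"
  using g_scale[of 0 0] by simp

lemma g_m: "z \<in> DW \<Longrightarrow> d z \<noteq> 0 \<Longrightarrow> g (z /\<^sub>R d z) = g z / d z"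
  using d_nonneg[of z] g_scale[of "inverse (d z)" z] by (simp add: divide_inverse mult.commute)

lemma m_W: "z \<in> DW \<Longrightarrow> z /\<^sub>R d z \<in> W"
  using W by (auto intro: subspace_scale)

lemma g_m_le: "z \<in> DW \<Longrightarrow> d z \<noteq> 0 \<Longrightarrow> g (z /\<^sub>R d z) \<le> 1"
  using d_nonneg[of z] by (simp add: g_m divide_le_eq_1)

text \<open>By homogeneity the gauge of the image is \<open>g z / (1 - norm z + g z)\<close>, so the
  unit sphere is exactly what separates the cell from its frontier.\<close>

lemma g_m_less: "z \<in> DW \<Longrightarrow> d z \<noteq> 0 \<Longrightarrow> g (z /\<^sub>R d z) < 1 \<longleftrightarrow> norm z < 1"
  using d_nonneg[of z] by (simp add: g_m divide_less_eq_1)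

lemma d_ball: "norm z < 1 \<Longrightarrow> 0 < d z"
  using g_nonneg[of z] by linarith

lemma cmap_ball: "z \<in> ball 0 1 \<inter> W \<Longrightarrow> cmap z = Some (m z) \<and> m z \<in> cell"
proof -
  assume z: "z \<in> ball 0 1 \<inter> W"
  then have "d z \<noteq> 0" using d_ball[of z] by auto
  moreover have "g (z /\<^sub>R d z) < 1" using g_m_less[of z] calculation z by auto
  moreover have "z /\<^sub>R d z \<in> W" using m_W[of z] z by auto
  ultimately show ?thesis using cell_X by (auto simp: cmap_def cell_def)
qed

lemma cmap_sphere: "z \<in> sphere 0 1 \<inter> W \<Longrightarrow> cmap z \<in> insert None (Some ` S)"
proof -
  assume z: "z \<in> sphere 0 1 \<inter> W"
  have "p + z /\<^sub>R d z \<in> S" if "d z \<noteq> 0" "m z \<in> X"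
  proof -
    have zD: "z \<in> DW" using z by auto
    have "g (z /\<^sub>R d z) = 1"
      using g_m[OF zD that(1)] that(1) z by simp
    then show ?thesis using frontier_S[OF m_W[OF zD]] that(2) by simp
  qed
  then show ?thesis by (auto simp: cmap_def)
qed

text \<open>For \<open>y = z / d z\<close> one has \<open>norm y = norm z / d z\<close> and
  \<open>g y = g z / d z\<close>, hence \<open>1 + norm y - g y = 1 / d z\<close>. This recovers the
  scaling factor from \<open>y\<close> and gives an explicit inverse, used again for
  surjectivity.\<close>

lemma inj_cmap: "inj_on cmap (ball 0 1 \<inter> W)"
proof (rule inj_on_inverseI)
  fix z assume z: "z \<in> ball 0 1 \<inter> W"
  define y where "y = z /\<^sub>R d z"
  have dz: "0 < d z" using d_ball z by auto
  have "norm y = norm z / d z" "g y = g z / d z"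
    using dz g_m[of z] z by (auto simp: y_def divide_inverse mult.commute)
  then have "1 + norm y - g y = inverse (d z)"
    using dz by (simp add: field_simps)
  then have "y /\<^sub>R (1 + norm y - g y) = z"
    using dz by (simp add: y_def)
  then show "(\<lambda>x. let y = the x - p in y /\<^sub>R (1 + norm y - g y)) (cmap z) = z"
    using cmap_ball[OF z] by (simp add: Let_def y_def)
qed

lemma cmap_onto: "cmap ` (ball 0 1 \<inter> W) = Some ` cell"
proof
  show "cmap ` (ball 0 1 \<inter> W) \<subseteq> Some ` cell" using cmap_ball by blast
  show "Some ` cell \<subseteq> cmap ` (ball 0 1 \<inter> W)"
  proof
    fix x assume "x \<in> Some ` cell"
    then obtain y where y: "y \<in> W" "g y < 1" "x = Some (p + y)" by (auto simp: cell_def)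
    define e where "e = 1 + norm y - g y"
    define z where "z = y /\<^sub>R e"
    have e: "e > norm y" using y by (simp add: e_def)
    then have e0: "0 < e" using norm_ge_zero[of y] by linarith
    have nz: "norm z = norm y / e" using e0 by (simp add: z_def divide_inverse mult.commute)
    then have "norm z < 1" using e e0 by simp
    moreover have "z \<in> W" using y W by (simp add: z_def subspace_scale)
    ultimately have z: "z \<in> ball 0 1 \<inter> W" by simp
    have "g z = g y / e" using e0 g_scale[of "inverse e" y] by (simp add: z_def divide_inverse mult.commute)
    then have "d z = inverse e" using nz e0 by (simp add: e_def field_simps)
    then have "m z = p + y" using e0 by (simp add: z_def)
    then have "cmap z = x" using cmap_ball[OF z] y by simp
    then show "x \<in> cmap ` (ball 0 1 \<inter> W)" using z by blast
  qed
qed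

lemma continuous_on_d: "continuous_on T (\<lambda>z. d z)"
  by (intro continuous_intros continuous_on_subset[OF cont_g]) auto

lemma continuous_on_m: "(\<And>z. z \<in> T \<Longrightarrow> d z \<noteq> 0) \<Longrightarrow> continuous_on T (\<lambda>z. m z)"
  by (intro continuous_intros continuous_on_d) auto

lemma closed_D: "closed DW"
  using W by (simp add: closed_Int closed_subspace)

lemma continuous_cmap: "continuous_map (top_of_set DW) (Alexandroff_compactification (top_of_set X)) cmap"
  unfolding continuous_map_def
proof (intro conjI allI impI)
  show "cmap \<in> topspace (top_of_set DW) \<rightarrow> topspace (Alexandroff_compactification (top_of_set X))"
    by (auto simp: cmap_def)
  fix V assume "openin (Alexandroff_compactification (top_of_set X)) V"
  then consider U where "openin (top_of_set X) U" "V = Some ` U"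
    | C where "compactin (top_of_set X) C" "V = insert None (Some ` (X - C))"
    unfolding openin_Alexandroff_compactification by auto
  then show "openin (top_of_set DW) {x \<in> topspace (top_of_set DW). cmap x \<in> V}"
  proof cases
    case 1
    then obtain U' where U': "open U'" "U = X \<inter> U'" by (auto simp: openin_open)
    \<comment> \<open>\<open>X\<close> need not be open in the ambient space. On the closed cell,
      membership in \<open>X\<close> agrees with membership in an open set, which makes the
      condition \<open>m z \<in> X\<close> an open one.\<close>
    obtain O' where O': "open O'" "\<And>y. y \<in> W \<Longrightarrow> g y \<le> 1 \<Longrightarrow> p + y \<in> X \<longleftrightarrow> p + y \<in> O'"
      using open_X by blast
    let ?D0 = "{z \<in> DW. d z \<noteq> 0}"
    have "openin (top_of_set DW) (DW \<inter> (\<lambda>z. d z) -` (- {0}))"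
      by (rule continuous_openin_preimage_gen[OF continuous_on_d]) auto
    then have D0: "openin (top_of_set DW) ?D0"
      by (rule back_subst[of "openin _"]) auto
    have "openin (top_of_set ?D0) (?D0 \<inter> (\<lambda>z. m z) -` (O' \<inter> U'))"
      by (rule continuous_openin_preimage_gen[OF continuous_on_m]) (use O' U' in auto)
    then have "openin (top_of_set DW) (?D0 \<inter> (\<lambda>z. m z) -` (O' \<inter> U'))"
      using D0 openin_trans by blast
    moreover have "?D0 \<inter> (\<lambda>z. m z) -` (O' \<inter> U') = {x \<in> topspace (top_of_set DW). cmap x \<in> V}"
      using O'(2)[OF m_W g_m_le] U' 1 by (auto simp: cmap_def image_iff)
    ultimately show ?thesis by simp
  next
    case 2
    then have C: "compact C" "C \<subseteq> X" by (auto simp: compactin_subtopology)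
    then obtain R where R: "\<And>x. x \<in> C \<Longrightarrow> norm (x - p) \<le> R"
      using compact_imp_bounded[OF C(1)] bounded_any_center[of C p] by (metis dist_norm dist_commute)
    let ?E = "{z \<in> DW. d z \<noteq> 0 \<and> m z \<in> C}"
    \<comment> \<open>For a neighbourhood of infinity the preimage of \<open>C\<close> must be
      closed, although \<open>m\<close> is undefined where \<open>d\<close> vanishes. Boundedness of
      \<open>C\<close> confines this preimage to a closed set that avoids the zeros of
      \<open>d\<close>: \<open>d z = 0\<close> would force \<open>z = 0\<close>, where
      \<open>d\<close> equals 1.\<close>
    let ?D' = "{z \<in> DW. norm z \<le> R * d z}"
    have nz: "d z \<noteq> 0" if "z \<in> ?D'" for z
      using that g_nonneg[of z] g_0 by force
    have "closed ?D'"
    proof -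
      have "closed (DW \<inter> {z. norm z \<le> R * d z})"
        by (intro closed_Int closed_D closed_Collect_le continuous_intros continuous_on_subset[OF cont_g]) auto
      moreover have "DW \<inter> {z. norm z \<le> R * d z} = ?D'" by auto
      ultimately show ?thesis by simp
    qed
    have "closedin (top_of_set ?D') (?D' \<inter> (\<lambda>z. m z) -` C)"
      by (rule continuous_closedin_preimage[OF continuous_on_m]) (use nz compact_imp_closed[OF C(1)] in auto)
    then have "closed (?D' \<inter> (\<lambda>z. m z) -` C)"
      using \<open>closed ?D'\<close> closedin_closed_trans by blast
    moreover have "?D' \<inter> (\<lambda>z. m z) -` C = ?E"
    proof -
      have "norm z \<le> R * d z" if "z \<in> DW" "d z \<noteq> 0" "m z \<in> C" for z
      proof -
        have "norm (z /\<^sub>R d z) \<le> R" using R[OF that(3)] by simp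
        moreover have "0 < d z" using d_nonneg[OF that(1)] that(2) by linarith
        ultimately show ?thesis by (simp add: field_simps)
      qed
      then show ?thesis using nz by auto
    qed
    ultimately have "closed ?E" by simp
    then have "openin (top_of_set DW) (DW - ?E)"
      by (simp add: Diff_eq open_Compl openin_open_Int)
    moreover have "DW - ?E = {x \<in> topspace (top_of_set DW). cmap x \<in> V}"
      using 2 C by (auto simp: cmap_def)
    ultimately show ?thesis by simp
  qed
qed

lemma euler_pair_gauge_cell:
  "euler_pair (subtopology (Alexandroff_compactification (top_of_set X)) (insert None (Some ` (S \<union> cell))))
     (insert None (Some ` S)) ((-1) ^ dim W)"
proof -
  let ?K = "Alexandroff_compactification (top_of_set X)"
  let ?L = "insert None (Some ` (S \<union> cell))"
  have SX: "S \<subseteq> X" using closed_S closedin_subset by fastforce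
  have cX: "cell \<subseteq> X - S" using cell_X by (auto simp: cell_def)
  have cS: "cmap z \<in> insert None (Some ` (S \<union> cell))" if "z \<in> DW" for z
  proof (cases "norm z < 1")
    case True
    then show ?thesis using cmap_ball[of z] that by auto
  next
    case False
    then show ?thesis using cmap_sphere[of z] that by auto
  qed
  interpret attached_cell "subtopology ?K ?L" "insert None (Some ` S)" W cmap
  proof
    have "Hausdorff_space (top_of_set X)" by (simp add: Hausdorff_space_subtopology)
    then have "Hausdorff_space ?K"
      using loc_compact by (simp add: Hausdorff_space_Alexandroff_compactification)
    then show "Hausdorff_space (subtopology ?K ?L)" by (rule Hausdorff_space_subtopology)
    \<comment> \<open>Closedness in the compactification is checked on the complement, an open
      subset of \<open>X\<close>; \<open>S\<close> itself need not be compact.\<close>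
    have "openin (top_of_set X) (X - S)"
      using closed_S by (metis openin_diff openin_topspace topspace_euclidean_subtopology)
    then have "closedin ?K (topspace ?K - Some ` (X - S))"
      unfolding closedin_Alexandroff_compactification by blast
    moreover have "topspace ?K - Some ` (X - S) = insert None (Some ` S)" using SX by auto
    ultimately have "closedin ?K (insert None (Some ` S))" by simp
    then show "closedin (subtopology ?K ?L) (insert None (Some ` S))"
      by (rule closedin_subset_topspace) auto
    show "continuous_map (top_of_set (cball 0 1 \<inter> W)) (subtopology ?K ?L) cmap"
      by (rule continuous_map_into_subtopology[OF continuous_cmap]) (use cS in auto)
    show "cmap z \<in> insert None (Some ` S)" if "z \<in> sphere 0 1 \<inter> W" for z
      using cmap_sphere that .
    show "cmap z \<notin> insert None (Some ` S)" if "z \<in> ball 0 1 \<inter> W" for z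
      using cmap_ball[OF that] cX by auto
    show "topspace (subtopology ?K ?L) = insert None (Some ` S) \<union> cmap ` (ball 0 1 \<inter> W)"
      unfolding cmap_onto using SX cX by auto
  qed (use W inj_cmap in auto)
  show ?thesis by (rule euler_pair_cell)
qed

end

section \<open>The orthant decomposition of an affine space\<close>

definition same_signs :: "'a::euclidean_space \<Rightarrow> 'a \<Rightarrow> bool" where
  "same_signs x y \<longleftrightarrow> (\<forall>b\<in>Basis. sgn (x \<bullet> b) = sgn (y \<bullet> b))"

definition orthant_cell :: "'a::euclidean_space set \<Rightarrow> 'a \<Rightarrow> 'a set" where
  "orthant_cell A x = {y \<in> A. same_signs x y}"

definition directions :: "'a::euclidean_space set \<Rightarrow> 'a \<Rightarrow> 'a set" where
  "directions A x = {y. x + y \<in> A}"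

text \<open>The tangent space at \<open>x\<close> of its orthant cell.\<close>

definition cell_directions :: "'a::euclidean_space set \<Rightarrow> 'a \<Rightarrow> 'a set" where
  "cell_directions A x = {y \<in> directions A x. \<forall>b\<in>Basis. x \<bullet> b = 0 \<longrightarrow> y \<bullet> b = 0}"

text \<open>The gauge used to attach a cell is later centred at this very point, so independence of
  the choice never has to be shown.\<close>

definition cell_weight :: "'a::euclidean_space set \<Rightarrow> 'a set \<Rightarrow> int" where
  "cell_weight A c = (-1) ^ dim (cell_directions A (SOME x. x \<in> c))"

text \<open>A rank function on cells that replaces dimension: among finitely many cells, one of
  largest support is relatively open in their union.\<close>

definition support_size :: "'a::euclidean_space \<Rightarrow> nat" where
  "support_size x = card {b \<in> Basis. x \<bullet> b \<noteq> 0}"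

text \<open>The gauge, centred at \<open>x\<close>, of the open orthant face containing \<open>x\<close>; the summands with
  \<open>x \<bullet> b = 0\<close> vanish because division by zero gives zero.\<close>

definition orthant_gauge :: "'a::euclidean_space \<Rightarrow> 'a \<Rightarrow> real" where
  "orthant_gauge x y = Max ((\<lambda>b. max 0 (- (y \<bullet> b) / (x \<bullet> b))) ` Basis)"

lemma same_signs_refl: "same_signs x x"
  and same_signs_sym: "same_signs x y \<Longrightarrow> same_signs y x"
  and same_signs_trans: "same_signs x y \<Longrightarrow> same_signs y z \<Longrightarrow> same_signs x z"
  by (auto simp: same_signs_def)

lemma orthant_cell_self: "x \<in> A \<Longrightarrow> x \<in> orthant_cell A x"
  by (simp add: orthant_cell_def same_signs_refl)

lemma orthant_cell_eq: "y \<in> orthant_cell A x \<Longrightarrow> orthant_cell A y = orthant_cell A x"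
  unfolding orthant_cell_def using same_signs_sym same_signs_trans by blast

lemma finite_orthant_cells: "finite (orthant_cell A ` A)"
proof (rule finite_subset)
  let ?P = "Basis \<rightarrow>\<^sub>E {-1, 0, 1::real}"
  show "orthant_cell A ` A \<subseteq> (\<lambda>\<sigma>. {y \<in> A. \<forall>b\<in>Basis. sgn (y \<bullet> b) = \<sigma> b}) ` ?P"
  proof
    fix c assume "c \<in> orthant_cell A ` A"
    then obtain x where x: "c = orthant_cell A x" by blast
    have "c = {y \<in> A. \<forall>b\<in>Basis. sgn (y \<bullet> b) = (\<lambda>b\<in>Basis. sgn (x \<bullet> b)) b}"
      unfolding x orthant_cell_def same_signs_def by auto
    moreover have "(\<lambda>b\<in>Basis. sgn (x \<bullet> b)) \<in> ?P" by (auto simp: sgn_if)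
    ultimately show "c \<in> (\<lambda>\<sigma>. {y \<in> A. \<forall>b\<in>Basis. sgn (y \<bullet> b) = \<sigma> b}) ` ?P" by blast
  qed
  show "finite ((\<lambda>\<sigma>. {y \<in> A. \<forall>b\<in>Basis. sgn (y \<bullet> b) = \<sigma> b}) ` ?P)"
    by (intro finite_imageI finite_PiE) auto
qed

lemma subspace_directions:
  assumes "affine A" "x \<in> A"
  shows "subspace (directions A x)"
proof -
  have "directions A x = (\<lambda>y. y - x) ` A"
    by (force simp: directions_def image_iff)
  then show ?thesis using affine_diffs_subspace_subtract[OF assms] by simp
qed

lemma subspace_cell_directions:
  assumes "affine A" "x \<in> A"
  shows "subspace (cell_directions A x)"
  using subspace_directions[OF assms]
  by (auto simp: subspace_def cell_directions_def inner_add_left)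

lemma continuous_on_Max_image:
  fixes f :: "'b \<Rightarrow> 'a::topological_space \<Rightarrow> real"
  assumes "finite F" "F \<noteq> {}" "\<And>b. b \<in> F \<Longrightarrow> continuous_on T (f b)"
  shows "continuous_on T (\<lambda>y. Max ((\<lambda>b. f b y) ` F))"
  using assms
proof (induction F rule: finite_ne_induct)
  case (insert b F)
  have "continuous_on T (\<lambda>y. max (f b y) (Max ((\<lambda>b. f b y) ` F)))"
    using insert by (intro continuous_on_max) auto
  then show ?case using insert by simp
qed simp

lemma orthant_gauge_continuous: "continuous_on UNIV (orthant_gauge x)"
proof -
  have "continuous_on UNIV (\<lambda>y. max 0 (- (y \<bullet> b) / (x \<bullet> b)))" for b
    unfolding divide_inverse by (intro continuous_on_max continuous_intros)
  then have "continuous_on UNIV (\<lambda>y. orthant_gauge x y)"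
    unfolding orthant_gauge_def by (intro continuous_on_Max_image) auto
  then show ?thesis by simp
qed

lemma orthant_gauge_nonneg: "0 \<le> orthant_gauge x y"
proof -
  obtain b :: 'a where "b \<in> Basis" using nonempty_Basis by blast
  then have "max 0 (- (y \<bullet> b) / (x \<bullet> b)) \<le> orthant_gauge x y"
    unfolding orthant_gauge_def by (intro Max_ge) auto
  then show ?thesis by linarith
qed

lemma orthant_gauge_scale:
  assumes "0 \<le> c"
  shows "orthant_gauge x (c *\<^sub>R y) = c * orthant_gauge x y"
proof -
  have "mono (\<lambda>r. c * r)" using assms by (simp add: mono_def mult_left_mono)
  then have "c * orthant_gauge x y = Max ((\<lambda>r. c * r) ` (\<lambda>b. max 0 (- (y \<bullet> b) / (x \<bullet> b))) ` Basis)"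
    unfolding orthant_gauge_def by (intro mono_Max_commute) auto
  also have "\<dots> = orthant_gauge x (c *\<^sub>R y)"
    unfolding orthant_gauge_def image_image using assms by (simp add: max_mult_distrib_left)
  finally show ?thesis by simp
qed

text \<open>Where \<open>x \<bullet> b\<close> is nonzero, the inequality
  \<open>- (y \<bullet> b) / (x \<bullet> b) < 1\<close> says that
  \<open>(x + y) \<bullet> b\<close> divided by \<open>x \<bullet> b\<close> is positive. Where it
  is zero, the assumption keeps the coordinate zero.\<close>

lemma orthant_gauge_less:
  assumes "\<And>b. b \<in> Basis \<Longrightarrow> x \<bullet> b = 0 \<Longrightarrow> y \<bullet> b = 0"
  shows "orthant_gauge x y < 1 \<longleftrightarrow> same_signs x (x + y)"
proof -
  have "orthant_gauge x y < 1 \<longleftrightarrow> (\<forall>b\<in>Basis. - (y \<bullet> b) / (x \<bullet> b) < 1)"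
    unfolding orthant_gauge_def by (subst Max_less_iff) auto
  also have "\<dots> \<longleftrightarrow> (\<forall>b\<in>Basis. sgn (x \<bullet> b) = sgn ((x + y) \<bullet> b))"
  proof (rule ball_cong[OF refl])
    fix b :: 'a assume b: "b \<in> Basis"
    show "- (y \<bullet> b) / (x \<bullet> b) < 1 \<longleftrightarrow> sgn (x \<bullet> b) = sgn ((x + y) \<bullet> b)"
    proof (cases "x \<bullet> b = 0")
      case True
      then show ?thesis using assms[OF b] by (simp add: inner_add_left)
    next
      case False
      then consider "0 < x \<bullet> b" | "x \<bullet> b < 0" by linarith
      then show ?thesis
        by cases (auto simp: inner_add_left sgn_if pos_divide_less_eq neg_divide_less_eq pos_less_divide_eq neg_less_divide_eq)
    qed
  qed
  finally show ?thesis by (simp add: same_signs_def)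
qed

lemma gauge_cell_orthant_cell:
  assumes "affine A"
  shows "(\<lambda>y. x + y) ` {y \<in> cell_directions A x. orthant_gauge x y < 1} = orthant_cell A x"
proof -
  have "x + y \<in> orthant_cell A x" if "y \<in> cell_directions A x" "orthant_gauge x y < 1" for y
    using that orthant_gauge_less[of x y] by (auto simp: orthant_cell_def cell_directions_def directions_def)
  moreover have "z - x \<in> cell_directions A x \<and> orthant_gauge x (z - x) < 1" if "z \<in> orthant_cell A x" for z
  proof -
    have z: "z \<in> A" "same_signs x z" using that by (auto simp: orthant_cell_def)
    have *: "(z - x) \<bullet> b = 0" if "b \<in> Basis" "x \<bullet> b = 0" for b
    proof -
      have "sgn (z \<bullet> b) = 0" using z that by (auto simp: same_signs_def)
      then show ?thesis using that by (simp add: inner_diff_left sgn_zero_iff)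
    qed
    then show ?thesis using z orthant_gauge_less[of x "z - x"]
      by (auto simp: cell_directions_def directions_def)
  qed
  ultimately show ?thesis
    by (auto simp: image_iff) (metis add_diff_cancel_left' add.commute diff_add_cancel)
qed

section \<open>Euler characteristics of unions of orthant cells\<close>

lemma support_size_cell: "same_signs x y \<Longrightarrow> support_size x = support_size y"
  unfolding support_size_def same_signs_def
  by (rule arg_cong[where f = card]) (metis (mono_tags, lifting) sgn_zero_iff)

text \<open>The support of \<open>x\<close> is contained in that of \<open>y\<close>, and the
  cardinalities force equality. The first assumption is an open condition on \<open>y\<close>; this
  is how maximal support yields relatively open cells.\<close>

lemma same_signs_if_support_size_le:
  assumes "\<And>b. b \<in> Basis \<Longrightarrow> x \<bullet> b \<noteq> 0 \<Longrightarrow> sgn (x \<bullet> b) = sgn (y \<bullet> b)" "support_size y \<le> support_size x"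
  shows "same_signs x y"
proof -
  have "{b \<in> Basis. x \<bullet> b \<noteq> 0} \<subseteq> {b \<in> Basis. y \<bullet> b \<noteq> 0}"
    using assms(1) by (metis (mono_tags, lifting) Collect_mono sgn_zero_iff)
  then have "{b \<in> Basis. x \<bullet> b \<noteq> 0} = {b \<in> Basis. y \<bullet> b \<noteq> 0}"
    using assms(2) unfolding support_size_def by (intro card_seteq) auto
  then have "x \<bullet> b = 0 \<Longrightarrow> b \<in> Basis \<Longrightarrow> y \<bullet> b = 0" for b by blast
  then show ?thesis using assms(1) unfolding same_signs_def by (metis sgn_zero_iff)
qed

lemma locally_compact_space_affine_Int_open:
  fixes A :: "'a::euclidean_space set"
  assumes "affine A" "open U"
  shows "locally_compact_space (top_of_set (A \<inter> U))"
proof -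
  have lc: "locally_compact_space (euclidean :: 'a topology)"
    by (rule locally_compact_space_euclidean)
  have "locally_compact_space (top_of_set A)"
    by (rule locally_compact_space_closed_subset[OF lc]) (simp add: assms affine_closed)
  then have "locally_compact_space (subtopology (top_of_set A) (A \<inter> U))"
    by (rule locally_compact_space_open_subset[rotated])
       (auto simp: assms openin_open_Int Hausdorff_space_subtopology)
  then show ?thesis by (simp add: subtopology_subtopology)
qed

lemma euler_pair_point: "euler_pair (subtopology (Alexandroff_compactification X) {None}) {None} 0"
proof -
  have "topspace (subtopology (Alexandroff_compactification X) {None}) = {None}" by auto
  then show ?thesis
    using trivial_relative_homology_group_topspace[of _ "subtopology (Alexandroff_compactification X) {None}"]
    by (intro euler_pair_trivial) simp
qed

text \<open>Remove a cell of largest support from \<open>F\<close>: it is relatively open in the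
  union, so the rest stays closed and the cell can be attached to it. The set \<open>U\<close>
  permits frontier points outside the space, which are sent to infinity.\<close>

lemma euler_pair_orthant_cells:
  fixes A :: "'a::euclidean_space set"
  assumes A: "affine A" and U: "open U"
    and F: "F \<subseteq> orthant_cell A ` A" "closedin (top_of_set (A \<inter> U)) (\<Union>F)"
  shows "euler_pair (subtopology (Alexandroff_compactification (top_of_set (A \<inter> U))) (insert None (Some ` \<Union>F)))
     {None} (\<Sum>c\<in>F. cell_weight A c)"
proof -
  have "finite F" using F(1) finite_orthant_cells finite_subset by blast
  then show ?thesis using F
  proof (induction F rule: finite_psubset_induct)
    case (psubset F)
    let ?K = "Alexandroff_compactification (top_of_set (A \<inter> U))"
    show ?case
    proof (cases "F = {}")
      case True
      then show ?thesis using euler_pair_point by simp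
    next
      case False
      let ?r = "\<lambda>c. support_size (SOME x. x \<in> c)"
      obtain c where c: "c \<in> F" "\<And>c'. c' \<in> F \<Longrightarrow> ?r c' \<le> ?r c"
      proof -
        have "Max (?r ` F) \<in> ?r ` F" using psubset.hyps False by (intro Max_in) auto
        then obtain c where "c \<in> F" "Max (?r ` F) = ?r c" by blast
        then show ?thesis using that psubset.hyps by (metis Max_ge finite_imageI imageI)
      qed
      define x where "x = (SOME x. x \<in> c)"
      have some: "(SOME x. x \<in> c') \<in> c' \<and> c' = orthant_cell A (SOME x. x \<in> c')" if c': "c' \<in> F" for c'
      proof -
        obtain z where z: "z \<in> A" "c' = orthant_cell A z" using psubset.prems(1) c' by blast
        then have "(SOME x. x \<in> c') \<in> c'" using orthant_cell_self[of z A] by (metis someI_ex)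
        then show ?thesis using z orthant_cell_eq by blast
      qed
      have xc: "x \<in> c" "c = orthant_cell A x" using some[OF c(1)] by (auto simp: x_def)
      then have xA: "x \<in> A" by (auto simp: orthant_cell_def)
      have le: "support_size y \<le> support_size x" if y: "y \<in> \<Union>F" for y
      proof -
        obtain c' where c': "c' \<in> F" "y \<in> c'" using y by blast
        have "same_signs (SOME x. x \<in> c') y"
          using some[OF c'(1)] c'(2) by (metis (no_types, lifting) mem_Collect_eq orthant_cell_def)
        then have "support_size y = ?r c'" using support_size_cell by metis
        then show ?thesis using c(2)[OF c'(1)] by (simp add: x_def)
      qed
      have disj: "c \<inter> c' = {}" if "c' \<in> F - {c}" for c'
      proof (rule ccontr)
        assume "c \<inter> c' \<noteq> {}"
        then obtain y where "y \<in> c" "y \<in> c'" by blast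
        then have "c = c'" using xc some[of c'] that orthant_cell_eq by (metis DiffD1)
        then show False using that by simp
      qed
      define S where "S = \<Union>(F - {c})"
      \<comment> \<open>Open condition that the nonzero coordinates of \<open>x\<close> keep their
        sign. The remaining coordinates are unconstrained, but inside the union of \<open>F\<close>
        maximality of the support forces them to be zero.\<close>
      define V where "V = {y. \<forall>b\<in>Basis. x \<bullet> b \<noteq> 0 \<longrightarrow> 0 < (x \<bullet> b) * (y \<bullet> b)}"
      have "open V"
      proof -
        have "V = (\<Inter>b\<in>{b\<in>Basis. x \<bullet> b \<noteq> 0}. {y. 0 < (x \<bullet> b) * (y \<bullet> b)})" by (auto simp: V_def)
        then show ?thesis
          by (auto intro!: open_INT open_Collect_less continuous_intros)
      qed
      have cV: "c = \<Union>F \<inter> V"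
      proof
        show "c \<subseteq> \<Union>F \<inter> V"
        proof
          fix y assume y: "y \<in> c"
          have "0 < (x \<bullet> b) * (y \<bullet> b)" if "b \<in> Basis" "x \<bullet> b \<noteq> 0" for b
          proof -
            have "sgn (x \<bullet> b) = sgn (y \<bullet> b)" using y xc that by (auto simp: orthant_cell_def same_signs_def)
            then show ?thesis using that(2)
              by (metis linorder_neqE_linordered_idom mult_neg_neg mult_pos_pos sgn_less sgn_greater)
          qed
          then show "y \<in> \<Union>F \<inter> V" using y c by (auto simp: V_def)
        qed
        show "\<Union>F \<inter> V \<subseteq> c"
        proof
          fix y assume y: "y \<in> \<Union>F \<inter> V"
          then have yA: "y \<in> A" using psubset.prems(1) by (auto simp: orthant_cell_def)
          have "same_signs x y"
          proof (rule same_signs_if_support_size_le)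
            show "support_size y \<le> support_size x" using le y by blast
            fix b :: 'a assume "b \<in> Basis" "x \<bullet> b \<noteq> 0"
            then have "0 < (x \<bullet> b) * (y \<bullet> b)" using y by (auto simp: V_def)
            then show "sgn (x \<bullet> b) = sgn (y \<bullet> b)" by (auto simp: zero_less_mult_iff)
          qed
          then show "y \<in> c" using yA xc by (simp add: orthant_cell_def)
        qed
      qed
      have SF: "S = \<Union>F - V"
      proof -
        have "S = \<Union>F - c" using disj by (auto simp: S_def)
        then show ?thesis using cV by auto
      qed
      have closedS: "closedin (top_of_set (A \<inter> U)) S"
      proof -
        have "S = \<Union>F \<inter> (- V)" using SF by auto
        moreover have "closedin (top_of_set (A \<inter> U)) (\<Union>F \<inter> (- V))"
          using psubset.prems(2) \<open>open V\<close>
          by (metis closed_Compl closedin_Int closedin_closed_Int closedin_imp_subset inf.orderE inf_assoc)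
        ultimately show ?thesis by simp
      qed
      have FX: "\<Union>F \<subseteq> A \<inter> U" using psubset.prems(2) closedin_imp_subset by blast
      have cellX: "x + y \<in> c" if "y \<in> cell_directions A x" "orthant_gauge x y < 1" for y
        using gauge_cell_orthant_cell[OF A, of x] xc that by blast
      interpret gauge_cell "A \<inter> U" S "cell_directions A x" "orthant_gauge x" x
      proof
        show "locally_compact_space (top_of_set (A \<inter> U))"
          by (rule locally_compact_space_affine_Int_open[OF A U])
        show "subspace (cell_directions A x)" by (rule subspace_cell_directions[OF A xA])
        show "x + y \<in> A \<inter> U - S" if "y \<in> cell_directions A x" "orthant_gauge x y < 1" for y
          using cellX[OF that] FX c(1) cV SF by blast
        show "\<exists>T. open T \<and> (\<forall>y\<in>cell_directions A x. orthant_gauge x y \<le> 1 \<longrightarrow> (x + y \<in> A \<inter> U \<longleftrightarrow> x + y \<in> T))"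
          using U by (intro exI[of _ U]) (auto simp: cell_directions_def directions_def)
        show "x + y \<in> S" if y: "y \<in> cell_directions A x" "orthant_gauge x y = 1" "x + y \<in> A \<inter> U" for y
        proof -
          \<comment> \<open>The frontier point is the limit of points on the segment from
            \<open>x\<close>, which lie in the cell because the gauge is homogeneous. Closedness of
            the union within the space then keeps the limit in it.\<close>
          have "x + y \<in> closure c"
          proof (rule closure_sequential[THEN iffD2], intro exI conjI allI)
            let ?s = "\<lambda>n. x + (1 - inverse (real (Suc n))) *\<^sub>R y"
            have "(\<lambda>n. 1 - inverse (real (Suc n))) \<longlonglongrightarrow> 1 - 0"
              by (intro tendsto_intros LIMSEQ_inverse_real_of_nat)
            then have "?s \<longlonglongrightarrow> x + 1 *\<^sub>R y" by (intro tendsto_intros) simp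
            then show "?s \<longlonglongrightarrow> x + y" by simp
            fix n
            have "0 \<le> 1 - inverse (real (Suc n))" "1 - inverse (real (Suc n)) < 1"
              by (auto simp: field_simps)
            then have "orthant_gauge x ((1 - inverse (real (Suc n))) *\<^sub>R y) < 1"
              using orthant_gauge_scale[of "1 - inverse (real (Suc n))" x y] y(2) by simp
            moreover have "(1 - inverse (real (Suc n))) *\<^sub>R y \<in> cell_directions A x"
              using subspace_cell_directions[OF A xA] y(1) by (rule subspace_scale)
            ultimately show "?s n \<in> c" using cellX by blast
          qed
          then have "x + y \<in> closure (\<Union>F)" using c(1) by (meson Union_upper closure_mono subsetD)
          then have "x + y \<in> \<Union>F"
            using psubset.prems(2) y(3) by (metis Int_iff closedin_closed closure_minimal inf.cobounded2 subsetD)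
          moreover have "x + y \<notin> c"
          proof
            assume "x + y \<in> c"
            then have "same_signs x (x + y)" using xc by (simp add: orthant_cell_def)
            then have "orthant_gauge x y < 1"
              using orthant_gauge_less[of x y] y(1) by (auto simp: cell_directions_def)
            then show False using y(2) by simp
          qed
          ultimately show ?thesis using cV SF by blast
        qed
      qed (use orthant_gauge_continuous orthant_gauge_nonneg orthant_gauge_scale closedS in auto)
      have cell_eq: "cell = c"
        unfolding cell_def gauge_cell_orthant_cell[OF A] xc(2) by (rule refl)
      have "S \<union> cell = \<Union>F" unfolding cell_eq using cV SF by blast
      then have e1: "euler_pair (subtopology ?K (insert None (Some ` \<Union>F))) (insert None (Some ` S)) (cell_weight A c)"
        using euler_pair_gauge_cell by (simp add: cell_weight_def x_def)
      have sub: "subtopology (subtopology ?K (insert None (Some ` \<Union>F))) (insert None (Some ` S))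
          = subtopology ?K (insert None (Some ` S))"
        unfolding subtopology_subtopology by (rule arg_cong[where f = "subtopology ?K"]) (use SF in auto)
      have "euler_pair (subtopology ?K (insert None (Some ` S))) {None} (\<Sum>c\<in>F - {c}. cell_weight A c)"
        unfolding S_def
        by (rule psubset.IH) (use c psubset.prems closedS in \<open>auto simp: S_def\<close>)
      then have "euler_pair (subtopology ?K (insert None (Some ` \<Union>F))) {None}
          ((\<Sum>c\<in>F - {c}. cell_weight A c) + cell_weight A c)"
        by (intro euler_pair_triple[OF _ _ e1]) (simp_all add: sub)
      then show ?thesis
        using sum.remove[OF psubset.hyps(1) c(1), of "cell_weight A"] by (simp add: add.commute)
    qed
  qed
qed

text \<open>With the zero gauge the whole flat is one cell, and the entire bounding sphere goes to
  infinity.\<close>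

lemma euler_pair_flat:
  fixes A :: "'a::euclidean_space set"
  assumes A: "affine A" and F: "affine F" "F \<subseteq> A" "x \<in> F"
  shows "euler_pair (subtopology (Alexandroff_compactification (top_of_set A)) (insert None (Some ` F)))
     {None} ((-1) ^ dim (directions F x))"
proof -
  interpret gauge_cell A "{}" "directions F x" "\<lambda>_. 0" x
  proof
    show "locally_compact_space (top_of_set A)"
      using locally_compact_space_affine_Int_open[OF A open_UNIV] by simp
    show "\<exists>U. open U \<and> (\<forall>y\<in>directions F x. (0::real) \<le> 1 \<longrightarrow> (x + y \<in> A \<longleftrightarrow> x + y \<in> U))"
      using F by (intro exI[of _ UNIV]) (auto simp: directions_def)
  qed (use F subspace_directions in \<open>auto simp: directions_def\<close>)
  have "cell = F"
    unfolding cell_def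
    by (auto simp: directions_def image_iff) (metis add.commute diff_add_cancel)
  then show ?thesis using euler_pair_gauge_cell by simp
qed

text \<open>Cells and weights are those of \<open>A\<close>, so one family of weights serves every
  flat in the later inclusion-exclusion; the saturation assumption makes \<open>F\<close> a union of
  such cells.\<close>

lemma sum_cell_weight_flat:
  fixes A :: "'a::euclidean_space set"
  assumes A: "affine A" and F: "affine F" "F \<subseteq> A" "x \<in> F"
    and sat: "\<And>y z. y \<in> F \<Longrightarrow> z \<in> A \<Longrightarrow> same_signs y z \<Longrightarrow> z \<in> F"
  shows "(\<Sum>c\<in>{c \<in> orthant_cell A ` A. c \<subseteq> F}. cell_weight A c) = (-1) ^ dim (directions F x)"
proof -
  let ?C = "{c \<in> orthant_cell A ` A. c \<subseteq> F}"
  have "\<Union>?C = F"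
  proof
    show "F \<subseteq> \<Union>?C"
    proof
      fix y assume y: "y \<in> F"
      then have "orthant_cell A y \<subseteq> F" using sat by (auto simp: orthant_cell_def)
      then show "y \<in> \<Union>?C" using y F orthant_cell_self[of y A] by auto
    qed
  qed auto
  moreover have "closedin (top_of_set (A \<inter> UNIV)) (\<Union>?C)"
    unfolding calculation using F by (auto intro: closed_subset affine_closed)
  ultimately have "euler_pair (subtopology (Alexandroff_compactification (top_of_set A)) (insert None (Some ` F)))
     {None} (\<Sum>c\<in>?C. cell_weight A c)"
    using euler_pair_orthant_cells[OF A open_UNIV, of ?C] by simp
  then show ?thesis
    using euler_pair_flat[OF A F] by (rule euler_pair_unique)
qed

section \<open>Complements of coordinate hyperplanes\<close>

lemma sum_Pow_insert:
  assumes "finite F" "x \<notin> F"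
  shows "(\<Sum>I\<in>Pow (insert x F). f I) = (\<Sum>I\<in>Pow F. f I + f (insert x I) :: int)"
proof -
  have "(\<Sum>I\<in>Pow (insert x F). f I) = (\<Sum>I\<in>Pow F. f I) + (\<Sum>I\<in>insert x ` Pow F. f I)"
    unfolding Pow_insert by (rule sum.union_disjoint) (use assms in auto)
  also have "(\<Sum>I\<in>insert x ` Pow F. f I) = (\<Sum>I\<in>Pow F. f (insert x I))"
    by (subst sum.reindex) (use assms in \<open>auto simp: inj_on_def\<close>)
  finally show ?thesis by (simp add: sum.distrib)
qed

lemma alternating_sum_Pow:
  assumes "finite Z"
  shows "(\<Sum>I\<in>Pow Z. (-1) ^ card I) = (if Z = {} then 1 else 0 :: int)"
proof (cases "Z = {}")
  case False
  then obtain x F where Z: "Z = insert x F" "x \<notin> F" by (metis mk_disjoint_insert all_not_in_conv)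
  then have F: "finite F" using assms by simp
  have "(-1::int) ^ card I + (-1) ^ card (insert x I) = 0" if "I \<in> Pow F" for I
    using that Z F finite_subset[of I F] by (subst card_insert_disjoint) auto
  then show ?thesis unfolding Z(1) by (subst sum_Pow_insert[OF F Z(2)]) simp
qed simp

section \<open>Complex subspaces as real vector spaces\<close>

lemma scaleR_vec_eq: "r *\<^sub>R x = of_real r *s (x :: complex^'n)"
  unfolding vec_eq_iff vector_scaleR_component vector_smult_component
  by (simp add: scaleR_conv_of_real)

lemma vec_subspace_imp_subspace:
  fixes L :: "(complex^'n) set"
  assumes "vec.subspace L"
  shows "subspace L"
  using assms by (auto simp: subspace_def vec.subspace_def scaleR_vec_eq)

lemma inner_i_vec: "((\<i> *s x) :: complex^'n) \<bullet> y = - (x \<bullet> (\<i> *s y))"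
  by (simp add: inner_vec_def inner_complex_def sum_negf[symmetric])

text \<open>Multiplication by \<i> is skew for the real inner product, so \<open>w\<close> and
  \<open>\<i> *s w\<close> are orthogonal. Splitting off their span lowers the real dimension by 2
  and leaves a complex subspace.\<close>

lemma even_dim_vec_subspace:
  fixes W :: "(complex^'n) set"
  assumes "vec.subspace W"
  shows "even (dim W)"
  using assms
proof (induction "dim W" arbitrary: W rule: less_induct)
  case less
  have sW: "subspace W" using less.prems by (rule vec_subspace_imp_subspace)
  show ?case
  proof (cases "W \<subseteq> {0}")
    case True
    then show ?thesis by (metis dim_eq_0 even_zero)
  next
    case False
    then obtain w where w: "w \<in> W" "w \<noteq> 0" by blast
    let ?w = "\<i> *s w"
    have iw: "?w \<in> W" using less.prems w by (simp add: vec.subspace_scale)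
    have orth: "orthogonal w ?w"
      using inner_i_vec[of w w] by (simp add: orthogonal_def inner_commute)
    have "?w \<noteq> 0" using w by (simp add: vec_eq_iff)
    have "w \<noteq> ?w" using orth w by (auto simp: orthogonal_def)
    have "independent {w, ?w}"
    proof (rule pairwise_orthogonal_independent)
      show "pairwise orthogonal {w, ?w}"
        using orth by (auto simp: pairwise_insert orthogonal_commute)
    qed (use w \<open>?w \<noteq> 0\<close> in auto)
    then have d2: "dim (span {w, ?w}) = 2"
      using \<open>w \<noteq> ?w\<close> by (simp add: dim_eq_card_independent)
    let ?V = "{y \<in> W. \<forall>x\<in>span {w, ?w}. orthogonal x y}"
    have V: "?V = {y \<in> W. w \<bullet> y = 0 \<and> ?w \<bullet> y = 0}"
    proof -
      have "(\<forall>x\<in>span {w, ?w}. orthogonal x y) \<longleftrightarrow> w \<bullet> y = 0 \<and> ?w \<bullet> y = 0" for y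
      proof
        assume "\<forall>x\<in>span {w, ?w}. orthogonal x y"
        then show "w \<bullet> y = 0 \<and> ?w \<bullet> y = 0" by (auto simp: orthogonal_def span_base)
      next
        assume *: "w \<bullet> y = 0 \<and> ?w \<bullet> y = 0"
        show "\<forall>x\<in>span {w, ?w}. orthogonal x y"
        proof
          fix x assume "x \<in> span {w, ?w}"
          then have "orthogonal y x"
            by (rule orthogonal_to_span) (use * in \<open>auto simp: orthogonal_def inner_commute\<close>)
          then show "orthogonal x y" by (simp add: orthogonal_commute)
        qed
      qed
      then show ?thesis by blast
    qed
    have "span {w, ?w} \<subseteq> W" by (rule span_minimal) (use w iw sW in auto)
    then have sum: "dim ?V + dim (span {w, ?w}) = dim W"
      by (intro dim_subspace_orthogonal_to_vectors subspace_span sW)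
    have "vec.subspace ?V"
    proof -
      \<comment> \<open>Multiplying \<open>y\<close> by \<i> merely exchanges the two orthogonality
        conditions up to sign, so together they are stable under complex scalars.\<close>
      have cs: "w \<bullet> (c *s y) = 0 \<and> ?w \<bullet> (c *s y) = 0" if "w \<bullet> y = 0" "?w \<bullet> y = 0" for c y
      proof -
        have "c *s y = Re c *\<^sub>R y + Im c *\<^sub>R (\<i> *s y)"
          by (simp add: vec_eq_iff scaleR_vec_eq complex_eq_iff algebra_simps)
        moreover have "w \<bullet> (\<i> *s y) = 0" "?w \<bullet> (\<i> *s y) = 0"
          using that inner_i_vec[of w y] inner_i_vec[of ?w y]
          by (auto simp: vector_smult_assoc vector_sneg_minus1[symmetric])
        ultimately show ?thesis using that by (simp add: inner_add_right)
      qed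
      then show ?thesis
        unfolding V using less.prems by (auto simp: vec.subspace_def inner_add_right)
    qed
    then have "even (dim ?V)" using less.hyps[of ?V] sum d2 by simp
    moreover have "dim W = dim ?V + 2" using sum d2 by linarith
    ultimately show ?thesis by simp
  qed
qed

text \<open>Real and imaginary part of a component are the real coordinates along
  \<open>axis i 1\<close> and \<open>axis i \<i>\<close>. Hence complex coordinate hyperplanes are
  unions of orthant faces.\<close>

lemma component_zero_same_signs:
  fixes y z :: "complex^'n"
  assumes "same_signs y z"
  shows "y $ i = 0 \<longleftrightarrow> z $ i = 0"
proof -
  have "y \<bullet> axis i 1 = 0 \<longleftrightarrow> z \<bullet> axis i 1 = 0" "y \<bullet> axis i \<i> = 0 \<longleftrightarrow> z \<bullet> axis i \<i> = 0"
    using assms unfolding same_signs_def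
    by (metis (no_types, lifting) sgn_zero_iff axis_in_Basis_iff complex_Basis_1 complex_Basis_i)+
  then show ?thesis by (simp add: inner_axis complex_eq_iff)
qed

lemma euler_pair_hyperplane_complement:
  fixes L :: "(complex^'n) set" and i0 :: 'n
  assumes L: "vec.subspace L"
  defines "A \<equiv> {a \<in> L. a $ i0 = 1}"
  shows "euler_pair (Alexandroff_compactification (top_of_set {a \<in> A. \<forall>i. a $ i \<noteq> 0})) {None}
    (\<Sum>I\<in>Pow UNIV. (-1) ^ card I * (if \<exists>a\<in>A. \<forall>i\<in>I. a $ i = 0 then 1 else 0))"
proof -
  define U where "U = {x::complex^'n. \<forall>i. x $ i \<noteq> 0}"
  define C where "C = orthant_cell A ` A"
  define Z where "Z = (\<lambda>c. {i::'n. \<forall>y\<in>c. y $ i = (0::complex)})"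
  define H where "H = (\<lambda>I. {a \<in> A. \<forall>i\<in>I. a $ i = 0})"
  have sL: "subspace L" using L by (rule vec_subspace_imp_subspace)
  have comp: "(u *\<^sub>R x + v *\<^sub>R y) $ i = c" if "x $ i = c" "y $ i = c" "u + v = 1" for u v x y i c
  proof -
    have "(u *\<^sub>R x + v *\<^sub>R y) $ i = (u + v) *\<^sub>R c"
      using that(1,2) by (simp add: scaleR_add_left)
    then show ?thesis using that(3) by simp
  qed
  have affH: "affine (H I)" for I
    unfolding affine_def
  proof (intro ballI allI impI)
    fix x y :: "complex^'n" and u v :: real
    assume xy: "x \<in> H I" "y \<in> H I" and uv: "u + v = 1"
    have "u *\<^sub>R x + v *\<^sub>R y \<in> L"
      using subspace_imp_affine[OF sL] xy uv unfolding affine_def H_def A_def by blast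
    then show "u *\<^sub>R x + v *\<^sub>R y \<in> H I"
      using xy comp[OF _ _ uv] unfolding H_def A_def by blast
  qed
  have A: "affine A" using affH[of "{}"] by (simp add: H_def)
  have U: "open U"
  proof -
    have "U = (\<Inter>i\<in>UNIV. {x. x $ i \<noteq> 0})" by (auto simp: U_def)
    then show ?thesis by (auto intro!: open_INT open_Collect_neq continuous_intros)
  qed
  have AU: "A \<inter> U = {a \<in> A. \<forall>i. a $ i \<noteq> 0}" by (auto simp: U_def)
  have cell: "c \<noteq> {} \<and> c \<subseteq> A \<and> (\<forall>y\<in>c. \<forall>z\<in>c. \<forall>i. y $ i = 0 \<longleftrightarrow> z $ i = 0)" if c: "c \<in> C" for c
  proof -
    obtain x where x: "x \<in> A" "c = orthant_cell A x" using c by (auto simp: C_def)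
    have "same_signs y z" if "y \<in> c" "z \<in> c" for y z
      using that same_signs_sym same_signs_trans unfolding x orthant_cell_def by blast
    then have "\<forall>y\<in>c. \<forall>z\<in>c. \<forall>i. y $ i = 0 \<longleftrightarrow> z $ i = 0"
      using component_zero_same_signs by blast
    moreover have "c \<noteq> {}" using x orthant_cell_self[of x A] by blast
    moreover have "c \<subseteq> A" unfolding x orthant_cell_def by blast
    ultimately show ?thesis by blast
  qed
  have finC: "finite C" unfolding C_def by (rule finite_orthant_cells)
  have cU: "c \<subseteq> A \<inter> U \<longleftrightarrow> Z c = {}" if "c \<in> C" for c
    using cell[OF that] unfolding U_def Z_def by blast
  have cH: "c \<subseteq> H I \<longleftrightarrow> I \<subseteq> Z c" if "c \<in> C" for c I
    using cell[OF that] unfolding H_def Z_def by blast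
  have flat: "(\<Sum>c\<in>{c \<in> C. c \<subseteq> H I}. cell_weight A c) = (if H I \<noteq> {} then 1 else 0)" for I
  proof (cases "H I = {}")
    case True
    then have "{c \<in> C. c \<subseteq> H I} = {}" using cell by blast
    then have "(\<Sum>c\<in>{c \<in> C. c \<subseteq> H I}. cell_weight A c) = 0" by (simp only: sum.empty)
    then show ?thesis using True by simp
  next
    case False
    then obtain x where x: "x \<in> H I" by blast
    have "(\<Sum>c\<in>{c \<in> C. c \<subseteq> H I}. cell_weight A c) = (-1) ^ dim (directions (H I) x)"
      unfolding C_def
    proof (rule sum_cell_weight_flat[OF A affH _ x])
      show "H I \<subseteq> A" by (auto simp: H_def)
      show "z \<in> H I" if "y \<in> H I" "z \<in> A" "same_signs y z" for y z
        using that component_zero_same_signs[OF that(3)] by (auto simp: H_def)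
    qed
    \<comment> \<open>The inhomogeneous condition at \<open>i0\<close> becomes homogeneous on
      directions, so the direction space is complex linear and the sign is 1.\<close>
    moreover have "directions (H I) x = {y \<in> L. y $ i0 = 0 \<and> (\<forall>i\<in>I. y $ i = 0)}"
    proof -
      have xL: "x \<in> L" "x $ i0 = 1" "\<And>i. i \<in> I \<Longrightarrow> x $ i = 0" using x by (auto simp: H_def A_def)
      have "x + y \<in> L \<longleftrightarrow> y \<in> L" for y
        using subspace_add[OF sL xL(1), of y] subspace_diff[OF sL _ xL(1), of "x + y"] by auto
      then show ?thesis using xL by (auto simp: directions_def H_def A_def)
    qed
    moreover have "vec.subspace {y \<in> L. y $ i0 = 0 \<and> (\<forall>i\<in>I. y $ i = 0)}"
      using L by (auto simp: vec.subspace_def)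
    ultimately show ?thesis using even_dim_vec_subspace False by (metis (no_types, lifting) neg_one_even_power)
  qed
  define F where "F = {c \<in> C. c \<subseteq> A \<inter> U}"
  have UF: "\<Union>F = A \<inter> U"
  proof
    show "A \<inter> U \<subseteq> \<Union>F"
    proof
      fix x assume x: "x \<in> A \<inter> U"
      then have "orthant_cell A x \<subseteq> A \<inter> U"
        using component_zero_same_signs[of x] by (auto simp: orthant_cell_def U_def)
      then show "x \<in> \<Union>F" using x orthant_cell_self[of x A] by (auto simp: F_def C_def)
    qed
  qed (auto simp: F_def)
  have "euler_pair (subtopology (Alexandroff_compactification (top_of_set (A \<inter> U))) (insert None (Some ` \<Union>F)))
     {None} (\<Sum>c\<in>F. cell_weight A c)"
    by (rule euler_pair_orthant_cells[OF A U]) (use UF in \<open>auto simp: F_def C_def\<close>)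
  moreover have "insert None (Some ` \<Union>F) = topspace (Alexandroff_compactification (top_of_set (A \<inter> U)))"
    unfolding UF by simp
  ultimately have e: "euler_pair (Alexandroff_compactification (top_of_set (A \<inter> U))) {None} (\<Sum>c\<in>F. cell_weight A c)"
    by (metis subtopology_topspace)
  have "(\<Sum>c\<in>F. cell_weight A c) = (\<Sum>c\<in>C. if Z c = {} then cell_weight A c else 0)"
  proof -
    have "F = {c \<in> C. Z c = {}}" unfolding F_def using cU by blast
    then show ?thesis using finC by (simp add: sum.inter_filter)
  qed
  \<comment> \<open>The indicator of an empty zero set is the alternating sum over its subsets.
    After swapping the sums, the inner sum runs over the cells in a flat and is known.\<close>
  also have "\<dots> = (\<Sum>c\<in>C. \<Sum>I\<in>Pow (Z c). (-1) ^ card I * cell_weight A c)"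
  proof (rule sum.cong[OF refl])
    fix c
    have "(\<Sum>I\<in>Pow (Z c). (-1) ^ card I * cell_weight A c) = (\<Sum>I\<in>Pow (Z c). (-1) ^ card I) * cell_weight A c"
      by (simp add: sum_distrib_right)
    then show "(if Z c = {} then cell_weight A c else 0) = (\<Sum>I\<in>Pow (Z c). (-1) ^ card I * cell_weight A c)"
      by (simp add: alternating_sum_Pow)
  qed
  also have "\<dots> = (\<Sum>c\<in>C. \<Sum>I\<in>Pow UNIV. if c \<subseteq> H I then (-1) ^ card I * cell_weight A c else 0)"
  proof (rule sum.cong[OF refl])
    fix c assume c: "c \<in> C"
    have "{I \<in> Pow UNIV. c \<subseteq> H I} = Pow (Z c)" using cH[OF c] by auto
    then show "(\<Sum>I\<in>Pow (Z c). (-1) ^ card I * cell_weight A c) =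
        (\<Sum>I\<in>Pow UNIV. if c \<subseteq> H I then (-1) ^ card I * cell_weight A c else 0)"
      by (subst sum.inter_filter[symmetric]) auto
  qed
  also have "\<dots> = (\<Sum>I\<in>Pow UNIV. \<Sum>c\<in>C. if c \<subseteq> H I then (-1) ^ card I * cell_weight A c else 0)"
    by (rule sum.swap)
  also have "\<dots> = (\<Sum>I\<in>Pow UNIV. (-1) ^ card I * (if \<exists>a\<in>A. \<forall>i\<in>I. a $ i = 0 then 1 else 0))"
  proof (rule sum.cong[OF refl])
    fix I :: "'n set"
    have "(\<Sum>c\<in>C. if c \<subseteq> H I then (-1) ^ card I * cell_weight A c else 0)
      = (-1) ^ card I * (\<Sum>c\<in>{c \<in> C. c \<subseteq> H I}. cell_weight A c)"
      using finC by (subst sum.inter_filter[symmetric]) (auto simp: sum_distrib_left)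
    also have "\<dots> = (-1) ^ card I * (if \<exists>a\<in>A. \<forall>i\<in>I. a $ i = 0 then 1 else 0)"
      unfolding flat by (auto simp: H_def)
    finally show "(\<Sum>c\<in>C. if c \<subseteq> H I then (-1) ^ card I * cell_weight A c else 0)
      = (-1) ^ card I * (if \<exists>a\<in>A. \<forall>i\<in>I. a $ i = 0 then 1 else 0)" .
  qed
  finally show ?thesis using e unfolding AU by simp
qed

section \<open>Quotients and one-point compactifications up to homeomorphism\<close>

text \<open>\<open>topology\<close> is inverted only on predicates satisfying
  \<open>istopology\<close>, so that check precedes any use of the definition.\<close>

lemma quotient_map_quotient_topology:
  "quotient_map X (quotient_topology X f) f"
proof -
  have ist: "istopology (\<lambda>U. U \<subseteq> f ` topspace X \<and> openin X {x \<in> topspace X. f x \<in> U})"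
    unfolding istopology_def
  proof (rule conjI; clarify)
    fix S T
    assume "S \<subseteq> f ` topspace X" "T \<subseteq> f ` topspace X"
      and o: "openin X {x \<in> topspace X. f x \<in> S}" "openin X {x \<in> topspace X. f x \<in> T}"
    have "{x \<in> topspace X. f x \<in> S \<inter> T} = {x \<in> topspace X. f x \<in> S} \<inter> {x \<in> topspace X. f x \<in> T}"
      by auto
    then show "S \<inter> T \<subseteq> f ` topspace X \<and> openin X {x \<in> topspace X. f x \<in> S \<inter> T}"
      using o \<open>S \<subseteq> f ` topspace X\<close> by auto
  next
    fix \<K> assume K: "\<forall>K\<in>\<K>. K \<subseteq> f ` topspace X \<and> openin X {x \<in> topspace X. f x \<in> K}"
    have "{x \<in> topspace X. f x \<in> \<Union>\<K>} = (\<Union>K\<in>\<K>. {x \<in> topspace X. f x \<in> K})" by auto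
    then show "\<Union>\<K> \<subseteq> f ` topspace X \<and> openin X {x \<in> topspace X. f x \<in> \<Union>\<K>}"
      using K by (auto intro!: openin_Union)
  qed
  have op: "openin (quotient_topology X f) U \<longleftrightarrow> U \<subseteq> f ` topspace X \<and> openin X {x \<in> topspace X. f x \<in> U}" for U
    unfolding quotient_topology_def using topology_inverse'[OF ist] by simp
  have "{x \<in> topspace X. f x \<in> f ` topspace X} = topspace X" by auto
  then have "openin (quotient_topology X f) (f ` topspace X)" by (simp add: op)
  then have "topspace (quotient_topology X f) = f ` topspace X"
    by (metis op openin_subset openin_topspace subset_antisym)
  then show ?thesis by (auto simp: quotient_map_def op)
qed

text \<open>The universal property in both directions; it will compare the orbit map with
  normalisation of a coordinate.\<close>

lemma quotient_maps_same_fibres_homeomorphic: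
  assumes f: "quotient_map X Y f" and g: "quotient_map X Z g"
    and fib: "\<And>x y. x \<in> topspace X \<Longrightarrow> y \<in> topspace X \<Longrightarrow> f x = f y \<longleftrightarrow> g x = g y"
  obtains h k where "homeomorphic_maps Y Z h k"
proof -
  obtain h where h: "continuous_map Y Z h" "\<And>x. x \<in> topspace X \<Longrightarrow> h (f x) = g x"
    using quotient_map_lift_exists[OF f quotient_imp_continuous_map[OF g]] fib by metis
  obtain k where k: "continuous_map Z Y k" "\<And>x. x \<in> topspace X \<Longrightarrow> k (g x) = f x"
    using quotient_map_lift_exists[OF g quotient_imp_continuous_map[OF f]] fib by metis
  have "k (h y) = y" if "y \<in> topspace Y" for y
    using that h(2) k(2) quotient_imp_surjective_map[OF f] by (metis imageE)
  moreover have "h (k z) = z" if "z \<in> topspace Z" for z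
    using that h(2) k(2) quotient_imp_surjective_map[OF g] by (metis imageE)
  ultimately have "homeomorphic_maps Y Z h k"
    unfolding homeomorphic_maps_def using h(1) k(1) by blast
  then show ?thesis by (rule that)
qed

text \<open>Neighbourhoods of infinity pull back because the preimage of a compact set
  \<open>C\<close> is its image under the continuous inverse, hence compact.\<close>

lemma continuous_map_option_Alexandroff:
  assumes f: "homeomorphic_maps X Y f g"
  shows "continuous_map (Alexandroff_compactification X) (Alexandroff_compactification Y) (map_option f)"
  unfolding continuous_map_def
proof (intro conjI allI impI)
  have cf: "continuous_map X Y f" and cg: "continuous_map Y X g"
    and gf: "\<And>x. x \<in> topspace X \<Longrightarrow> g (f x) = x" and fg: "\<And>y. y \<in> topspace Y \<Longrightarrow> f (g y) = y"
    using f by (auto simp: homeomorphic_maps_def)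
  have fY: "f x \<in> topspace Y" if "x \<in> topspace X" for x
    using cf that by (auto simp: continuous_map_def)
  have gX: "g x \<in> topspace X" if "x \<in> topspace Y" for x
    using cg that by (auto simp: continuous_map_def)
  show "map_option f \<in> topspace (Alexandroff_compactification X) \<rightarrow> topspace (Alexandroff_compactification Y)"
    using fY by auto
  fix V assume "openin (Alexandroff_compactification Y) V"
  then consider U where "openin Y U" "V = Some ` U"
    | C where "compactin Y C" "closedin Y C" "V = insert None (Some ` (topspace Y - C))"
    unfolding openin_Alexandroff_compactification by auto
  then show "openin (Alexandroff_compactification X)
      {x \<in> topspace (Alexandroff_compactification X). map_option f x \<in> V}"
  proof cases
    case 1
    have "{x \<in> topspace (Alexandroff_compactification X). map_option f x \<in> V} = Some ` {x \<in> topspace X. f x \<in> U}"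
      using 1 by auto
    then show ?thesis using cf 1 by (auto simp: continuous_map_def)
  next
    case 2
    let ?C = "{x \<in> topspace X. f x \<in> C}"
    have CY: "C \<subseteq> topspace Y" using 2 closedin_subset by blast
    have "?C = g ` C"
    proof
      show "?C \<subseteq> g ` C" using gf by force
      show "g ` C \<subseteq> ?C" using CY gX fg by auto
    qed
    then have "compactin X ?C" using image_compactin[OF 2(1) cg] by simp
    moreover have "closedin X ?C" using cf 2 by (simp add: closedin_continuous_map_preimage)
    moreover have "{x \<in> topspace (Alexandroff_compactification X). map_option f x \<in> V}
        = insert None (Some ` (topspace X - ?C))"
      using 2 fY by auto
    ultimately show ?thesis unfolding openin_Alexandroff_compactification by blast
  qed
qed

lemma euler_pair_Alexandroff_homeomorphic:
  assumes h: "homeomorphic_maps X Y f g" and e: "euler_pair (Alexandroff_compactification Y) {None} e"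
  shows "euler_pair (Alexandroff_compactification X) {None} e"
proof (rule euler_pair_homeomorphic_map[OF e])
  have "homeomorphic_maps (Alexandroff_compactification Y) (Alexandroff_compactification X) (map_option g) (map_option f)"
    unfolding homeomorphic_maps_def
    using continuous_map_option_Alexandroff[OF h] h
      continuous_map_option_Alexandroff[of Y X g f] homeomorphic_maps_sym[of X Y f g]
    by (auto simp: homeomorphic_maps_def)
  then show "homeomorphic_map (Alexandroff_compactification Y) (Alexandroff_compactification X) (map_option g)"
    using homeomorphic_map_maps by blast
qed auto

section \<open>Dimensions of quotients of function spaces\<close>

definition fcomb :: "'i set \<Rightarrow> ('i \<Rightarrow> complex) \<Rightarrow> ('i \<Rightarrow> 'a \<Rightarrow> complex) \<Rightarrow> 'a \<Rightarrow> complex" where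
  "fcomb I a g = (\<lambda>z. \<Sum>j\<in>I. a j * g j z)"

definition fspace :: "('a \<Rightarrow> complex) set \<Rightarrow> bool" where
  "fspace A \<longleftrightarrow> (\<lambda>z. 0) \<in> A \<and> (\<forall>f\<in>A. \<forall>g\<in>A. (\<lambda>z. f z + g z) \<in> A) \<and> (\<forall>c. \<forall>f\<in>A. (\<lambda>z. c * f z) \<in> A)"

definition flinear :: "('a \<Rightarrow> complex) set \<Rightarrow> (('a \<Rightarrow> complex) \<Rightarrow> complex) \<Rightarrow> bool" where
  "flinear A l \<longleftrightarrow> (\<forall>f\<in>A. \<forall>g\<in>A. l (\<lambda>z. f z + g z) = l f + l g) \<and> (\<forall>c. \<forall>f\<in>A. l (\<lambda>z. c * f z) = c * l f)"

text \<open>Linear independence in the quotient, without forming it. The index set is any finite set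
  of naturals, so that single vectors can be added or dropped without renumbering.\<close>

definition qindep :: "('a \<Rightarrow> complex) set \<Rightarrow> ('a \<Rightarrow> complex) set \<Rightarrow> nat set \<Rightarrow> (nat \<Rightarrow> 'a \<Rightarrow> complex) \<Rightarrow> bool" where
  "qindep A B I g \<longleftrightarrow> finite I \<and> g ` I \<subseteq> A \<and> (\<forall>a. fcomb I a g \<in> B \<longrightarrow> (\<forall>j\<in>I. a j = 0))"

definition has_qdim :: "('a \<Rightarrow> complex) set \<Rightarrow> ('a \<Rightarrow> complex) set \<Rightarrow> nat \<Rightarrow> bool" where
  "has_qdim A B n \<longleftrightarrow> (\<exists>I g. qindep A B I g \<and> card I = n) \<and> (\<forall>I g. qindep A B I g \<longrightarrow> card I \<le> n)"

lemma fcomb_insert: "finite I \<Longrightarrow> k \<notin> I \<Longrightarrow> fcomb (insert k I) a g = (\<lambda>z. a k * g k z + fcomb I a g z)"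
  by (simp add: fcomb_def)

lemma fcomb_cong: "(\<And>j. j \<in> I \<Longrightarrow> a j = b j) \<Longrightarrow> (\<And>j. j \<in> I \<Longrightarrow> g j = h j) \<Longrightarrow> fcomb I a g = fcomb I b h"
  unfolding fcomb_def by (intro ext sum.cong) auto

lemma fspace_fcomb:
  assumes "fspace A" "finite I" "g ` I \<subseteq> A"
  shows "fcomb I a g \<in> A"
  using assms(2,3)
proof (induction I)
  case empty
  then show ?case using assms(1) by (simp add: fcomb_def fspace_def)
next
  case (insert k I)
  then show ?case using assms(1) unfolding fcomb_insert[OF insert(1,2)] fspace_def by simp
qed

lemma flinear_zero:
  assumes "fspace A" "flinear A l"
  shows "l (\<lambda>z. 0) = 0"
proof -
  have "(\<lambda>z. 0) \<in> A" using assms(1) by (simp add: fspace_def)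
  moreover have "\<forall>f\<in>A. l (\<lambda>z. 0 * f z) = 0 * l f" using assms(2) unfolding flinear_def by blast
  ultimately show ?thesis by fastforce
qed

lemma flinear_fcomb:
  assumes "fspace A" "flinear A l" "finite I" "g ` I \<subseteq> A"
  shows "l (fcomb I a g) = (\<Sum>j\<in>I. a j * l (g j))"
  using assms(3,4)
proof (induction I)
  case empty
  show ?case using flinear_zero[OF assms(1,2)] by (simp add: fcomb_def)
next
  case (insert k I)
  have "fcomb I a g \<in> A" using insert assms(1) by (intro fspace_fcomb) auto
  moreover have "(\<lambda>z. a k * g k z) \<in> A" "g k \<in> A" using insert.prems assms(1) by (auto simp: fspace_def)
  ultimately have "l (\<lambda>z. a k * g k z + fcomb I a g z) = a k * l (g k) + l (fcomb I a g)"
    using assms(2) unfolding flinear_def by simp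
  then show ?case using insert unfolding fcomb_insert[OF insert(1,2)] by simp
qed

lemma quot_dim_eq:
  assumes "has_qdim A B n"
  shows "quot_dim A B = n"
proof -
  let ?P = "\<lambda>k g. (\<forall>j<k. g j \<in> A) \<and> (\<forall>a. (\<lambda>z. \<Sum>j<k. a j * g j z) \<in> B \<longrightarrow> (\<forall>j<k. a j = 0))"
  have P: "?P k g \<longleftrightarrow> qindep A B {..<k} g" for k g
    by (auto simp: qindep_def fcomb_def)
  obtain I g where I: "qindep A B I g" "card I = n" using assms by (auto simp: has_qdim_def)
  then have "finite I" by (simp add: qindep_def)
  then obtain f where f: "bij_betw f {..<n} I"
    using I(2) ex_bij_betw_nat_finite[of I] by (metis atLeast0LessThan)
  have "qindep A B {..<n} (g \<circ> f)"
    unfolding qindep_def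
  proof (intro conjI allI impI)
    show "(g \<circ> f) ` {..<n} \<subseteq> A" using I f by (auto simp: qindep_def bij_betw_def)
    fix a assume a: "fcomb {..<n} a (g \<circ> f) \<in> B"
    have "fcomb I (a \<circ> inv_into {..<n} f) g = fcomb {..<n} a (g \<circ> f)"
      unfolding fcomb_def using f
      by (intro ext, subst sum.reindex_bij_betw[OF f, symmetric])
         (auto intro!: sum.cong simp: bij_betw_inv_into_left)
    then have "fcomb I (a \<circ> inv_into {..<n} f) g \<in> B" using a by simp
    then have "\<forall>j\<in>I. (a \<circ> inv_into {..<n} f) j = 0" using I(1) unfolding qindep_def by blast
    then show "\<forall>j\<in>{..<n}. a j = 0" using f by (force simp: bij_betw_def bij_betw_inv_into_left)
  qed auto
  then have "n \<in> {k. \<exists>g. ?P k g}" using P by blast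
  moreover have "k \<le> n" if k: "k \<in> {k. \<exists>g. ?P k g}" for k
  proof -
    obtain g where "qindep A B {..<k} g" using k P by auto
    then have "card {..<k} \<le> n" using assms unfolding has_qdim_def by blast
    then show ?thesis by simp
  qed
  ultimately show ?thesis unfolding quot_dim_def by (rule cSup_eq_maximum)
qed

lemma has_qdim_refl:
  assumes "fspace A"
  shows "has_qdim A A 0"
  unfolding has_qdim_def
proof (intro conjI allI impI)
  show "\<exists>I g. qindep A A I g \<and> card I = 0"
    by (rule exI[of _ "{}"]) (simp add: qindep_def)
  fix I and g :: "nat \<Rightarrow> 'a \<Rightarrow> complex" assume I: "qindep A A I g"
  then have "fcomb I (\<lambda>_. 1) g \<in> A" using assms by (intro fspace_fcomb) (auto simp: qindep_def)
  then have "I = {}" using I unfolding qindep_def by fastforce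
  then show "card I \<le> 0" by simp
qed

text \<open>The lower bound shared by the next two results, which use it with \<open>C\<close> equal
  to \<open>B\<close> and with \<open>C\<close> contained in \<open>B\<close>, respectively.\<close>

lemma qindep_extend:
  assumes "qindep A B I g" "k \<notin> I" "b \<in> A"
    and "\<And>c a. (\<lambda>z. c * b z + fcomb I a g z) \<in> C \<Longrightarrow> c = 0 \<and> fcomb I a g \<in> B"
  shows "qindep A C (insert k I) (g(k := b))"
  unfolding qindep_def
proof (intro conjI allI impI)
  have fin: "finite I" using assms(1) by (simp add: qindep_def)
  show "finite (insert k I)" using fin by simp
  show "(g(k := b)) ` insert k I \<subseteq> A" using assms by (auto simp: qindep_def)
  fix a assume a: "fcomb (insert k I) a (g(k := b)) \<in> C"
  have "fcomb I a (g(k := b)) = fcomb I a g" using assms(2) by (intro fcomb_cong) auto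
  then have "(\<lambda>z. a k * b z + fcomb I a g z) \<in> C"
    using a unfolding fcomb_insert[OF fin assms(2)] by simp
  then have "a k = 0" "fcomb I a g \<in> B" using assms(4) by blast+
  then show "\<forall>j\<in>insert k I. a j = 0" using assms(1) by (auto simp: qindep_def)
qed

text \<open>Additivity of dimension in a chain whose upper step is the kernel of one functional:
  \<open>A\<close> exceeds \<open>B\<close> by at most one dimension.\<close>

lemma has_qdim_kernel_top:
  assumes A: "fspace A" and C: "fspace C" and l: "flinear A l" and B: "B = {f \<in> A. l f = 0}" and "C \<subseteq> B"
    and n: "has_qdim B C n"
  shows "has_qdim A C (n + (if \<exists>f\<in>A. l f \<noteq> 0 then 1 else 0))"
proof (cases "\<exists>f\<in>A. l f \<noteq> 0")
  case False
  then have "B = A" using B by auto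
  then show ?thesis using n False by simp
next
  case True
  then obtain f0 where f0: "f0 \<in> A" "l f0 \<noteq> 0" by blast
  have "\<exists>I g. qindep A C I g \<and> card I = n + 1"
  proof -
    obtain I g where I: "qindep B C I g" "card I = n" using n by (auto simp: has_qdim_def)
    then have I': "qindep A C I g" "finite I" and gB: "g ` I \<subseteq> B" using B by (auto simp: qindep_def)
    obtain k where k: "k \<notin> I" using \<open>finite I\<close> ex_new_if_finite infinite_UNIV_nat by metis
    have "qindep A C (insert k I) (g(k := f0))"
    proof (rule qindep_extend[OF I'(1) k f0(1)])
      fix c a assume c: "(\<lambda>z. c * f0 z + fcomb I a g z) \<in> C"
      have fA: "fcomb I a g \<in> A" using A I' by (intro fspace_fcomb) (auto simp: qindep_def)
      have "l (fcomb I a g) = (\<Sum>j\<in>I. a j * l (g j))"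
        using A l I' by (intro flinear_fcomb) (auto simp: qindep_def)
      also have "\<dots> = 0" using gB B by (intro sum.neutral) auto
      finally have l0: "l (fcomb I a g) = 0" .
      have "(\<lambda>z. c * f0 z) \<in> A" using A f0 by (auto simp: fspace_def)
      then have "l (\<lambda>z. c * f0 z + fcomb I a g z) = c * l f0 + l (fcomb I a g)"
        using l fA f0 unfolding flinear_def by simp
      moreover have "l (\<lambda>z. c * f0 z + fcomb I a g z) = 0" using c \<open>C \<subseteq> B\<close> B by auto
      ultimately have "c = 0" using l0 f0 by simp
      then show "c = 0 \<and> fcomb I a g \<in> C" using c by simp
    qed
    moreover have "card (insert k I) = n + 1" using I(2) I'(2) k by simp
    ultimately show ?thesis by blast
  qed
  moreover have "card I \<le> n + 1" if I: "qindep A C I g" for I g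
  proof (cases "\<exists>k\<in>I. l (g k) \<noteq> 0")
    case False
    then have "qindep B C I g" using I B by (auto simp: qindep_def)
    then show ?thesis using n by (auto simp: has_qdim_def intro: le_SucI)
  next
    case True
    then obtain k where k: "k \<in> I" "l (g k) \<noteq> 0" by blast
    have fin: "finite I" and gA: "g ` I \<subseteq> A" using I by (auto simp: qindep_def)
    \<comment> \<open>One vector on which \<open>l\<close> does not vanish serves as pivot;
      subtracting multiples of it moves all others into the kernel.\<close>
    define h where "h = (\<lambda>j z. g j z + (- (l (g j) / l (g k))) * g k z)"
    have hB: "h j \<in> B" if "j \<in> I" for j
    proof -
      have 0: "g j \<in> A" "g k \<in> A" using gA that k by auto
      moreover have "(\<lambda>z. (- (l (g j) / l (g k))) * g k z) \<in> A"
        using A 0(2) unfolding fspace_def by blast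
      ultimately have 1: "g j \<in> A" "(\<lambda>z. (- (l (g j) / l (g k))) * g k z) \<in> A" "g k \<in> A" by auto
      have "\<forall>f\<in>A. \<forall>f'\<in>A. (\<lambda>z. f z + f' z) \<in> A" using A by (simp add: fspace_def)
      from this[rule_format, OF 1(1,2)] have "h j \<in> A" by (simp add: h_def)
      moreover have "l (h j) = l (g j) + (- (l (g j) / l (g k))) * l (g k)"
      proof -
        have "\<forall>f\<in>A. \<forall>f'\<in>A. l (\<lambda>z. f z + f' z) = l f + l f'" "\<forall>c. \<forall>f\<in>A. l (\<lambda>z. c * f z) = c * l f"
          using l by (simp_all add: flinear_def)
        from this(1)[rule_format, OF 1(1,2)] this(2)[rule_format, OF 1(3), of "- (l (g j) / l (g k))"]
        show ?thesis unfolding h_def by (simp only:)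
      qed
      ultimately show ?thesis using k B by simp
    qed
    have "qindep B C (I - {k}) h"
      unfolding qindep_def
    proof (intro conjI allI impI)
      show "finite (I - {k})" using fin by simp
      show "h ` (I - {k}) \<subseteq> B" using hB by auto
      fix a assume a: "fcomb (I - {k}) a h \<in> C"
      \<comment> \<open>The coefficient at the pivot collects all the subtracted multiples, so that
        the combination of the old vectors equals that of the new ones.\<close>
      define b where "b = a(k := - (\<Sum>j\<in>I - {k}. a j * (l (g j) / l (g k))))"
      have "fcomb I b g = fcomb (insert k (I - {k})) b g" using k by (simp add: insert_absorb)
      also have "\<dots> = (\<lambda>z. b k * g k z + fcomb (I - {k}) b g z)"
        using fin by (intro fcomb_insert) auto
      also have "\<dots> = (\<lambda>z. b k * g k z + fcomb (I - {k}) a g z)"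
        using fcomb_cong[of "I - {k}" b a g g] by (simp add: b_def)
      also have "\<dots> = fcomb (I - {k}) a h"
      proof -
        define q where "q = (\<lambda>j. l (g j) / l (g k))"
        have bk: "b k = - (\<Sum>j\<in>I - {k}. a j * q j)" by (simp add: b_def q_def)
        have hq: "h = (\<lambda>j z. g j z + (- q j) * g k z)" by (simp add: h_def q_def)
        show ?thesis
          unfolding fcomb_def hq bk
          by (intro ext) (simp add: algebra_simps sum_subtractf sum_distrib_left)
      qed
      finally have "fcomb I b g \<in> C" using a by simp
      then have "\<forall>j\<in>I. b j = 0" using I by (auto simp: qindep_def)
      then show "\<forall>j\<in>I - {k}. a j = 0" by (auto simp: b_def split: if_splits)
    qed
    then have "card (I - {k}) \<le> n" using n by (auto simp: has_qdim_def)
    then show ?thesis using fin k by (simp add: card_Diff_singleton)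
  qed
  ultimately show ?thesis using True by (auto simp: has_qdim_def)
qed

text \<open>The same additivity with the functional on the lower step. If a family is independent
  modulo \<open>C\<close> but not modulo \<open>B\<close>, some combination of it lies in
  \<open>B\<close> outside \<open>C\<close>; dropping one vector that occurs in it restores
  independence modulo \<open>B\<close>.\<close>

lemma has_qdim_kernel_bottom:
  assumes A: "fspace A" and B: "fspace B" and l: "flinear B l" and C: "C = {f \<in> B. l f = 0}" and "B \<subseteq> A"
    and n: "has_qdim A B n"
  shows "has_qdim A C (n + (if \<exists>f\<in>B. l f \<noteq> 0 then 1 else 0))"
proof (cases "\<exists>f\<in>B. l f \<noteq> 0")
  case False
  then have "B = C" using C by auto
  then show ?thesis using n False by simp
next
  case True
  then obtain f0 where f0: "f0 \<in> B" "l f0 \<noteq> 0" by blast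
  have comb: "(\<lambda>z. c * f z + f' z) \<in> B \<and> l (\<lambda>z. c * f z + f' z) = c * l f + l f'" if "f \<in> B" "f' \<in> B" for c f f'
  proof -
    have "(\<lambda>z. c * f z) \<in> B" using B that by (auto simp: fspace_def)
    then show ?thesis using B l that unfolding fspace_def flinear_def by auto
  qed
  have "\<exists>I g. qindep A C I g \<and> card I = n + 1"
  proof -
    obtain I g where I: "qindep A B I g" "card I = n" using n by (auto simp: has_qdim_def)
    then have "finite I" by (auto simp: qindep_def)
    then obtain k where k: "k \<notin> I" using ex_new_if_finite infinite_UNIV_nat by metis
    have "f0 \<in> A" using f0 \<open>B \<subseteq> A\<close> by blast
    have "qindep A C (insert k I) (g(k := f0))"
    proof (rule qindep_extend[OF I(1) k \<open>f0 \<in> A\<close>])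
      fix c a assume c: "(\<lambda>z. c * f0 z + fcomb I a g z) \<in> C"
      then have 1: "(\<lambda>z. c * f0 z + fcomb I a g z) \<in> B" "l (\<lambda>z. c * f0 z + fcomb I a g z) = 0" using C by auto
      have "(\<lambda>z. (- c) * f0 z + (c * f0 z + fcomb I a g z)) \<in> B"
        using comb[OF f0(1) 1(1)] by blast
      then have fB: "fcomb I a g \<in> B" by simp
      then have "c * l f0 + l (fcomb I a g) = 0" using comb[OF f0(1) fB, of c] 1 by simp
      moreover have "\<forall>j\<in>I. a j = 0" using I(1) fB by (auto simp: qindep_def)
      then have "fcomb I a g = (\<lambda>z. 0)" by (simp add: fcomb_def)
      then have "l (fcomb I a g) = 0" using flinear_zero[OF B l] by simp
      ultimately show "c = 0 \<and> fcomb I a g \<in> B" using f0 fB by simp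
    qed
    moreover have "card (insert k I) = n + 1" using I(2) \<open>finite I\<close> k by simp
    ultimately show ?thesis by blast
  qed
  moreover have "card I \<le> n + 1" if I: "qindep A C I g" for I g
  proof (cases "qindep A B I g")
    case True
    then show ?thesis using n by (auto simp: has_qdim_def intro: le_SucI)
  next
    case False
    have fin: "finite I" and gA: "g ` I \<subseteq> A" using I by (auto simp: qindep_def)
    then obtain a k where a: "fcomb I a g \<in> B" and k: "k \<in> I" "a k \<noteq> 0"
      using False by (auto simp: qindep_def)
    have la: "l (fcomb I a g) \<noteq> 0"
    proof
      assume "l (fcomb I a g) = 0"
      then have "fcomb I a g \<in> C" using a C by simp
      then show False using I k by (auto simp: qindep_def)
    qed
    have "qindep A B (I - {k}) g"
      unfolding qindep_def
    proof (intro conjI allI impI)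
      show "finite (I - {k})" using fin by simp
      show "g ` (I - {k}) \<subseteq> A" using gA by auto
      fix c assume c: "fcomb (I - {k}) c g \<in> B"
      define c' where "c' = c(k := 0)"
      have c': "fcomb I c' g = fcomb (I - {k}) c g"
      proof -
        have "fcomb I c' g = fcomb (insert k (I - {k})) c' g" using k by (simp add: insert_absorb)
        also have "\<dots> = (\<lambda>z. c' k * g k z + fcomb (I - {k}) c' g z)"
          using fin by (intro fcomb_insert) auto
        also have "\<dots> = fcomb (I - {k}) c g"
          using fcomb_cong[of "I - {k}" c' c g g] by (simp add: c'_def)
        finally show ?thesis .
      qed
      \<comment> \<open>The multiple that corrects the value of \<open>l\<close> to 0 and so moves
        the combination into \<open>C\<close>. As \<open>c'\<close> vanishes at \<open>k\<close>
        while \<open>a\<close> does not, independence modulo \<open>C\<close> forces this multiple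
        to be 0.\<close>
      let ?r = "- (l (fcomb I c' g) / l (fcomb I a g))"
      have cB: "fcomb I c' g \<in> B" using c c' by simp
      have "(\<lambda>z. ?r * fcomb I a g z + fcomb I c' g z) \<in> C"
        using comb[OF a cB, of ?r] la C by simp
      moreover have "(\<lambda>z. ?r * fcomb I a g z + fcomb I c' g z) = fcomb I (\<lambda>j. ?r * a j + c' j) g"
        unfolding fcomb_def[of I "\<lambda>j. ?r * a j + c' j"]
        by (simp only: distrib_right sum.distrib mult.assoc flip: sum_distrib_left) (simp only: fcomb_def)
      ultimately have z: "\<forall>j\<in>I. ?r * a j + c' j = 0" using I by (auto simp: qindep_def)
      then have "?r * a k + c' k = 0" using k by blast
      then have "?r = 0" using k by (simp add: c'_def)
      then have "\<forall>j\<in>I. c' j = 0" using z by (simp only: mult_zero_left add_0)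
      then show "\<forall>j\<in>I - {k}. c j = 0" by (auto simp: c'_def split: if_splits)
    qed
    then have "card (I - {k}) \<le> n" using n by (auto simp: has_qdim_def)
    then show ?thesis using fin k by (simp add: card_Diff_singleton)
  qed
  ultimately show ?thesis using True by (auto simp: has_qdim_def)
qed

section \<open>Germs along a parametrization\<close>

text \<open>Germs are given by real derivatives commuting with \<i>. The chain rule then produces a
  derivative that is multiplication by a complex number.\<close>

lemma analytic_holo_germ_comp:
  fixes f :: "complex \<Rightarrow> complex^'n"
  assumes g: "holo_germ g" and e0: "0 < e0" and hol: "\<And>k. (\<lambda>t. f t $ k) holomorphic_on ball 0 e0" and f0: "f 0 = 0"
  shows "(g \<circ> f) analytic_on {0}"
proof -
  obtain e1 where e1: "e1 > 0" "\<And>z. z \<in> ball 0 e1 \<Longrightarrow> \<exists>L. (g has_derivative L) (at z) \<and> (\<forall>v. L (\<i> *s v) = \<i> * L v)"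
    using g unfolding holo_germ_def by blast
  \<comment> \<open>Holomorphy is known componentwise, so the vector-valued derivative is assembled
    along the axes.\<close>
  have f_exp: "f = (\<lambda>t. \<Sum>k\<in>UNIV. axis k (f t $ k))"
    by (rule ext) (simp add: vec_eq_iff axis_def if_distrib cong: if_cong)
  have lin: "bounded_linear (axis k :: complex \<Rightarrow> complex^'n)" for k
    unfolding linear_conv_bounded_linear[symmetric]
    by (rule linearI) (auto simp: vec_eq_iff axis_def)
  have df: "\<exists>d. (f has_derivative (\<lambda>h. h *s d)) (at t)" if t: "t \<in> ball 0 e0" for t
  proof -
    have "\<exists>d. ((\<lambda>t. f t $ k) has_field_derivative d) (at t)" for k
      using holomorphic_on_imp_differentiable_at[OF hol open_ball t] by (simp add: field_differentiable_def)
    then obtain d where d: "\<And>k. ((\<lambda>t. f t $ k) has_field_derivative d k) (at t)" by metis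
    have "((\<lambda>t. axis k (f t $ k)) has_derivative (\<lambda>h. axis k (d k * h))) (at t)" for k
      using bounded_linear.has_derivative[OF lin] d[of k] by (simp add: has_field_derivative_def)
    then have "((\<lambda>t. \<Sum>k\<in>UNIV. axis k (f t $ k)) has_derivative (\<lambda>h. \<Sum>k\<in>UNIV. axis k (d k * h))) (at t)"
      by (intro has_derivative_sum) auto
    moreover have "(\<lambda>h. \<Sum>k\<in>UNIV. axis k (d k * h)) = (\<lambda>h. h *s (\<chi> k. d k))"
      by (rule ext) (simp add: vec_eq_iff axis_def if_distrib mult.commute cong: if_cong)
    ultimately show ?thesis using f_exp by metis
  qed
  have "continuous (at 0) f"
    using df[of 0] e0 has_derivative_continuous by auto
  then obtain e where e: "e > 0" "\<And>t. t \<in> ball 0 e \<Longrightarrow> f t \<in> ball 0 e1"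
    using e1(1) f0 unfolding continuous_at_eps_delta by (metis dist_commute mem_ball)
  have "(g \<circ> f) field_differentiable (at t)" if t: "t \<in> ball 0 (min e e0)" for t
  proof -
    obtain d where d: "(f has_derivative (\<lambda>h. h *s d)) (at t)" using df t by auto
    obtain L where L: "(g has_derivative L) (at (f t))" "\<And>v. L (\<i> *s v) = \<i> * L v"
      using e1(2)[OF e(2)[of t]] t by auto
    have linL: "linear L" using L(1) by (simp add: has_derivative_linear)
    have "L (h *s d) = L d * h" for h
    proof -
      have "h *s d = Re h *\<^sub>R d + Im h *\<^sub>R (\<i> *s d)"
        by (simp add: vec_eq_iff scaleR_vec_eq complex_eq_iff algebra_simps)
      then have "L (h *s d) = Re h *\<^sub>R L d + Im h *\<^sub>R L (\<i> *s d)"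
        using linL by (simp add: linear_add linear_scale)
      also have "\<dots> = L d * h"
        using L(2) by (simp add: complex_eq_iff algebra_simps)
      finally show ?thesis .
    qed
    then have "L \<circ> (\<lambda>h. h *s d) = (*) (L d)" by auto
    moreover have "((g \<circ> f) has_derivative (L \<circ> (\<lambda>h. h *s d))) (at t)"
      by (rule diff_chain_at[OF d L(1)])
    ultimately have "((g \<circ> f) has_field_derivative (L d)) (at t)"
      by (simp add: has_field_derivative_def)
    then show ?thesis by (auto simp: field_differentiable_def)
  qed
  then have "(g \<circ> f) holomorphic_on ball 0 (min e e0)"
    by (simp add: holomorphic_on_def field_differentiable_at_within)
  then show ?thesis
    using e(1) e0 by (auto simp: analytic_at_ball intro!: exI[of _ "min e e0"])
qed

lemma holo_germ_zero: "holo_germ (\<lambda>z. 0)"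
  unfolding holo_germ_def by (intro exI[of _ 1]) (auto intro!: exI[of _ "\<lambda>_. 0"])

lemma holo_germ_add:
  assumes "holo_germ f" "holo_germ g"
  shows "holo_germ (\<lambda>z. f z + g z)"
proof -
  obtain a where a: "a > 0" "\<And>z. z \<in> ball 0 a \<Longrightarrow> \<exists>L. (f has_derivative L) (at z) \<and> (\<forall>v. L (\<i> *s v) = \<i> * L v)"
    using assms(1) unfolding holo_germ_def by blast
  obtain b where b: "b > 0" "\<And>z. z \<in> ball 0 b \<Longrightarrow> \<exists>L. (g has_derivative L) (at z) \<and> (\<forall>v. L (\<i> *s v) = \<i> * L v)"
    using assms(2) unfolding holo_germ_def by blast
  have "\<exists>L. ((\<lambda>z. f z + g z) has_derivative L) (at z) \<and> (\<forall>v. L (\<i> *s v) = \<i> * L v)"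
    if z: "z \<in> ball 0 (min a b)" for z
  proof -
    obtain L M where "(f has_derivative L) (at z)" "\<forall>v. L (\<i> *s v) = \<i> * L v"
      "(g has_derivative M) (at z)" "\<forall>v. M (\<i> *s v) = \<i> * M v"
      using a(2)[of z] b(2)[of z] z by auto
    then show ?thesis
      by (intro exI[of _ "\<lambda>v. L v + M v"]) (auto simp: algebra_simps intro!: has_derivative_add)
  qed
  then show ?thesis unfolding holo_germ_def using a(1) b(1) by (intro exI[of _ "min a b"]) auto
qed

lemma holo_germ_scale:
  assumes "holo_germ f"
  shows "holo_germ (\<lambda>z. c * f z)"
proof -
  obtain a where a: "a > 0" "\<And>z. z \<in> ball 0 a \<Longrightarrow> \<exists>L. (f has_derivative L) (at z) \<and> (\<forall>v. L (\<i> *s v) = \<i> * L v)"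
    using assms(1) unfolding holo_germ_def by blast
  have "\<exists>L. ((\<lambda>z. c * f z) has_derivative L) (at z) \<and> (\<forall>v. L (\<i> *s v) = \<i> * L v)"
    if z: "z \<in> ball 0 a" for z
  proof -
    obtain L where "(f has_derivative L) (at z)" "\<forall>v. L (\<i> *s v) = \<i> * L v"
      using a(2)[of z] z by auto
    then show ?thesis
      by (intro exI[of _ "\<lambda>v. c * L v"]) (auto simp: algebra_simps intro!: has_derivative_mult_right)
  qed
  then show ?thesis unfolding holo_germ_def using a(1) by (intro exI[of _ a]) auto
qed

section \<open>Taylor coefficients and the filtration by the spaces J\<close>

lemma enat_le_tord_iff: "enat n \<le> tord f \<longleftrightarrow> (\<forall>k<n. tcoeff f (int k) = 0)"
proof (cases "\<forall>k::nat. tcoeff f (int k) = 0")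
  case True
  then show ?thesis by (simp add: tord_def)
next
  case False
  then have t: "tord f = enat (LEAST k. tcoeff f (int k) \<noteq> 0)" unfolding tord_def by (rule if_not_P)
  show ?thesis
    unfolding t enat_ord_simps
  proof
    assume "n \<le> (LEAST k. tcoeff f (int k) \<noteq> 0)"
    then show "\<forall>k<n. tcoeff f (int k) = 0" by (meson not_less_Least order_less_le_trans)
  next
    assume "\<forall>k<n. tcoeff f (int k) = 0"
    moreover have "tcoeff f (int (LEAST k. tcoeff f (int k) \<noteq> 0)) \<noteq> 0"
      using False by (metis (mono_tags, lifting) LeastI_ex)
    ultimately show "n \<le> (LEAST k. tcoeff f (int k) \<noteq> 0)" by (metis not_le)
  qed
qed

lemma tord_eq_enat_iff: "tord f = enat n \<longleftrightarrow> (\<forall>k<n. tcoeff f (int k) = 0) \<and> tcoeff f (int n) \<noteq> 0"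
proof -
  have "tord f = enat n \<longleftrightarrow> enat n \<le> tord f \<and> \<not> enat (Suc n) \<le> tord f"
    by (cases "tord f") auto
  then show ?thesis unfolding enat_le_tord_iff by (auto simp: less_Suc_eq)
qed

lemma tcoeff_neg: "m < 0 \<Longrightarrow> tcoeff f m = 0"
  by (simp add: tcoeff_def)

lemma tcoeff_zero: "tcoeff (\<lambda>z. 0) m = 0"
  by (simp add: tcoeff_def)

lemma all_less_int_tcoeff: "(\<forall>m<w. tcoeff f m = 0) \<longleftrightarrow> (\<forall>k<nat w. tcoeff f (int k) = 0)"
proof
  assume R: "\<forall>k<nat w. tcoeff f (int k) = 0"
  show "\<forall>m<w. tcoeff f m = 0"
  proof (intro allI impI)
    fix m assume "m < w"
    then show "tcoeff f m = 0" using R[rule_format, of "nat m"] tcoeff_neg[of m f] by (cases "m < 0") auto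
  qed
qed auto

text \<open>Coefficients of negative index are 0 by definition, so the conditions for nonpositive
  exponents hold automatically and need no separate case.\<close>

lemma Jset_eq:
  fixes \<phi> :: "'r \<Rightarrow> complex \<Rightarrow> complex^'n"
  shows "Jset \<phi> w = {g. holo_germ g \<and> (\<forall>i. \<forall>m<w i. tcoeff (g \<circ> \<phi> i) m = 0)}"
proof -
  have "w i \<le> 0 \<or> enat (nat (w i)) \<le> tord (g \<circ> \<phi> i) \<longleftrightarrow> (\<forall>m<w i. tcoeff (g \<circ> \<phi> i) m = 0)" for g :: "complex^'n \<Rightarrow> complex" and i
    unfolding enat_le_tord_iff all_less_int_tcoeff by auto
  then show ?thesis by (simp add: Jset_def)
qed

definition shift :: "('r \<Rightarrow> int) \<Rightarrow> 'r set \<Rightarrow> 'r \<Rightarrow> int" where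
  "shift w I = (\<lambda>i. w i + (if i \<in> I then 1 else 0))"

lemma Jset_shift: "Jset \<phi> (shift w I) = {g \<in> Jset \<phi> w. \<forall>i\<in>I. tcoeff (g \<circ> \<phi> i) (w i) = 0}"
proof -
  have "(\<forall>m<shift w I i. P m) \<longleftrightarrow> (\<forall>m<w i. P m) \<and> (i \<in> I \<longrightarrow> P (w i))" for i P
    unfolding shift_def by (auto simp: order_le_less)
  then show ?thesis unfolding Jset_eq by auto
qed

lemma shift_insert: "i \<notin> I \<Longrightarrow> shift (shift w I) {i} = shift w (insert i I)"
  by (auto simp: shift_def)

text \<open>Analyticity makes Taylor coefficients linear in the germ: additivity of the iterated
  \<open>deriv\<close> is obtained from it.\<close>

locale analytic_branches =
  fixes \<phi> :: "'r::finite \<Rightarrow> complex \<Rightarrow> complex^'n"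
  assumes analytic: "\<And>g i. holo_germ g \<Longrightarrow> (g \<circ> \<phi> i) analytic_on {0}"
begin

abbreviation "tc g i m \<equiv> tcoeff (g \<circ> \<phi> i) m"

text \<open>The dimension of J(w) / J(w + e_i), which is 0 or 1 because a single functional cuts out
  the smaller space.\<close>

definition step :: "('r \<Rightarrow> int) \<Rightarrow> 'r \<Rightarrow> nat" where
  "step w i = (if \<exists>g\<in>Jset \<phi> w. tc g i (w i) \<noteq> 0 then 1 else 0)"

definition xsum :: "'r \<Rightarrow> ('r \<Rightarrow> int) \<Rightarrow> int" where
  "xsum i0 v = (\<Sum>I\<in>Pow (UNIV - {i0}). (-1) ^ card I * int (step (shift v I) i0))"

lemma tc_add: "holo_germ f \<Longrightarrow> holo_germ g \<Longrightarrow> tc (\<lambda>z. f z + g z) i m = tc f i m + tc g i m"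
  using higher_deriv_add_at[OF analytic[of f i] analytic[of g i], of "nat m"]
  by (simp add: tcoeff_def o_def add_divide_distrib)

lemma tc_scale: "holo_germ f \<Longrightarrow> tc (\<lambda>z. c * f z) i m = c * tc f i m"
  using higher_deriv_cmult'[OF analytic[of f i], of "nat m" c]
  by (simp add: tcoeff_def o_def)

lemma fspace_Jset: "fspace (Jset \<phi> w)"
  unfolding fspace_def Jset_eq
  by (auto simp: holo_germ_zero holo_germ_add holo_germ_scale tc_add tc_scale)
     (simp add: o_def tcoeff_zero)

lemma flinear_tc: "flinear (Jset \<phi> w) (\<lambda>g. tc g i m)"
  unfolding flinear_def Jset_eq by (auto simp: tc_add tc_scale)

lemma Jset_shift_insert:
  "i \<notin> I \<Longrightarrow> Jset \<phi> (shift w (insert i I)) = {g \<in> Jset \<phi> (shift w I). tc g i (shift w I i) = 0}"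
  using Jset_shift[of \<phi> "shift w I" "{i}"] shift_insert[of i I w] by auto

text \<open>One condition is added at a time, each costing at most one dimension. The finiteness is
  needed to cancel a common dimension below.\<close>

lemma has_qdim_Jset_shift: "\<exists>n. has_qdim (Jset \<phi> w) (Jset \<phi> (shift w I)) n"
proof -
  have "finite I" by simp
  then show ?thesis
  proof (induction I)
    case empty
    show ?case
      by (rule exI[of _ 0]) (simp add: shift_def has_qdim_refl[OF fspace_Jset])
  next
    case (insert i I)
    then obtain n where n: "has_qdim (Jset \<phi> w) (Jset \<phi> (shift w I)) n" by blast
    have "Jset \<phi> (shift w I) \<subseteq> Jset \<phi> w" unfolding Jset_shift by blast
    then show ?case
      using has_qdim_kernel_bottom[OF fspace_Jset fspace_Jset flinear_tc Jset_shift_insert[OF insert(2)] _ n] by blast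
  qed
qed

text \<open>In the chain J(w), J(w + e_i), J(w + 1), J(w + 1 + e_i), the first dimension compares
  the first space with the third and the other the second with the fourth. The middle quotient, of
  dimension \<open>m\<close>, is common and cancels.\<close>

lemma cdim_diff: "int (cdim \<phi> w) - int (cdim \<phi> (shift w {i})) = int (step w i) - int (step (shift w UNIV) i)"
proof -
  have all1: "(\<lambda>i. w i + 1) = shift w UNIV" for w :: "'r \<Rightarrow> int" by (simp add: shift_def)
  have s: "shift (shift w {i}) (UNIV - {i}) = shift w UNIV"
    "shift (shift w UNIV) {i} = shift (shift w {i}) UNIV" by (auto simp: shift_def)
  obtain m where m: "has_qdim (Jset \<phi> (shift w {i})) (Jset \<phi> (shift w UNIV)) m"
    using has_qdim_Jset_shift[of "shift w {i}" "UNIV - {i}"] unfolding s by blast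
  have sub: "Jset \<phi> (shift w UNIV) \<subseteq> Jset \<phi> (shift w {i})"
    using Jset_shift[of \<phi> "shift w {i}" "UNIV - {i}"] unfolding s by blast
  have eq1: "Jset \<phi> (shift w {i}) = {f \<in> Jset \<phi> w. tc f i (w i) = 0}"
    unfolding Jset_shift by simp
  have eq2: "Jset \<phi> (shift (shift w {i}) UNIV) = {f \<in> Jset \<phi> (shift w UNIV). tc f i (shift w UNIV i) = 0}"
    unfolding s(2)[symmetric] Jset_shift[of \<phi> "shift w UNIV"] by simp
  have "has_qdim (Jset \<phi> w) (Jset \<phi> (shift w UNIV)) (m + step w i)"
    using has_qdim_kernel_top[OF fspace_Jset fspace_Jset flinear_tc eq1 sub m] by (simp add: step_def)
  then have "cdim \<phi> w = m + step w i"
    unfolding cdim_def all1 by (rule quot_dim_eq)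
  moreover have "has_qdim (Jset \<phi> (shift w {i})) (Jset \<phi> (shift (shift w {i}) UNIV)) (m + step (shift w UNIV) i)"
    using has_qdim_kernel_bottom[OF fspace_Jset fspace_Jset flinear_tc eq2 sub m] by (simp add: step_def)
  then have "cdim \<phi> (shift w {i}) = m + step (shift w UNIV) i"
    unfolding cdim_def all1 by (rule quot_dim_eq)
  ultimately show ?thesis by simp
qed

lemma xsum_recursion: "xsum i0 (\<lambda>i. v i - 1) - xsum i0 v = Pprime_coeff \<phi> v"
proof -
  let ?u = "\<lambda>i. v i - 1"
  have "Pprime_coeff \<phi> v = (\<Sum>I\<in>Pow UNIV. (-1) ^ card I * int (cdim \<phi> (shift ?u I)))"
    unfolding Pprime_coeff_def
  \<comment> \<open>Lowering \<open>v\<close> on \<open>S\<close> is the same as raising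
    \<open>v - 1\<close> on the complement of \<open>S\<close>.\<close>
  proof (rule sum.reindex_bij_witness[of _ "\<lambda>I. - I" "\<lambda>I. - I"])
    fix S :: "'r set"
    have "(\<lambda>i. v i - (if i \<in> S then 1 else 0)) = shift ?u (- S)" by (auto simp: shift_def)
    then show "(-1) ^ card (- S) * int (cdim \<phi> (shift ?u (- S)))
        = (-1) ^ card (UNIV - S) * int (cdim \<phi> (\<lambda>i. v i - (if i \<in> S then 1 else 0)))"
      by (simp add: Compl_eq_Diff_UNIV)
  qed auto
  also have "Pow UNIV = Pow (insert i0 (UNIV - {i0}))" by (simp add: insert_absorb)
  also have "(\<Sum>I\<in>\<dots>. (-1) ^ card I * int (cdim \<phi> (shift ?u I)))
     = (\<Sum>I\<in>Pow (UNIV - {i0}). (-1) ^ card I * int (cdim \<phi> (shift ?u I))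
          + (-1) ^ card (insert i0 I) * int (cdim \<phi> (shift ?u (insert i0 I))))"
    by (rule sum_Pow_insert) auto
  also have "\<dots> = (\<Sum>I\<in>Pow (UNIV - {i0}). (-1) ^ card I * int (step (shift ?u I) i0)
       - (-1) ^ card I * int (step (shift v I) i0))"
  proof (rule sum.cong[OF refl])
    fix I assume "I \<in> Pow (UNIV - {i0})"
    then have i0: "i0 \<notin> I" by auto
    have c: "card (insert i0 I) = Suc (card I)" using i0 by simp
    \<comment> \<open>Raising \<open>v - 1\<close> everywhere gives \<open>v\<close>: this turns the
      second step in \<open>cdim_diff\<close> into a term of \<open>xsum\<close> at
      \<open>v\<close>.\<close>
    have s: "shift (shift ?u I) UNIV = shift v I" by (auto simp: shift_def)
    have "(-1) ^ card I * int (cdim \<phi> (shift ?u I)) + (-1) ^ card (insert i0 I) * int (cdim \<phi> (shift ?u (insert i0 I)))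
      = (-1) ^ card I * (int (cdim \<phi> (shift ?u I)) - int (cdim \<phi> (shift (shift ?u I) {i0})))"
      unfolding c shift_insert[OF i0] by (simp add: algebra_simps)
    also have "\<dots> = (-1) ^ card I * int (step (shift ?u I) i0) - (-1) ^ card I * int (step (shift v I) i0)"
      unfolding cdim_diff s by (simp add: algebra_simps)
    finally show "(-1) ^ card I * int (cdim \<phi> (shift ?u I)) + (-1) ^ card (insert i0 I) * int (cdim \<phi> (shift ?u (insert i0 I)))
      = (-1) ^ card I * int (step (shift ?u I) i0) - (-1) ^ card I * int (step (shift v I) i0)" .
  qed
  also have "\<dots> = xsum i0 ?u - xsum i0 v"
    unfolding xsum_def by (rule sum_subtractf)
  finally show ?thesis by simp
qed

text \<open>If \<open>j = i0\<close>, every step concerns a coefficient of negative index and is 0.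
  Otherwise raising a negative exponent at \<open>j\<close> imposes no condition, so the terms of
  \<open>I\<close> and \<open>insert j I\<close> cancel.\<close>

lemma xsum_negative:
  assumes "v j < 0"
  shows "xsum i0 v = 0"
proof (cases "j = i0")
  case True
  have "step (shift v I) i0 = 0" if "I \<in> Pow (UNIV - {i0})" for I
    using that assms True by (auto simp: step_def shift_def tcoeff_neg)
  then show ?thesis by (simp add: xsum_def)
next
  case False
  let ?F = "UNIV - {i0} - {j}"
  have F: "UNIV - {i0} = insert j ?F" using False by auto
  have "xsum i0 v = (\<Sum>I\<in>Pow ?F. (-1) ^ card I * int (step (shift v I) i0)
      + (-1) ^ card (insert j I) * int (step (shift v (insert j I)) i0))"
    unfolding xsum_def by (subst F, rule sum_Pow_insert) auto
  also have "\<dots> = 0"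
  proof (rule sum.neutral, rule ballI)
    fix I assume "I \<in> Pow ?F"
    then have j: "j \<notin> I" by auto
    have "Jset \<phi> (shift v (insert j I)) = Jset \<phi> (shift v I)"
      unfolding Jset_shift_insert[OF j] using assms j by (auto simp: shift_def tcoeff_neg)
    moreover have "shift v (insert j I) i0 = shift v I i0" using False by (simp add: shift_def)
    ultimately have "step (shift v (insert j I)) i0 = step (shift v I) i0" by (simp add: step_def)
    then show "(-1) ^ card I * int (step (shift v I) i0)
      + (-1) ^ card (insert j I) * int (step (shift v (insert j I)) i0) = 0"
      using j by simp
  qed
  finally show ?thesis .
qed

section \<open>Leading coefficient vectors and the projectivised fibre\<close>

text \<open>The image of the map j_w, written with vectors so that the results on complex subspaces
  apply.\<close>

definition leading :: "('r \<Rightarrow> int) \<Rightarrow> (complex^'r) set" where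
  "leading w = (\<lambda>g. \<chi> i. tc g i (w i)) ` Jset \<phi> w"

lemma subspace_leading: "vec.subspace (leading w)"
proof -
  have add: "(\<lambda>z. f z + g z) \<in> Jset \<phi> w" if "f \<in> Jset \<phi> w" "g \<in> Jset \<phi> w" for f g
    using fspace_Jset that by (auto simp: fspace_def)
  have scale: "(\<lambda>z. c * f z) \<in> Jset \<phi> w" if "f \<in> Jset \<phi> w" for f c
    using fspace_Jset that by (auto simp: fspace_def)
  have holo: "holo_germ f" if "f \<in> Jset \<phi> w" for f using that by (simp add: Jset_eq)
  show ?thesis
    unfolding vec.subspace_def
  proof (intro conjI ballI allI)
    have "0 = (\<chi> i. tc (\<lambda>z. 0) i (w i))" by (simp add: vec_eq_iff tcoeff_zero o_def)
    moreover have "(\<lambda>z. 0) \<in> Jset \<phi> w" using fspace_Jset by (auto simp: fspace_def)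
    ultimately show "0 \<in> leading w" unfolding leading_def by blast
  next
    fix x y assume "x \<in> leading w" "y \<in> leading w"
    then obtain f g where fg: "f \<in> Jset \<phi> w" "g \<in> Jset \<phi> w" "x = (\<chi> i. tc f i (w i))" "y = (\<chi> i. tc g i (w i))"
      by (auto simp: leading_def)
    then have "x + y = (\<chi> i. tc (\<lambda>z. f z + g z) i (w i))" by (simp add: vec_eq_iff tc_add holo)
    then show "x + y \<in> leading w" using add[OF fg(1,2)] unfolding leading_def by blast
  next
    fix c x assume "x \<in> leading w"
    then obtain f where f: "f \<in> Jset \<phi> w" "x = (\<chi> i. tc f i (w i))"
      by (auto simp: leading_def)
    then have "c *s x = (\<chi> i. tc (\<lambda>z. c * f z) i (w i))" by (simp add: vec_eq_iff tc_scale holo)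
    then show "c *s x \<in> leading w" using scale[OF f(1)] unfolding leading_def by blast
  qed
qed

text \<open>A nonzero coordinate at \<open>i0\<close> can be scaled to 1 without disturbing the
  vanishing coordinates.\<close>

lemma step_shift_iff:
  assumes "i0 \<notin> I"
  shows "step (shift v I) i0 = (if \<exists>a\<in>{a \<in> leading v. a $ i0 = 1}. \<forall>i\<in>I. a $ i = 0 then 1 else 0)"
proof -
  have s: "shift v I i0 = v i0" using assms by (simp add: shift_def)
  have "(\<exists>g\<in>Jset \<phi> (shift v I). tc g i0 (v i0) \<noteq> 0) \<longleftrightarrow> (\<exists>a\<in>{a \<in> leading v. a $ i0 = 1}. \<forall>i\<in>I. a $ i = 0)"
  proof
    assume "\<exists>g\<in>Jset \<phi> (shift v I). tc g i0 (v i0) \<noteq> 0"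
    then obtain g where g: "g \<in> Jset \<phi> v" "\<And>i. i \<in> I \<Longrightarrow> tc g i (v i) = 0" "tc g i0 (v i0) \<noteq> 0"
      unfolding Jset_shift by blast
    let ?a = "inverse (tc g i0 (v i0)) *s (\<chi> i. tc g i (v i))"
    have "?a \<in> leading v"
      using g(1) by (intro vec.subspace_scale[OF subspace_leading]) (auto simp: leading_def)
    then show "\<exists>a\<in>{a \<in> leading v. a $ i0 = 1}. \<forall>i\<in>I. a $ i = 0"
      using g(2,3) by (intro bexI[of _ ?a]) auto
  next
    assume "\<exists>a\<in>{a \<in> leading v. a $ i0 = 1}. \<forall>i\<in>I. a $ i = 0"
    then obtain g where "g \<in> Jset \<phi> v" "tc g i0 (v i0) = 1" "\<forall>i\<in>I. tc g i (v i) = 0"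
      by (auto simp: leading_def)
    then show "\<exists>g\<in>Jset \<phi> (shift v I). tc g i0 (v i0) \<noteq> 0"
      unfolding Jset_shift by (intro bexI[of _ g]) auto
  qed
  then show ?thesis by (simp add: step_def s)
qed

lemma euler_pair_leading:
  "euler_pair (Alexandroff_compactification (top_of_set {a \<in> {a \<in> leading v. a $ i0 = 1}. \<forall>i. a $ i \<noteq> 0})) {None}
     (xsum i0 v)"
proof -
  let ?A = "{a \<in> leading v. a $ i0 = 1}"
  let ?t = "\<lambda>I::'r set. if \<exists>a\<in>?A. \<forall>i\<in>I. a $ i = 0 then 1 else 0 :: int"
  have "(\<Sum>I\<in>Pow UNIV. (-1) ^ card I * ?t I) = (\<Sum>I\<in>Pow (insert i0 (UNIV - {i0})). (-1) ^ card I * ?t I)"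
    by (simp add: insert_absorb)
  also have "\<dots> = (\<Sum>I\<in>Pow (UNIV - {i0}). (-1) ^ card I * ?t I + (-1) ^ card (insert i0 I) * ?t (insert i0 I))"
    by (rule sum_Pow_insert) auto
  also have "\<dots> = xsum i0 v"
    unfolding xsum_def
  proof (rule sum.cong[OF refl])
    fix I assume "I \<in> Pow (UNIV - {i0})"
    then have "i0 \<notin> I" by auto
    then have "int (step (shift v I) i0) = ?t I"
      by (subst step_shift_iff) (simp_all only: if_distrib[of int] of_nat_1 of_nat_0 not_False_eq_True)
    \<comment> \<open>The normalisation \<open>a $ i0 = 1\<close> excludes every flat on which the
      coordinate \<open>i0\<close> vanishes.\<close>
    moreover have "?t (insert i0 I) = 0" by auto
    ultimately show "(-1) ^ card I * ?t I + (-1) ^ card (insert i0 I) * ?t (insert i0 I)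
        = (-1) ^ card I * int (step (shift v I) i0)" by simp
  qed
  finally have eq: "(\<Sum>I\<in>Pow UNIV. (-1) ^ card I * ?t I) = xsum i0 v" .
  show ?thesis
    using euler_pair_hyperplane_complement[OF subspace_leading[of v], of i0] unfolding eq .
qed

lemma Fset_eq: "Fset \<phi> n = {a. (\<chi> i. a i) \<in> leading (\<lambda>i. int (n i)) \<and> (\<forall>i. a i \<noteq> 0)}"
proof -
  have tord: "(\<forall>i. tord (g \<circ> \<phi> i) = enat (n i)) \<longleftrightarrow>
      (\<forall>i. \<forall>m<int (n i). tc g i m = 0) \<and> (\<forall>i. tc g i (int (n i)) \<noteq> 0)" for g
    unfolding tord_eq_enat_iff all_less_int_tcoeff by auto
  show ?thesis
  proof (rule equalityI; rule subsetI)
    fix a assume "a \<in> Fset \<phi> n"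
    then show "a \<in> {a. (\<chi> i. a i) \<in> leading (\<lambda>i. int (n i)) \<and> (\<forall>i. a i \<noteq> 0)}"
      unfolding Fset_def tord leading_def Jset_eq by auto
  next
    fix a assume "a \<in> {a. (\<chi> i. a i) \<in> leading (\<lambda>i. int (n i)) \<and> (\<forall>i. a i \<noteq> 0)}"
    then obtain g where g: "g \<in> Jset \<phi> (\<lambda>i. int (n i))" "\<And>i. a i = tc g i (int (n i))" "\<forall>i. a i \<noteq> 0"
      by (auto simp: leading_def vec_eq_iff)
    then have "a = (\<lambda>i. tc g i (int (n i)))" by auto
    then show "a \<in> Fset \<phi> n"
      unfolding Fset_def tord using g by (auto simp: Jset_eq)
  qed
qed

text \<open>Dividing by the coordinate \<open>i0\<close> retracts the fibre onto the normalised
  slice, so it is a quotient map. Its fibres are the orbits, and two quotient maps with equal fibres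
  have homeomorphic targets.\<close>

lemma PF_top_homeomorphic:
  "\<exists>h k. homeomorphic_maps (PF_top \<phi> n)
     (top_of_set {a \<in> {a \<in> leading (\<lambda>i. int (n i)). a $ i0 = 1}. \<forall>i. a $ i \<noteq> 0}) h k"
proof -
  let ?L = "leading (\<lambda>i. int (n i))"
  let ?F = "Fset \<phi> n"
  let ?Y = "{a \<in> {a \<in> ?L. a $ i0 = 1}. \<forall>i. a $ i \<noteq> 0}"
  let ?f = "\<lambda>a::'r \<Rightarrow> complex. \<chi> i. a i / a i0"
  let ?s = "\<lambda>x::complex^'r. \<lambda>i. x $ i"
  have "retraction_maps (top_of_set ?F) (top_of_set ?Y) ?f ?s"
    unfolding retraction_maps_def
  proof (intro conjI ballI)
    have proj: "continuous_on ?F (\<lambda>a. a i)" for i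
      by (rule continuous_on_subset[OF continuous_on_product_coordinates]) auto
    have "continuous_on ?F ?f"
      by (intro continuous_on_vec_lambda continuous_on_divide proj) (auto simp: Fset_eq)
    moreover have "?f a \<in> ?Y" if a: "a \<in> ?F" for a
    proof -
      have "?f a = inverse (a i0) *s (\<chi> i. a i)"
        by (simp add: vec_eq_iff divide_inverse mult.commute)
      then have "?f a \<in> ?L" using a vec.subspace_scale[OF subspace_leading] by (simp add: Fset_eq)
      then show ?thesis using a by (simp add: Fset_eq)
    qed
    ultimately show "continuous_map (top_of_set ?F) (top_of_set ?Y) ?f" by auto
    have "continuous_on ?Y ?s"
      by (intro continuous_on_coordinatewise_then_product continuous_intros)
    moreover have "?s x \<in> ?F" if "x \<in> ?Y" for x using that by (simp add: Fset_eq)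
    ultimately show "continuous_map (top_of_set ?Y) (top_of_set ?F) ?s" by auto
    show "?f (?s x) = x" if "x \<in> topspace (top_of_set ?Y)" for x
      using that by (simp add: vec_eq_iff)
  qed
  then have f: "quotient_map (top_of_set ?F) (top_of_set ?Y) ?f"
    using retraction_imp_quotient_map unfolding retraction_map_def by blast
  have g: "quotient_map (top_of_set ?F) (PF_top \<phi> n) Cstar_orbit"
    unfolding PF_top_def by (rule quotient_map_quotient_topology)
  have "Cstar_orbit a = Cstar_orbit b \<longleftrightarrow> ?f a = ?f b" if ab: "a \<in> ?F" "b \<in> ?F" for a b
  proof
    assume "Cstar_orbit a = Cstar_orbit b"
    moreover have "a \<in> Cstar_orbit a" unfolding Cstar_orbit_def by (auto intro!: exI[of _ 1])
    ultimately obtain c where "c \<noteq> 0" "a = (\<lambda>i. c * b i)" unfolding Cstar_orbit_def by auto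
    then show "?f a = ?f b" by simp
  next
    assume eq: "?f a = ?f b"
    have nz: "a i0 \<noteq> 0" "b i0 \<noteq> 0" using ab by (auto simp: Fset_eq)
    define r where "r = a i0 / b i0"
    have r: "r \<noteq> 0" using nz by (simp add: r_def)
    have a_eq: "a i = r * b i" for i
      using eq nz by (simp add: vec_eq_iff r_def field_simps)
    have b_eq: "b i = inverse r * a i" for i using a_eq r by simp
    have "(\<lambda>i. c * a i) \<in> Cstar_orbit b" if "c \<noteq> 0" for c
      unfolding Cstar_orbit_def using that r a_eq by (auto intro!: exI[of _ "c * r"])
    moreover have "(\<lambda>i. c * b i) \<in> Cstar_orbit a" if "c \<noteq> 0" for c
      unfolding Cstar_orbit_def using that r b_eq by (auto intro!: exI[of _ "c * inverse r"])
    ultimately show "Cstar_orbit a = Cstar_orbit b"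
      by (auto simp: Cstar_orbit_def[of a] Cstar_orbit_def[of b])
  qed
  then show ?thesis
    using quotient_maps_same_fibres_homeomorphic[OF g f]
    by (metis (no_types, lifting) topspace_euclidean_subtopology)
qed

lemma X_coeff_eq_xsum: "X_coeff \<phi> v = xsum i0 v"
proof (cases "\<forall>i. 0 \<le> v i")
  case True
  have v: "(\<lambda>i. int (nat (v i))) = v" using True by auto
  obtain h k where hk: "homeomorphic_maps (PF_top \<phi> (\<lambda>i. nat (v i)))
     (top_of_set {a \<in> {a \<in> leading v. a $ i0 = 1}. \<forall>i. a $ i \<noteq> 0}) h k"
    using PF_top_homeomorphic[of "\<lambda>i. nat (v i)" i0, unfolded v] by (elim exE)
  have "euler_char (PF_top \<phi> (\<lambda>i. nat (v i))) = xsum i0 v"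
    by (rule euler_char_eqI[OF euler_pair_Alexandroff_homeomorphic[OF hk euler_pair_leading]])
  then show ?thesis using True by (simp add: X_coeff_def)
next
  case False
  then obtain j where "v j < 0" by (auto simp: not_le)
  then have "xsum i0 v = 0" by (rule xsum_negative)
  then show ?thesis unfolding X_coeff_def using False by (subst if_not_P) auto
qed

lemma X_coeff_eq_Poincare_coeff: "X_coeff \<phi> = Poincare_coeff \<phi>"
proof -
  fix i0 :: 'r
  have X: "X_coeff \<phi> = xsum i0" using X_coeff_eq_xsum by (rule ext)
  let ?P = "\<lambda>Q. (\<forall>v. (\<exists>i. v i < 0) \<longrightarrow> Q v = 0) \<and> (\<forall>v. Q (\<lambda>i. v i - 1) - Q v = Pprime_coeff \<phi> v)"
  have PX: "?P (xsum i0)" using xsum_negative xsum_recursion by blast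
  have uniq: "Q = xsum i0" if Q: "?P Q" for Q
  proof
    \<comment> \<open>Subtracting 1 from all coordinates lowers the one at \<open>i0\<close>, and
      where it is negative both functions vanish. The difference equation therefore determines all
      values upward along each diagonal.\<close>
    have "\<forall>v. v i0 < int n \<longrightarrow> Q v = xsum i0 v" for n
    proof (induction n)
      case 0
      then show ?case using Q xsum_negative by auto
    next
      case (Suc n)
      show ?case
      proof (intro allI impI)
        fix v :: "'r \<Rightarrow> int" assume "v i0 < int (Suc n)"
        then have "Q (\<lambda>i. v i - 1) = xsum i0 (\<lambda>i. v i - 1)" using Suc by simp
        moreover have "Q (\<lambda>i. v i - 1) - Q v = xsum i0 (\<lambda>i. v i - 1) - xsum i0 v"
          using Q xsum_recursion by simp
        ultimately show "Q v = xsum i0 v" by simp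
      qed
    qed
    then show "Q v = xsum i0 v" for v
      by (metis zless_iff_Suc_zadd int_nat_eq less_add_one linorder_not_le nat_le_iff order_less_le_trans zle_iff_zadd)
  qed
  have "(THE Q. ?P Q) = xsum i0" using PX uniq by (rule the_equality)
  then show ?thesis unfolding Poincare_coeff_def X by (rule sym)
qed

end

theorem theorem2:
  fixes \<phi> :: "'r::finite \<Rightarrow> complex \<Rightarrow> complex^'n"
  assumes "curve_parametrization \<phi>"
  shows "X_coeff \<phi> = Poincare_coeff \<phi>"
proof -
  obtain e0 where e0: "e0 > 0" "\<And>i k. (\<lambda>t. \<phi> i t $ k) holomorphic_on ball 0 e0" "\<And>i. \<phi> i 0 = 0"
    using assms unfolding curve_parametrization_def by blast
  interpret analytic_branches \<phi>
    by unfold_locales (rule analytic_holo_germ_comp[OF _ e0])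
  show ?thesis by (rule X_coeff_eq_Poincare_coeff)
qed

end
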